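(* Let $\theta_0\in\Theta$ (i.e. $\rho(A_0)<1$ for $A_0=A_0(\theta_0)$), and assume that the noise $(\xi_n)_{n\ge1}$ satisfies: $r(n)=O(n^{-\alpha_1})$ as $n\to\infty$ for some $\alpha_1>0$; $\int_{-\pi}^{\pi}|\log f_\xi(\lambda)|\,d\lambda<\infty$; and $\beta_n^2=O(n^{-\alpha_2})$ for some $\alpha_2>1$. Let $\phi_n(\theta_0)=\frac1{\sqrt n}Id_p$ and let $I(\theta_0)$ be the unique solution of $I(\theta_0)=A_0I(\theta_0)A_0^*+bb^*$. Then the family $(\mathbb{P}^{(n)}_\theta)$ is locally asymptotically normal at $\theta_0$: for every $R>0$ and every $u\in B(0;R)\subset\mathbb{R}^p$, $$\log\frac{\mathcal L(\theta_0+\phi_n(\theta_0)u,X^{(n)})}{\mathcal L(\theta_0,X^{(n)})}=\Big\langle u,\frac{M_n}{\sqrt n}\Big\rangle-\frac12\langle u,I(\theta_0)u\rangle+R_n(\theta_0,u),$$ where, under $\mathbb{P}^{(n)}_{\theta_0}$, as $n\to\infty$, $\frac{M_n}{\sqrt n}$ converges in law to $\mathcal N(0,I(\theta_0))$ and $R_n(\theta_0,u)$ converges in law to $0$.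
   Context: Fix an integer $p\ge1$. $A^*$ is the transpose of $A$, $Id_p$ the $p\times p$ identity matrix, $\rho(\cdot)$ the spectral radius, $b=(1,0,\dots,0)^*\in\mathbb{R}^p$, $B(0;R)$ the ball of radius $R$ centered at $0$. Noise: $(\xi_n)_{n\ge1}$ is a real stationary centered Gaussian process with covariance function $r(n)=\mathbb{E}(\xi_1\xi_{1+n})$, $r(0)=1$, and spectral density $f_\xi$. Let $\sigma_1\varepsilon_1=\xi_1$, $\sigma_1=1$, and for $n\ge2$, $\sigma_n\varepsilon_n=\xi_n-\mathbb{E}(\xi_n\mid\xi_1,\dots,\xi_{n-1})$, where $\sigma_n>0$ and the $\varepsilon_n$ are i.i.d. $\mathcal N(0,1)$. Write $\sigma_n\varepsilon_n=\sum_{i=1}^n k(n,i)\xi_i$ with deterministic $k(n,i)$, $k(n,n)=1$. For $n\ge1$, $\beta_n=-k(n+1,1)$ (the partial autocorrelation function, PACF, of $(\xi_n)$); by convention $\beta_0=1$ (it plays no role below since $\zeta_0=0$). One has $\sigma_n^2=\prod_{i=1}^{n-1}(1-\beta_i^2)$. Model: $X_n=\sum_{i=1}^p\theta_iX_{n-i}+\xi_n$ for $n\ge1$, with $X_n=0$ for $n\le0$ and $\theta=(\theta_1,\dots,\theta_p)^*\in\mathbb{R}^p$. $A_0=A_0(\theta)$ is the $p\times p$ companion matrix with first row $(\theta_1,\dots,\theta_p)$, ones on the subdiagonal and zeros elsewhere. $\Theta=\{\theta\in\mathbb{R}^p:\rho(A_0(\theta))<1\}$. $X^{(n)}=(X_0,\dots,X_n)$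 and $\mathbb{P}^{(n)}_\theta$ is its law under parameter $\theta$. Let $Y_n=(X_n,\dots,X_{n-p+1})^*$, $Z_n=\sum_{i=1}^nk(n,i)Y_i$, and $\zeta_n=\begin{pmatrix}Z_n\\ \sum_{k=1}^{n-1}\beta_kZ_k\end{pmatrix}\in\mathbb{R}^{2p}$ for $n\ge1$, $\zeta_0=0$. Then $\zeta_n=\widetilde A_{n-1}\zeta_{n-1}+\ell\sigma_n\varepsilon_n$ with $\widetilde A_n=\widetilde A_n(\theta)=\begin{pmatrix}A_0&\beta_nA_0\\ \beta_nId_p&Id_p\end{pmatrix}$ and $\ell=(1,0,\dots,0)^*\in\mathbb{R}^{2p}$. Log-likelihood: $\log\mathcal L(\theta,X^{(n)})=-\frac12\sum_{i=1}^n\Big(\frac{\ell^*(\zeta_i-\widetilde A_{i-1}(\theta)\zeta_{i-1})}{\sigma_i}\Big)^2-\frac n2\log2\pi-\frac12\sum_{i=1}^n\log\sigma_i^2$. With $a_n=(Id_p,\beta_nId_p)^*$ (a $2p\times p$ matrix), $M_n=\sum_{i=1}^n\frac{a_{i-1}^*\zeta_{i-1}\varepsilon_i}{\sigma_i}$, where $\varepsilon_i=\ell^*(\zeta_i-\widetilde A_{i-1}(\theta_0)\zeta_{i-1})/\sigma_i$. *)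

theory Defs
  imports "HOL-Probability.Probability" "HOL-Library.Landau_Symbols"
begin

section \<open>Probabilistic notions\<close>

text \<open>The Gaussian law on the reals with mean \<open>m\<close> and standard deviation \<open>s\<close>; the case
  \<open>s = 0\<close> is the point mass at \<open>m\<close>.\<close>

definition gauss_law :: "real \<Rightarrow> real \<Rightarrow> real measure" where
  "gauss_law m s = distr std_normal_distribution borel (\<lambda>x. m + s * x)"

text \<open>\<open>mv_gauss_law \<mu> m \<Sigma>\<close>: the Borel law \<open>\<mu>\<close> is the (possibly degenerate) multivariate Gaussian
  law with mean \<open>m\<close> and covariance matrix \<open>\<Sigma>\<close>, i.e. every linear functional \<open>x \<mapsto> v \<bullet> x\<close> has
  the one-dimensional Gaussian law with mean \<open>v \<bullet> m\<close> and variance \<open>v \<bullet> \<Sigma> v\<close>.\<close>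

definition mv_gauss_law :: "(real ^ 'n) measure \<Rightarrow> real ^ 'n \<Rightarrow> real ^ 'n ^ 'n \<Rightarrow> bool" where
  "mv_gauss_law \<mu> m \<Sigma> \<longleftrightarrow> prob_space \<mu> \<and> sets \<mu> = sets borel \<and> transpose \<Sigma> = \<Sigma> \<and>
     (\<forall>v. v \<bullet> (\<Sigma> *v v) \<ge> 0 \<and>
          distr \<mu> borel (\<lambda>x. v \<bullet> x) = gauss_law (v \<bullet> m) (sqrt (v \<bullet> (\<Sigma> *v v))))"

definition converges_in_law :: "(nat \<Rightarrow> 'a::topological_space measure) \<Rightarrow> 'a measure \<Rightarrow> bool" where
  "converges_in_law \<mu> \<nu> \<longleftrightarrow>
     (\<forall>f :: 'a \<Rightarrow> real. continuous_on UNIV f \<and> bounded (range f) \<longrightarrow>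
        (\<lambda>n. integral\<^sup>L (\<mu> n) f) \<longlonglongrightarrow> integral\<^sup>L \<nu> f)"


section \<open>The noise\<close>

text \<open>Processes \<open>(\<xi>\<^sub>n)\<close> with \<open>n \<ge> 1\<close> are functions on \<^typ>\<open>nat\<close>; the value at index 0 is
  never used.\<close>

definition gaussian_process :: "'w measure \<Rightarrow> (nat \<Rightarrow> 'w \<Rightarrow> real) \<Rightarrow> bool" where
  "gaussian_process M \<xi> \<longleftrightarrow>
     (\<forall>n\<ge>1. \<xi> n \<in> borel_measurable M) \<and>
     (\<forall>J c. finite J \<and> J \<subseteq> {1..} \<longrightarrow>
        (\<exists>m s. s \<ge> 0 \<and> distr M borel (\<lambda>\<omega>. \<Sum>j\<in>J. c j * \<xi> j \<omega>) = gauss_law m s))"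

definition stationary_process :: "'w measure \<Rightarrow> (nat \<Rightarrow> 'w \<Rightarrow> real) \<Rightarrow> bool" where
  "stationary_process M \<xi> \<longleftrightarrow>
     (\<forall>n h. distr M (PiM {1..n} (\<lambda>_. borel)) (\<lambda>\<omega>. \<lambda>i\<in>{1..n}. \<xi> (i + h) \<omega>) =
            distr M (PiM {1..n} (\<lambda>_. borel)) (\<lambda>\<omega>. \<lambda>i\<in>{1..n}. \<xi> i \<omega>))"

definition centered_process :: "'w measure \<Rightarrow> (nat \<Rightarrow> 'w \<Rightarrow> real) \<Rightarrow> bool" where
  "centered_process M \<xi> \<longleftrightarrow> (\<forall>n\<ge>1. integral\<^sup>L M (\<xi> n) = 0)"

definition autocov :: "'w measure \<Rightarrow> (nat \<Rightarrow> 'w \<Rightarrow> real) \<Rightarrow> nat \<Rightarrow> real" where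
  "autocov M \<xi> n = (\<integral>\<omega>. \<xi> 1 \<omega> * \<xi> (1 + n) \<omega> \<partial>M)"

text \<open>Normalisation \<open>r(n) = \<integral>\<^bsub>[-\<pi>,\<pi>]\<^esub> e\<^bsup>i n t\<^esup> f(t) dt\<close>. As \<open>f\<close> and \<open>r\<close> are real, the
  identity for \<open>n \<ge> 0\<close> implies the one for \<open>-n\<close>.\<close>

definition spectral_density :: "(nat \<Rightarrow> real) \<Rightarrow> (real \<Rightarrow> real) \<Rightarrow> bool" where
  "spectral_density r f \<longleftrightarrow>
     set_integrable lborel {-pi..pi} f \<and>
     (\<forall>t\<in>{-pi..pi}. f t \<ge> 0) \<and>
     (\<forall>n. complex_of_real (r n) = (CLINT t:{-pi..pi}|lborel. exp (\<i> * of_real (real n * t)) * of_real (f t)))"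

text \<open>\<open>\<integral>\<^bsub>[-\<pi>,\<pi>]\<^esub> |log f| < \<infinity>\<close> with the convention \<open>log 0 = -\<infinity>\<close>. Since \<open>ln 0 = 0\<close> in HOL, positivity
  almost everywhere has to be stated separately.\<close>

definition log_integrable :: "(real \<Rightarrow> real) \<Rightarrow> bool" where
  "log_integrable f \<longleftrightarrow>
     (AE t in lborel. t \<in> {-pi..pi} \<longrightarrow> f t > 0) \<and>
     set_integrable lborel {-pi..pi} (\<lambda>t. ln (f t))"

text \<open>The sigma-algebra generated by \<open>\<xi>\<^sub>1, \<dots>, \<xi>\<^bsub>n-1\<^esub>\<close>.\<close>

definition past :: "'w measure \<Rightarrow> (nat \<Rightarrow> 'w \<Rightarrow> real) \<Rightarrow> nat \<Rightarrow> 'w measure" where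
  "past M \<xi> n = vimage_algebra (space M) (\<lambda>\<omega>. \<lambda>i\<in>{1..<n}. \<xi> i \<omega>) (PiM {1..<n} (\<lambda>_. borel))"

text \<open>\<open>\<sigma>\<^sub>n \<epsilon>\<^sub>n = \<xi>\<^sub>n - E(\<xi>\<^sub>n | \<xi>\<^sub>1, \<dots>, \<xi>\<^bsub>n-1\<^esub>)\<close>. For \<open>n = 1\<close> the past is trivial, so this is
  \<open>\<xi>\<^sub>1\<close> almost surely when the process is centered.\<close>

definition innovation :: "'w measure \<Rightarrow> (nat \<Rightarrow> 'w \<Rightarrow> real) \<Rightarrow> nat \<Rightarrow> 'w \<Rightarrow> real" where
  "innovation M \<xi> n \<omega> = \<xi> n \<omega> - real_cond_exp M (past M \<xi> n) (\<xi> n) \<omega>"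

text \<open>\<open>\<sigma>\<^sub>n\<close> is determined by \<open>\<sigma>\<^sub>n > 0\<close> and \<open>\<epsilon>\<^sub>n\<close> having unit variance.\<close>

definition innov_sd :: "'w measure \<Rightarrow> (nat \<Rightarrow> 'w \<Rightarrow> real) \<Rightarrow> nat \<Rightarrow> real" where
  "innov_sd M \<xi> n = sqrt (\<integral>\<omega>. (innovation M \<xi> n \<omega>)\<^sup>2 \<partial>M)"

text \<open>The deterministic coefficients \<open>k(n,i)\<close> with \<open>k(n,n) = 1\<close> and
  \<open>\<sigma>\<^sub>n \<epsilon>\<^sub>n = \<Sum>\<^sub>i k(n,i) \<xi>\<^sub>i\<close>. They are unique for \<open>1 \<le> i \<le> n\<close> when the covariance matrix of
  \<open>\<xi>\<^sub>1, \<dots>, \<xi>\<^bsub>n-1\<^esub>\<close> is nonsingular; values at other \<open>i\<close> are arbitrary and never used.\<close>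

definition innov_coeff :: "'w measure \<Rightarrow> (nat \<Rightarrow> 'w \<Rightarrow> real) \<Rightarrow> nat \<Rightarrow> nat \<Rightarrow> real" where
  "innov_coeff M \<xi> n = (SOME c. c n = 1 \<and>
     (AE \<omega> in M. innovation M \<xi> n \<omega> = (\<Sum>i=1..n. c i * \<xi> i \<omega>)))"

definition pacf :: "(nat \<Rightarrow> nat \<Rightarrow> real) \<Rightarrow> nat \<Rightarrow> real" where
  "pacf k n = (if n = 0 then 1 else - k (n + 1) 1)"


section \<open>The autoregressive model\<close>

text \<open>Vectors in \<open>\<real>\<^sup>p\<close> are of type \<open>real ^ 'p\<close> where \<open>'p\<close> is a finite linearly ordered type with
  \<open>p\<close> elements; \<open>pos i \<in> {1..p}\<close> is the number of the coordinate \<open>i\<close>. Vectors in \<open>\<real>\<^bsup>2p\<^esup>\<close> are indexed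
  by \<open>'p + 'p\<close>.\<close>

definition pos :: "'p::{finite,linorder} \<Rightarrow> nat" where
  "pos i = card {..i}"

lemma pos_pos: "0 < pos i"
  unfolding pos_def by (auto simp: card_gt_0_iff)

definition first_unit :: "real ^ 'p::{finite,linorder}" where
  "first_unit = (\<chi> i. if pos i = 1 then 1 else 0)"

definition stack :: "real ^ 'p \<Rightarrow> real ^ 'p \<Rightarrow> real ^ ('p + 'p)" where
  "stack v w = (\<chi> j. case j of Inl i \<Rightarrow> v $ i | Inr i \<Rightarrow> w $ i)"

definition companion :: "real ^ 'p::{finite,linorder}
    \<Rightarrow> real ^ 'p::{finite,linorder} ^ 'p::{finite,linorder}" where
  "companion \<theta> = (\<chi> i j. if pos i = 1 then \<theta> $ j else if pos i = pos j + 1 then 1 else 0)"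

definition spectral_radius :: "real ^ 'n ^ 'n \<Rightarrow> real" where
  "spectral_radius A =
     Max (cmod ` {z. \<exists>v. v \<noteq> 0 \<and> map_matrix complex_of_real A *v v = z *s v})"

definition stable_params :: "(real ^ 'p::{finite,linorder}) set" where
  "stable_params = {\<theta>. spectral_radius (companion \<theta>) < 1}"

text \<open>The solution of \<open>X\<^sub>n = \<Sum>\<^sub>i \<theta>\<^sub>i X\<^bsub>n-i\<^esub> + e\<^sub>n\<close> for \<open>n \<ge> 1\<close>, with \<open>X\<^sub>n = 0\<close> for \<open>n \<le> 0\<close>.\<close>

function ar_path :: "real ^ 'p::{finite,linorder} \<Rightarrow> (nat \<Rightarrow> real) \<Rightarrow> nat \<Rightarrow> real" where
  "ar_path \<theta> e n = (if n = 0 then 0 else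
     (\<Sum>i\<in>UNIV. if pos i < n then \<theta> $ i * ar_path \<theta> e (n - pos i) else 0) + e n)"
  by pat_completeness auto
termination
  by (relation "Wellfounded.measure (\<lambda>(\<theta>, e, n). n)") (auto simp: pos_pos)

declare ar_path.simps [simp del]

text \<open>The law of \<open>(X\<^sub>0, \<dots>, X\<^sub>n)\<close> under the parameter \<open>\<theta>\<close>.\<close>

definition ar_law ::
    "'w measure \<Rightarrow> (nat \<Rightarrow> 'w \<Rightarrow> real) \<Rightarrow> real ^ 'p::{finite,linorder} \<Rightarrow> nat \<Rightarrow> (nat \<Rightarrow> real) measure" where
  "ar_law M \<xi> \<theta> n = distr M (PiM {0..n} (\<lambda>_. borel))
     (\<lambda>\<omega>. \<lambda>i\<in>{0..n}. ar_path \<theta> (\<lambda>m. \<xi> m \<omega>) i)"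


section \<open>Likelihood and score\<close>

text \<open>Below \<open>x\<close> is an observed path, \<open>k\<close> the innovation coefficients and \<open>s n\<close> stands for \<open>\<sigma>\<^sub>n\<close>.
  All quantities at time \<open>n\<close> depend on \<open>x 0, \<dots>, x n\<close> only.\<close>

definition lag_vec :: "(nat \<Rightarrow> real) \<Rightarrow> nat \<Rightarrow> real ^ 'p::{finite,linorder}" where
  "lag_vec x n = (\<chi> i. if pos i \<le> n + 1 then x (n + 1 - pos i) else 0)"

definition Z_vec :: "(nat \<Rightarrow> nat \<Rightarrow> real) \<Rightarrow> (nat \<Rightarrow> real) \<Rightarrow> nat \<Rightarrow> real ^ 'p::{finite,linorder}" where
  "Z_vec k x n = (\<Sum>i=1..n. k n i *\<^sub>R lag_vec x i)"

definition zeta :: "(nat \<Rightarrow> nat \<Rightarrow> real) \<Rightarrow> (nat \<Rightarrow> real) \<Rightarrow> nat \<Rightarrow> real ^ ('p::{finite,linorder} + 'p)" where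
  "zeta k x n = (if n = 0 then 0 else
     stack (Z_vec k x n) (\<Sum>j=1..<n. pacf k j *\<^sub>R Z_vec k x j))"

definition A_tilde ::
    "(nat \<Rightarrow> nat \<Rightarrow> real) \<Rightarrow> real ^ 'p::{finite,linorder} \<Rightarrow> nat \<Rightarrow> real ^ ('p + 'p) ^ ('p + 'p)" where
  "A_tilde k \<theta> n = (\<chi> row col. case row of
      Inl i \<Rightarrow> (case col of Inl j \<Rightarrow> companion \<theta> $ i $ j
                        | Inr j \<Rightarrow> pacf k n * companion \<theta> $ i $ j)
    | Inr i \<Rightarrow> (case col of Inl j \<Rightarrow> pacf k n * mat 1 $ i $ j
                        | Inr j \<Rightarrow> mat 1 $ i $ j))"

text \<open>The \<open>2p \<times> p\<close> matrix \<open>a\<^sub>n = (Id, \<beta>\<^sub>n Id)\<^sup>*\<close>.\<close>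

definition a_mat :: "(nat \<Rightarrow> nat \<Rightarrow> real) \<Rightarrow> nat \<Rightarrow> real ^ 'p ^ ('p + 'p)" where
  "a_mat k n = (\<chi> row j. case row of Inl i \<Rightarrow> mat 1 $ i $ j | Inr i \<Rightarrow> pacf k n * mat 1 $ i $ j)"

definition residual ::
    "(nat \<Rightarrow> nat \<Rightarrow> real) \<Rightarrow> (nat \<Rightarrow> real) \<Rightarrow> real ^ 'p::{finite,linorder} \<Rightarrow> (nat \<Rightarrow> real) \<Rightarrow> nat \<Rightarrow> real" where
  "residual k s \<theta> x i =
     stack (first_unit :: real ^ 'p::{finite,linorder}) 0
       \<bullet> (zeta k x i - A_tilde k \<theta> (i - 1) *v zeta k x (i - 1)) / s i"

definition log_likelihood ::
    "(nat \<Rightarrow> nat \<Rightarrow> real) \<Rightarrow> (nat \<Rightarrow> real) \<Rightarrow> nat \<Rightarrow> real ^ 'p::{finite,linorder} \<Rightarrow> (nat \<Rightarrow> real) \<Rightarrow> real" where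
  "log_likelihood k s n \<theta> x =
     - (1/2) * (\<Sum>i=1..n. (residual k s \<theta> x i)\<^sup>2) - real n / 2 * ln (2 * pi)
     - (1/2) * (\<Sum>i=1..n. ln ((s i)\<^sup>2))"

definition likelihood ::
    "(nat \<Rightarrow> nat \<Rightarrow> real) \<Rightarrow> (nat \<Rightarrow> real) \<Rightarrow> nat \<Rightarrow> real ^ 'p::{finite,linorder} \<Rightarrow> (nat \<Rightarrow> real) \<Rightarrow> real" where
  "likelihood k s n \<theta> x = exp (log_likelihood k s n \<theta> x)"

text \<open>\<open>M\<^sub>n\<close>; under the parameter \<open>\<theta>\<close> the residual at time \<open>i\<close> is \<open>\<epsilon>\<^sub>i\<close>.\<close>

definition score ::
    "(nat \<Rightarrow> nat \<Rightarrow> real) \<Rightarrow> (nat \<Rightarrow> real) \<Rightarrow> real ^ 'p::{finite,linorder} \<Rightarrow> nat \<Rightarrow> (nat \<Rightarrow> real) \<Rightarrow> real ^ 'p::{finite,linorder}" where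
  "score k s \<theta> n x =
     (\<Sum>i=1..n. (residual k s \<theta> x i / s i) *\<^sub>R (transpose (a_mat k (i - 1)) *v zeta k x (i - 1)))"

definition rate :: "nat \<Rightarrow> real ^ 'p ^ 'p" where
  "rate n = (1 / sqrt (real n)) *\<^sub>R mat 1"

definition is_fisher_info :: "real ^ 'p::{finite,linorder} \<Rightarrow> real ^ 'p::{finite,linorder} ^ 'p::{finite,linorder} \<Rightarrow> bool" where
  "is_fisher_info \<theta> I \<longleftrightarrow>
     I = companion \<theta> ** I ** transpose (companion \<theta>)
         + columnvector first_unit ** (rowvector first_unit :: real ^ 'p::{finite,linorder} ^ 1)"

definition fisher_info :: "real ^ 'p::{finite,linorder} \<Rightarrow> real ^ 'p::{finite,linorder} ^ 'p::{finite,linorder}" where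
  "fisher_info \<theta> = (THE I. is_fisher_info \<theta> I)"

end

theory Submission
  imports Defs "HOL-Computational_Algebra.Fundamental_Theorem_Algebra"
begin

text \<open>Writing \<open>W\<^sub>i = a\<^sup>*\<^bsub>i-1\<^esub> \<zeta>\<^bsub>i-1\<^esub>\<close>, the residual is affine in the
  parameter, so the log-likelihood ratio is exactly \<open>\<langle>u, M\<^sub>n/\<surd>n\<rangle> - q\<^sub>n(u)/2\<close> with
  \<open>q\<^sub>n(u) = (1/n) \<Sum>\<^sub>i \<langle>u, W\<^sub>i/\<sigma>\<^sub>i\<rangle>\<^sup>2\<close>. The Levinson recursion turns \<open>W\<close> into an autoregression
  driven by the independent innovations, \<open>W\<^bsub>n+1\<^esub> = A\<^sub>0 W\<^sub>n + \<sigma>\<^sub>n \<epsilon>\<^sub>n b + \<beta>\<^sub>n \<Sum>\<^bsub>j<n\<^esub> \<beta>\<^sub>j Z\<^sub>j\<close>, whose last term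
  tends to 0 in \<open>L\<^sup>2\<close> because \<open>n \<beta>\<^sub>n\<^sup>2 \<longlongrightarrow> 0\<close>. Comparing \<open>q\<^sub>n(v)\<close> with \<open>q\<^sub>n(A\<^sub>0\<^sup>* v)\<close> gives
  \<open>q\<^sub>n(v) - q\<^sub>n(A\<^sub>0\<^sup>* v) \<longlongrightarrow> \<langle>v, b\<rangle>\<^sup>2\<close> in \<open>L\<^sup>1\<close>, and iterating, \<open>q\<^sub>n(v) \<longlongrightarrow> \<langle>v, I(\<theta>\<^sub>0) v\<rangle>\<close>. As the
  innovations are exactly Gaussian, stopped exponential martingales turn this into convergence of
  the characteristic functions of \<open>M\<^sub>n/\<surd>n\<close>.

  The innovation coefficients are identified with those of the Levinson recursion, for which
  \<open>\<sigma>\<^sub>n > 0\<close> because \<open>r \<longlongrightarrow> 0\<close>.\<close>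

section \<open>Geometric decay of matrix powers\<close>

text \<open>Three difficulties shape the details. The coefficients \<beta>_n need not be absolutely
  summable, since \<beta>_n^2 may decay hardly faster than 1/n; by Cauchy-Schwarz, |\<beta>_n| times
  the sum of |\<beta>_j| over j < n is at most the root of n \<beta>_n^2 times the sum of all
  \<beta>_j^2, and this is where \<alpha>_2 > 1 enters. Next, the memory term feeds all earlier
  values back into \<open>W\<close>, so its uniform L^2 bound has to be a bootstrap: the feedback
  factor tends to 0, and from some time on a bound on the past reproduces itself. Finally,
  \<open>W\<close> is not stationary. The difference of q_n at v and at A^T v is nevertheless
  explicit: up to a boundary term it consists of martingale sums of order sqrt n and of averages of
  errors that vanish in L^2, and after j iterations the remainder is small uniformly in n because
  the powers of A^T decay geometrically. In the central limit theorem the factor exp(g^2 / 2)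
  compensates the characteristic function of an innovation exactly, so that only the quadratic
  variation has to be controlled.\<close>

context
  fixes B :: "complex ^ 'n ^ 'n"
begin

text \<open>The vector p(B) v by Horner's scheme; polynomials act on vectors throughout, which keeps
  the induction on the degree elementary.\<close>

definition poly_app :: "complex poly \<Rightarrow> complex ^ 'n \<Rightarrow> complex ^ 'n" where
  "poly_app p v = fold_coeffs (\<lambda>a w. a *s v + B *v w) p 0"

lemma poly_app_0 [simp]: "poly_app 0 v = 0"
  by (simp add: poly_app_def)

lemma poly_app_pCons [simp]: "poly_app (pCons a p) v = a *s v + B *v poly_app p v"
proof (cases "p = 0 \<and> a = 0")
  case False
  then show ?thesis by (auto simp: poly_app_def)
qed auto

lemma matrix_scale: "B *v (c *s v) = c *s (B *v v)"
  by (simp add: vector_scalar_commute)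

lemma poly_app_add: "poly_app (p + q) v = poly_app p v + poly_app q v"
proof (induction p arbitrary: q)
  case (pCons a p)
  then show ?case
    by (cases q) (simp add: vec.scale_left_distrib matrix_vector_right_distrib add_ac)
qed auto

lemma poly_app_smult: "poly_app (smult c p) v = c *s poly_app p v"
  by (induction p) (auto simp: vec.scale_right_distrib matrix_scale)

lemma poly_app_monom: "poly_app (monom c i) v = c *s ((*v) B ^^ i) v"
  by (induction i) (auto simp: monom_0 monom_Suc matrix_scale)

lemma poly_app_sum: "finite S \<Longrightarrow> poly_app (sum f S) v = (\<Sum>i\<in>S. poly_app (f i) v)"
  by (induction S rule: finite_induct) (auto simp: poly_app_add)

lemma poly_app_diff_vec: "poly_app p (v - w) = poly_app p v - poly_app p w"
  by (induction p) (auto simp: vec.scale_right_diff_distrib matrix_vector_mult_diff_distrib)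

lemma poly_app_scale_vec: "poly_app p (c *s v) = c *s poly_app p v"
  by (induction p) (auto simp: vec.scale_right_distrib matrix_scale mult.commute)

lemma poly_app_matrix: "poly_app p (B *v v) = B *v poly_app p v"
  by (induction p) (auto simp: matrix_vector_right_distrib matrix_scale)

lemma poly_app_linear_factor:
  "poly_app ([:-l, 1:] * p) v = B *v poly_app p v - l *s poly_app p v"
proof -
  have "[:-l, 1:] * p = smult (-l) p + pCons 0 p" by simp
  then show ?thesis by (simp only: poly_app_add poly_app_smult poly_app_pCons) simp
qed

lemma poly_app_eigenvector: "B *v v = z *s v \<Longrightarrow> poly_app p v = poly p z *s v"
  by (induction p) (auto simp: matrix_scale vec.scale_left_distrib mult.commute)

text \<open>N + 1 powers of \<open>B\<close> in a space of real dimension N are linearly dependent.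
  The dimension is the real one, so the coefficients are real numbers embedded in the complex
  ones.\<close>

lemma ex_annihilating_poly: "\<exists>q. q \<noteq> 0 \<and> (\<forall>v. poly_app q v = 0)"
proof -
  define P where "P i = matrix (((*v) B ^^ i))" for i
  have lin: "Vector_Spaces.linear (*s) (*s) ((*v) B ^^ i)" for i
  proof (induction i)
    case 0 then show ?case by (simp add: id_def vec.linear_id[unfolded id_def])
  next
    case (Suc i)
    have "Vector_Spaces.linear (*s) (*s) ((*v) B)" by (rule matrix_vector_mul_linear_gen)
    from Vector_Spaces.linear_compose[OF Suc this] show ?case by (simp add: comp_def)
  qed
  have P: "P i *v v = ((*v) B ^^ i) v" for i v
    unfolding P_def by (rule matrix_works[OF lin])
  define N where "N = DIM(complex^'n^'n)"
  have "\<exists>c. (\<exists>i\<le>N. c i \<noteq> 0) \<and> (\<Sum>i\<le>N. c i *\<^sub>R P i) = 0"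
  proof (cases "inj_on P {..N}")
    case True
    have "card (P ` {..N}) > DIM(complex^'n^'n)" using card_image[OF True] by (simp add: N_def)
    then have "dependent (P ` {..N})" by (intro dependent_biggerset) auto
    then obtain u where u: "\<exists>v\<in>P ` {..N}. u v \<noteq> 0" "(\<Sum>v\<in>P ` {..N}. u v *\<^sub>R v) = 0"
      by (subst (asm) dependent_finite) auto
    have "(\<Sum>i\<le>N. u (P i) *\<^sub>R P i) = 0" using u(2) by (subst (asm) sum.reindex[OF True]) auto
    then show ?thesis using u(1) by (intro exI[of _ "u \<circ> P"]) auto
  next
    \<comment> \<open>Coinciding powers make the set of powers too small for the dimension count,
      but \<open>P i = P j\<close> is already a relation.\<close>
    case False
    then obtain i j where ij: "i \<le> N" "j \<le> N" "i \<noteq> j" "P i = P j" by (auto simp: inj_on_def)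
    define c :: "nat \<Rightarrow> real" where "c m = (if m = i then 1 else 0) - (if m = j then 1 else 0)" for m
    have "(\<Sum>m\<le>N. c m *\<^sub>R P m) = (\<Sum>m\<le>N. (if m = i then P m else 0) - (if m = j then P m else 0))"
      by (intro sum.cong) (auto simp: c_def)
    also have "\<dots> = 0" using ij by (simp add: sum_subtractf sum.delta)
    finally show ?thesis using ij by (intro exI[of _ c]) (auto simp: c_def)
  qed
  then obtain c j where c: "j \<le> N" "c j \<noteq> 0" "(\<Sum>i\<le>N. c i *\<^sub>R P i) = 0" by auto
  define q where "q = (\<Sum>i\<le>N. monom (complex_of_real (c i)) i)"
  have "coeff q j \<noteq> 0" using c(1,2) by (simp add: q_def coeff_sum sum.delta)
  moreover have "poly_app q v = 0" for v
  proof -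
    have "poly_app q v = (\<Sum>i\<le>N. complex_of_real (c i) *s (P i *v v))"
      by (simp add: q_def poly_app_sum poly_app_monom P)
    also have "\<dots> = (\<Sum>i\<le>N. (c i *\<^sub>R P i) *v v)"
      by (intro sum.cong refl) (simp add: vec_eq_iff matrix_vector_mult_def sum_distrib_left scaleR_conv_of_real[where 'a=complex] mult_ac)
    also have "\<dots> = (\<Sum>i\<le>N. c i *\<^sub>R P i) *v v"
      by (simp add: matrix_vector_mult_def vec_eq_iff sum_distrib_right sum_component) (subst sum.swap, simp)
    finally show ?thesis using c by simp
  qed
  ultimately show ?thesis by (intro exI[of _ q]) auto
qed

text \<open>\<open>spectral_radius\<close> is a \<open>Max\<close>, so it bounds the eigenvalues
  only once their set is known to be finite; they are roots of an annihilating polynomial.\<close>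

lemma finite_eigenvalues: "finite {z. \<exists>v. v \<noteq> 0 \<and> B *v v = z *s v}"
proof -
  obtain q where q: "q \<noteq> 0" "\<And>v. poly_app q v = 0" using ex_annihilating_poly by auto
  have "{z. \<exists>v. v \<noteq> 0 \<and> B *v v = z *s v} \<subseteq> {z. poly q z = 0}"
    using q(2) poly_app_eigenvector[where p=q] by auto
  then show ?thesis using poly_roots_finite[OF q(1)] finite_subset by blast
qed

lemma norm_scale_vec: "norm (c *s v) = cmod c * norm (v :: complex ^ 'n)"
proof -
  have "norm (c *s v) = L2_set (\<lambda>i. cmod c * norm (v $ i)) UNIV"
    by (simp add: norm_vec_def norm_mult)
  then show ?thesis by (simp add: norm_vec_def L2_set_right_distrib)
qed

lemma funpow_matrix_diff: "((*v) B ^^ k) (v - w) = ((*v) B ^^ k) v - ((*v) B ^^ k) w"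
  by (induction k) (auto simp: matrix_vector_mult_diff_distrib)

lemma funpow_matrix_scale: "((*v) B ^^ k) (c *s v) = c *s ((*v) B ^^ k) v"
  by (induction k) (auto simp: matrix_scale)

text \<open>A root l is split off: q = (X - l) q'. Either q' already annihilates v, or q'(B) v is an
  eigenvector and |l| < 1; then w = (B - l) v is annihilated by q' and decays by induction, and
  B^(k+1) v = l B^k v + B^k w carries the decay over to v. The vector varies in the induction
  because w replaces v.\<close>

lemma decay_of_annihilated:
  assumes eig: "\<And>z v. v \<noteq> 0 \<Longrightarrow> B *v v = z *s v \<Longrightarrow> cmod z < 1"
  shows "q \<noteq> 0 \<Longrightarrow> poly_app q v = 0 \<Longrightarrow>
    \<exists>C r. 0 < r \<and> r < 1 \<and> (\<forall>k. norm (((*v) B ^^ k) v) \<le> C * r ^ k)"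
proof (induction "degree q" arbitrary: q v)
  case 0
  then obtain a where "q = [:a:]" by (metis degree_eq_zeroE)
  then have "v = 0" using 0 by auto
  then have "((*v) B ^^ k) v = 0" for k by (induction k) auto
  then show ?case by (intro exI[of _ 0] exI[of _ "1/2"]) auto
next
  case (Suc n)
  obtain l where "poly q l = 0"
    using alg_closed_imp_poly_has_root[of q] Suc(2) by auto
  then obtain q' where q': "q = [:-l, 1:] * q'" by (auto simp: poly_eq_0_iff_dvd)
  then have q'0: "q' \<noteq> 0" using Suc(3) by auto
  then have deg: "n = degree q'" using Suc(2) unfolding q' by (subst (asm) degree_mult_eq) auto
  have z: "B *v poly_app q' v = l *s poly_app q' v"
    using Suc(4) unfolding q' poly_app_linear_factor by simp
  show ?case
  proof (cases "poly_app q' v = 0")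
    case True
    then show ?thesis using Suc(1)[OF deg q'0] by auto
  next
    case False
    then have l: "cmod l < 1" using eig z by auto
    define w where "w = B *v v - l *s v"
    have "poly_app q' w = 0"
      by (simp add: w_def poly_app_diff_vec poly_app_matrix poly_app_scale_vec z)
    then obtain C s where s: "0 < s" "s < 1" "\<And>k. norm (((*v) B ^^ k) w) \<le> C * s ^ k"
      using Suc(1)[OF deg q'0] by blast
    have C0: "C \<ge> 0" using order_trans[OF norm_ge_zero s(3)[of 0]] by simp
    \<comment> \<open>A rate strictly above both s and |l| absorbs the factor k that appears when
      the two coincide; \<open>D\<close> is chosen so that |l| D + C \<le> r D, which is the
      induction step.\<close>
    define r where "r = (max s (cmod l) + 1) / 2"
    have r: "0 < r" "r < 1" "s \<le> r" "cmod l < r" using s l unfolding r_def by (auto simp: max_def)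
    define D where "D = max (norm v) (C / (r - cmod l))"
    have "C / (r - cmod l) \<le> D" by (simp add: D_def)
    then have D: "C \<le> D * (r - cmod l)" "norm v \<le> D" using r
      by (simp add: pos_divide_le_eq, simp add: D_def)
    have "norm (((*v) B ^^ k) v) \<le> D * r ^ k" for k
    proof (induction k)
      case 0 then show ?case using D by simp
    next
      case (Suc k)
      have "B *v v = l *s v + w" by (simp add: w_def)
      have "((*v) B ^^ Suc k) v = ((*v) B ^^ k) (B *v v)" by (simp add: funpow_swap1)
      also have "B *v v = l *s v - (- w)" by (simp add: w_def)
      also have "((*v) B ^^ k) (l *s v - (- w)) = l *s ((*v) B ^^ k) v + ((*v) B ^^ k) w"
        using funpow_matrix_diff[of k 0 w] funpow_matrix_diff[of k 0 0]
        by (simp add: funpow_matrix_diff funpow_matrix_scale del: diff_minus_eq_add)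
      finally have "norm (((*v) B ^^ Suc k) v) \<le> cmod l * norm (((*v) B ^^ k) v) + norm (((*v) B ^^ k) w)"
        by (metis norm_scale_vec norm_triangle_ineq)
      also have "\<dots> \<le> cmod l * (D * r ^ k) + C * r ^ k"
        using Suc s(3)[of k] r(3) s(1) C0
        by (intro add_mono mult_left_mono order_trans[OF s(3)] power_mono) auto
      also have "\<dots> = (cmod l * D + C) * r ^ k" by (simp add: algebra_simps)
      also have "\<dots> \<le> (D * r) * r ^ k" using D r by (intro mult_right_mono) (auto simp: algebra_simps)
      finally show ?case by (simp add: mult_ac)
    qed
    then show ?thesis using r by blast
  qed
qed

end

lemma norm_map_vec_of_real: "norm (\<chi> i. complex_of_real (v $ i)) = norm (v :: real ^ 'n)"
  by (simp add: norm_vec_def)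

text \<open>So far the constants depend on the vector. Expanding in the finitely many axis vectors
  makes them uniform: the largest rate and the sum of the constants serve for all.\<close>

lemma matrix_decay:
  fixes A :: "real ^ 'n ^ 'n"
  assumes "spectral_radius A < 1"
  shows "\<exists>C r. 0 \<le> C \<and> 0 < r \<and> r < 1 \<and> (\<forall>k v. norm (((*v) A ^^ k) v) \<le> C * r ^ k * norm v)"
proof -
  define B where "B = map_matrix complex_of_real A"
  have eig: "cmod z < 1" if "v \<noteq> 0" "B *v v = z *s v" for z v
  proof -
    have "cmod z \<le> spectral_radius A"
      unfolding spectral_radius_def B_def[symmetric]
      using finite_eigenvalues[of B] that by (intro Max_ge) auto
    then show ?thesis using assms by simp
  qed
  \<comment> \<open>Eigenvalues live over the complex numbers; real orbits are embedded there with
    their norms unchanged.\<close>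
  define cv where "cv v = (\<chi> i. complex_of_real (v $ i))" for v :: "real ^ 'n"
  have cv: "((*v) B ^^ k) (cv v) = cv (((*v) A ^^ k) v)" for k v
    by (induction k) (auto simp: B_def cv_def matrix_vector_mult_def map_matrix_def vec_eq_iff)
  obtain q where q: "q \<noteq> 0" "\<And>v. poly_app B q v = 0" using ex_annihilating_poly by auto
  have "\<exists>C r. 0 < r \<and> r < 1 \<and> (\<forall>k. norm (((*v) A ^^ k) v) \<le> C * r ^ k)" for v
    using decay_of_annihilated[OF eig q(1) q(2)[of "cv v"]]
    by (simp add: cv) (simp add: cv_def norm_map_vec_of_real)
  then obtain C r where Cr: "\<And>v. 0 < r v" "\<And>v. r v < 1"
    "\<And>v k. norm (((*v) A ^^ k) v) \<le> C v * r v ^ k" by metis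
  have C0: "C v \<ge> 0" for v using order_trans[OF norm_ge_zero Cr(3)[of 0 v]] by simp
  define s where "s = Max (range (\<lambda>i. r (axis i 1)))"
  have s: "r (axis i 1) \<le> s" for i unfolding s_def by (intro Max_ge) auto
  have s1: "s < 1" "0 < s" unfolding s_def using Cr by (auto simp: Max_gr_iff)
  have "norm (((*v) A ^^ k) v) \<le> (\<Sum>i\<in>UNIV. C (axis i 1)) * s ^ k * norm v" for k v
  proof -
    have lin: "linear ((*v) A ^^ k)"
      by (induction k) (auto intro: linear_compose[unfolded comp_def] simp: id_def linear_id[unfolded id_def] comp_def linear_ident)
    have "v = (\<Sum>i\<in>UNIV. (v $ i) *\<^sub>R axis i 1)" using basis_expansion[of v] by (simp add: scalar_mult_eq_scaleR)
    then have "((*v) A ^^ k) v = (\<Sum>i\<in>UNIV. (v $ i) *\<^sub>R ((*v) A ^^ k) (axis i 1))"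
      by (metis (no_types, lifting) lin linear_sum linear_scale sum.cong)
    also have "norm \<dots> \<le> (\<Sum>i\<in>UNIV. norm v * (C (axis i 1) * s ^ k))"
    proof (intro order_trans[OF norm_sum] sum_mono)
      fix i
      have "norm (((*v) A ^^ k) (axis i 1)) \<le> C (axis i 1) * r (axis i 1) ^ k" by (rule Cr)
      also have "\<dots> \<le> C (axis i 1) * s ^ k"
        using C0 s Cr by (intro mult_left_mono power_mono) (auto intro: less_imp_le)
      finally show "norm ((v $ i) *\<^sub>R ((*v) A ^^ k) (axis i 1)) \<le> norm v * (C (axis i 1) * s ^ k)"
        by (simp only: norm_scaleR) (intro mult_mono, auto intro: component_le_norm_cart)
    qed
    finally show ?thesis by (simp add: sum_distrib_left sum_distrib_right mult_ac)
  qed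
  then show ?thesis using s1 C0 by (intro exI[of _ "\<Sum>i\<in>UNIV. C (axis i 1)"] exI[of _ s]) (auto intro: sum_nonneg)
qed

lemma matrix_funpow_adjoint:
  fixes A :: "real ^ 'n ^ 'n"
  shows "((*v) (transpose A) ^^ k) v \<bullet> w = v \<bullet> ((*v) A ^^ k) w"
proof (induction k arbitrary: v w)
  case (Suc k)
  have "((*v) (transpose A) ^^ Suc k) v \<bullet> w = ((*v) (transpose A) ^^ k) v \<bullet> (A *v w)"
    by (simp add: dot_lmul_matrix[symmetric])
  also have "\<dots> = v \<bullet> ((*v) A ^^ Suc k) w"
    by (simp only: Suc funpow_Suc_right comp_apply)
  finally show ?case .
qed simp

text \<open>Duality keeps the constants: with w = (A^T)^k v one has |w|^2 = <v, A^k w>, and one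
  factor |w| cancels.\<close>

lemma matrix_decay_transpose:
  fixes A :: "real ^ 'n ^ 'n"
  assumes "\<And>k v. norm (((*v) A ^^ k) v) \<le> C * r ^ k * norm v"
  shows "norm (((*v) (transpose A) ^^ k) v) \<le> C * r ^ k * norm v"
proof (cases "((*v) (transpose A) ^^ k) v = 0")
  case True
  have "0 \<le> C * r ^ k * norm v" using assms[of k v] norm_ge_zero order_trans by blast
  then show ?thesis using True by simp
next
  case False
  define w where "w = ((*v) (transpose A) ^^ k) v"
  have "norm w * norm w = v \<bullet> ((*v) A ^^ k) w"
    by (metis w_def matrix_funpow_adjoint power2_eq_square power2_norm_eq_inner)
  also have "\<dots> \<le> norm v * (C * r ^ k * norm w)"
    by (intro order_trans[OF norm_cauchy_schwarz] mult_left_mono assms) auto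
  finally show ?thesis using False by (simp add: w_def mult_ac)
qed

section \<open>The discrete Lyapunov equation\<close>

lemma matrix_eqI_bilinear:
  fixes F G :: "real ^ 'n ^ 'n"
  assumes "\<And>v w. v \<bullet> (F *v w) = v \<bullet> (G *v w)"
  shows "F = G"
  using assms by (simp add: matrix_eq) (metis vector_eq_ldot)

text \<open>For bilinear forms, the equation says that passing from (v, w) to (A^T v, A^T w) loses
  exactly <v, b> <w, b>. This is what gets iterated, both for uniqueness and in the law of large
  numbers.\<close>

lemma lyapunov_bilinear:
  fixes A F :: "real ^ 'n ^ 'n"
  shows "v \<bullet> ((A ** F ** transpose A + columnvector b ** (rowvector b :: real ^ 'n ^ 1)) *v w)
    = (transpose A *v v) \<bullet> (F *v (transpose A *v w)) + (v \<bullet> b) * (w \<bullet> b)"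
proof -
  have "(columnvector b ** (rowvector b :: real ^ 'n ^ 1)) *v w = (w \<bullet> b) *\<^sub>R b"
    by (simp add: vec_eq_iff matrix_vector_mult_def matrix_matrix_mult_def rowvector_def
        columnvector_def inner_vec_def sum_distrib_left sum_distrib_right mult_ac)
  moreover have "v \<bullet> (A *v x) = (transpose A *v v) \<bullet> x" for x
    using matrix_funpow_adjoint[of 1 A v x] by simp
  ultimately show ?thesis
    by (simp add: matrix_vector_mult_add_rdistrib inner_add_right matrix_vector_mul_assoc[symmetric])
qed

text \<open>\<open>F\<close> is the sum of A^k b b^T (A^T)^k. The weak form is the one used later:
  on the diagonal it is the variance of v in the limit law.\<close>

lemma lyapunov_series:
  fixes A :: "real ^ 'n ^ 'n" and b :: "real ^ 'n"
  assumes dec: "\<And>k v. norm (((*v) A ^^ k) v) \<le> C * r ^ k * norm v" and r: "0 < r" "r < 1"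
  defines "F \<equiv> (\<chi> i j. \<Sum>k. ((*v) A ^^ k) b $ i * ((*v) A ^^ k) b $ j)"
  shows "(\<lambda>k. (v \<bullet> ((*v) A ^^ k) b) * (w \<bullet> ((*v) A ^^ k) b)) sums (v \<bullet> (F *v w))"
proof -
  let ?x = "\<lambda>k. ((*v) A ^^ k) b"
  have sm: "summable (\<lambda>k. ?x k $ i * ?x k $ j)" for i j
  proof (rule summable_comparison_test')
    show "summable (\<lambda>k. (C * norm b)\<^sup>2 * (r ^ 2) ^ k)"
      using r by (intro summable_mult summable_geometric) (auto simp: power_less_one_iff)
    fix k :: nat assume "k \<ge> 0"
    have "\<bar>?x k $ i\<bar> \<le> C * r ^ k * norm b" for i
      using component_le_norm_cart[of "?x k" i] dec[of k b] by linarith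
    then have "\<bar>?x k $ i\<bar> * \<bar>?x k $ j\<bar> \<le> (C * r ^ k * norm b) * (C * r ^ k * norm b)"
      by (intro mult_mono) (auto intro: order_trans[OF abs_ge_zero])
    then show "norm (?x k $ i * ?x k $ j) \<le> (C * norm b)\<^sup>2 * (r ^ 2) ^ k"
      by (simp add: abs_mult power2_eq_square power_mult_distrib mult_ac)
  qed
  have "(\<lambda>k. \<Sum>i\<in>UNIV. \<Sum>j\<in>UNIV. v $ i * w $ j * (?x k $ i * ?x k $ j)) sums
      (\<Sum>i\<in>UNIV. \<Sum>j\<in>UNIV. v $ i * w $ j * F $ i $ j)"
    unfolding F_def by (intro sums_sum) (simp, intro sums_mult summable_sums sm)
  also have "(\<lambda>k. \<Sum>i\<in>UNIV. \<Sum>j\<in>UNIV. v $ i * w $ j * (?x k $ i * ?x k $ j)) =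
      (\<lambda>k. (v \<bullet> ?x k) * (w \<bullet> ?x k))"
    by (simp add: inner_vec_def sum_product mult_ac)
  also have "(\<Sum>i\<in>UNIV. \<Sum>j\<in>UNIV. v $ i * w $ j * F $ i $ j) = v \<bullet> (F *v w)"
    by (simp add: inner_vec_def matrix_vector_mult_def sum_distrib_left mult_ac)
  finally show ?thesis .
qed

text \<open>Removing the first term shifts the series by one power of \<open>A\<close>; the removed
  term is b b^T.\<close>

lemma lyapunov_series_solves:
  fixes A :: "real ^ 'n ^ 'n" and b :: "real ^ 'n"
  assumes dec: "\<And>k v. norm (((*v) A ^^ k) v) \<le> C * r ^ k * norm v" and r: "0 < r" "r < 1"
  defines "F \<equiv> (\<chi> i j. \<Sum>k. ((*v) A ^^ k) b $ i * ((*v) A ^^ k) b $ j)"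
  shows "F = A ** F ** transpose A + columnvector b ** (rowvector b :: real ^ 'n ^ 1)"
proof (rule matrix_eqI_bilinear, unfold lyapunov_bilinear)
  fix v w
  note s = lyapunov_series[OF dec r, of _ b, folded F_def]
  have *: "(transpose A *v v) \<bullet> x = v \<bullet> (A *v x)" for v x
    using matrix_funpow_adjoint[of 1 A v x] by simp
  have "(\<lambda>k. (v \<bullet> ((*v) A ^^ Suc k) b) * (w \<bullet> ((*v) A ^^ Suc k) b)) sums
      ((transpose A *v v) \<bullet> (F *v (transpose A *v w)))"
    using s[of "transpose A *v v" "transpose A *v w"] by (simp only: funpow.simps comp_apply *[symmetric])
  from sums_Suc[OF this] have "(\<lambda>k. (v \<bullet> ((*v) A ^^ k) b) * (w \<bullet> ((*v) A ^^ k) b)) sums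
      ((transpose A *v v) \<bullet> (F *v (transpose A *v w)) + (v \<bullet> b) * (w \<bullet> b))" by simp
  with s[of v w] show "v \<bullet> (F *v w) =
      (transpose A *v v) \<bullet> (F *v (transpose A *v w)) + (v \<bullet> b) * (w \<bullet> b)"
    by (rule sums_unique2)
qed

text \<open>Uniqueness: in the difference \<Delta> of two solutions the term in \<open>b\<close>
  cancels, so \<Delta> is unchanged when A^T is applied to both arguments, while the decay of the
  powers of A^T drives it to 0.\<close>

lemma lyapunov_ex1:
  fixes A :: "real ^ 'n ^ 'n"
  assumes dec: "\<And>k v. norm (((*v) A ^^ k) v) \<le> C * r ^ k * norm v" and r: "0 < r" "r < 1"
  shows "\<exists>!F. F = A ** F ** transpose A + columnvector b ** (rowvector b :: real ^ 'n ^ 1)"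
proof (rule ex_ex1I)
  show "\<exists>F. F = A ** F ** transpose A + columnvector b ** (rowvector b :: real ^ 'n ^ 1)"
    using lyapunov_series_solves[OF dec r] by blast
next
  fix F G :: "real ^ 'n ^ 'n"
  assume F: "F = A ** F ** transpose A + columnvector b ** (rowvector b :: real ^ 'n ^ 1)"
    and G: "G = A ** G ** transpose A + columnvector b ** (rowvector b :: real ^ 'n ^ 1)"
  let ?T = "\<lambda>k. ((*v) (transpose A) ^^ k)"
  define \<Delta> where "\<Delta> v w = v \<bullet> (F *v w) - v \<bullet> (G *v w)" for v w
  have "\<Delta> v w = \<Delta> (transpose A *v v) (transpose A *v w)" for v w
    using arg_cong[OF F, of "\<lambda>F. v \<bullet> (F *v w)"] arg_cong[OF G, of "\<lambda>G. v \<bullet> (G *v w)"]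
    unfolding lyapunov_bilinear \<Delta>_def by linarith
  then have iter: "\<Delta> v w = \<Delta> (?T k v) (?T k w)" for v w k
    by (induction k) auto
  obtain K where K: "\<And>w. norm ((F - G) *v w) \<le> norm w * K"
    using bounded_linear.bounded[OF matrix_vector_mul_bounded_linear[of "F - G"]] by blast
  have \<Delta>_eq: "\<Delta> v w = v \<bullet> ((F - G) *v w)" for v w
    by (simp add: \<Delta>_def matrix_vector_mult_diff_rdistrib inner_diff_right)
  have "\<Delta> v w = 0" for v w
  proof -
    have lim: "(\<lambda>k. C * r ^ k * norm u) \<longlonglongrightarrow> 0" for u :: "real ^ 'n"
      using r by (auto intro!: tendsto_eq_intros LIMSEQ_power_zero)
    have "(\<lambda>k. (C * r ^ k * norm v) * ((C * r ^ k * norm w) * \<bar>K\<bar>)) \<longlonglongrightarrow> 0 * (0 * \<bar>K\<bar>)"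
      by (intro tendsto_mult lim tendsto_const)
    moreover have "norm (\<Delta> v w) \<le> (C * r ^ k * norm v) * ((C * r ^ k * norm w) * \<bar>K\<bar>)" for k
    proof -
      have "norm (\<Delta> v w) = \<bar>?T k v \<bullet> ((F - G) *v ?T k w)\<bar>"
        by (subst iter[of _ _ k]) (simp add: \<Delta>_eq)
      also have "\<dots> \<le> norm (?T k v) * norm ((F - G) *v ?T k w)" by (rule Cauchy_Schwarz_ineq2)
      also have "norm ((F - G) *v ?T k w) \<le> norm (?T k w) * \<bar>K\<bar>"
        by (rule order_trans[OF K mult_left_mono]) auto
      finally have "norm (\<Delta> v w) \<le> norm (?T k v) * (norm (?T k w) * \<bar>K\<bar>)"
        by (simp add: mult_left_mono del: transpose_matrix_vector)
      also have "\<dots> \<le> (C * r ^ k * norm v) * ((C * r ^ k * norm w) * \<bar>K\<bar>)"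
        using matrix_decay_transpose[OF dec]
        by (intro mult_mono) (auto intro: order_trans[OF norm_ge_zero])
      finally show ?thesis .
    qed
    ultimately have "(\<lambda>k. \<Delta> v w) \<longlonglongrightarrow> 0"
      by (auto intro!: Lim_null_comparison[where f="\<lambda>k::nat. \<Delta> v w" and g="\<lambda>k. (C * r ^ k * norm v) * ((C * r ^ k * norm w) * \<bar>K\<bar>)"])
    then show ?thesis by (simp add: LIMSEQ_const_iff)
  qed
  then show "F = G" by (intro matrix_eqI_bilinear) (auto simp: \<Delta>_def)
qed

section \<open>Trigonometric polynomials\<close>

text \<open>Only exponentials and sums are generators, so that what holds for characteristic
  functions passes on by linearity; closure under products is derived.\<close>

inductive trig_poly :: "('a::real_inner \<Rightarrow> complex) \<Rightarrow> bool" where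
  trig_exp: "trig_poly (\<lambda>x. c * cis (v \<bullet> x))"
| trig_add: "trig_poly f \<Longrightarrow> trig_poly g \<Longrightarrow> trig_poly (\<lambda>x. f x + g x)"

lemma trig_poly_const: "trig_poly (\<lambda>x. c)"
  using trig_exp[of c 0] by simp

lemma trig_poly_mult:
  assumes "trig_poly f" "trig_poly g"
  shows "trig_poly (\<lambda>x. f x * g x)"
  using assms(1)
proof induction
  case (trig_exp c v)
  show ?case using assms(2)
  proof induction
    case (trig_exp d w)
    show ?case using trig_poly.trig_exp[of "c * d" "v + w"]
      by (simp add: inner_add_left cis_mult[symmetric] mult_ac)
  next
    case (trig_add f g)
    then show ?case using trig_poly.trig_add by (fastforce simp: distrib_left)
  qed
next
  case (trig_add f g)
  then show ?case using trig_poly.trig_add by (fastforce simp: distrib_right)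
qed

lemma trig_poly_sum: "finite S \<Longrightarrow> (\<And>i. i \<in> S \<Longrightarrow> trig_poly (f i)) \<Longrightarrow> trig_poly (\<lambda>x. \<Sum>i\<in>S. f i x)"
  by (induction S rule: finite_induct) (auto intro: trig_poly_const trig_add)

lemma trig_poly_sin: "trig_poly (\<lambda>x. complex_of_real (sin (v \<bullet> x)))"
proof -
  have "trig_poly (\<lambda>x. (- \<i> / 2) * cis (v \<bullet> x) + (\<i> / 2) * cis ((- v) \<bullet> x))"
    by (intro trig_add trig_exp)
  also have "(\<lambda>x. (- \<i> / 2) * cis (v \<bullet> x) + (\<i> / 2) * cis ((- v) \<bullet> x)) = (\<lambda>x. complex_of_real (sin (v \<bullet> x)))"
    by (auto simp: complex_eq_iff)
  finally show ?thesis .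
qed

text \<open>The indexed form lets a product of such functions of different variables be expanded
  over all choices of one term from each.\<close>

lemma trig_poly_repr:
  "trig_poly f \<Longrightarrow> \<exists>n (c :: nat \<Rightarrow> complex) v. \<forall>x. f x = (\<Sum>i<n. c i * cis (v i \<bullet> x))"
proof (induction rule: trig_poly.induct)
  case (trig_exp c v)
  show ?case by (rule exI[of _ 1], rule exI[of _ "\<lambda>_. c"], rule exI[of _ "\<lambda>_. v"]) simp
next
  case (trig_add f g)
  then obtain n m :: nat and c d :: "nat \<Rightarrow> complex" and v w
    where f: "\<And>x. f x = (\<Sum>i<n. c i * cis (v i \<bullet> x))" and g: "\<And>x. g x = (\<Sum>i<m. d i * cis (w i \<bullet> x))"
    by blast
  let ?c = "\<lambda>i. if i < n then c i else d (i - n)" and ?v = "\<lambda>i. if i < n then v i else w (i - n)"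
  have "f x + g x = (\<Sum>i<n + m. ?c i * cis (?v i \<bullet> x))" for x
  proof -
    have "(\<Sum>i<n + m. ?c i * cis (?v i \<bullet> x)) =
        (\<Sum>i<n. ?c i * cis (?v i \<bullet> x)) + (\<Sum>i=n..<n + m. ?c i * cis (?v i \<bullet> x))"
      by (subst sum.atLeastLessThan_concat[of 0 n "n + m", symmetric, unfolded atLeast0LessThan]) auto
    also have "(\<Sum>i=n..<n + m. ?c i * cis (?v i \<bullet> x)) = (\<Sum>i<m. d i * cis (w i \<bullet> x))"
      using sum.shift_bounds_nat_ivl[of "\<lambda>i. ?c i * cis (?v i \<bullet> x)" 0 n m]
      by (simp add: add.commute atLeast0LessThan)
    finally show ?thesis by (simp add: f g)
  qed
  then show ?case by (intro exI[of _ "n + m"] exI[of _ ?c] exI[of _ ?v] allI)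
qed

text \<open>With \<open>a = \<pi>/(2K)\<close>, \<open>f(x)\<close> equals \<open>F(sin (a x\<^sub>i))\<^sub>i\<close> on the cube of half-width \<open>K\<close> for
  \<open>F(y) = f((arcsin y\<^sub>i) / a)\<^sub>i\<close>, and \<open>F\<close> is uniformly approximable on the compact cube \<open>[-1,1]\<^sup>d\<close>,
  which contains \<^emph>\<open>all\<close> values of \<open>(sin (a x\<^sub>i))\<^sub>i\<close>. Hence the global bound on \<open>t\<close>.\<close>

lemma trig_poly_approx:
  fixes f :: "'a::euclidean_space \<Rightarrow> real"
  assumes cont: "continuous_on UNIV f" and B: "\<And>x. \<bar>f x\<bar> \<le> B" and K: "K > 0" and e: "e > 0"
  obtains t where "trig_poly (\<lambda>x. complex_of_real (t x))" "\<And>x. \<bar>t x\<bar> \<le> B + e"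
    "\<And>x. norm x \<le> K \<Longrightarrow> \<bar>t x - f x\<bar> \<le> e"
proof -
  define a where "a = pi / (2 * K)"
  have a: "a > 0" using K by (simp add: a_def)
  define s where "s x = (\<Sum>i\<in>Basis. sin (a * (x \<bullet> i)) *\<^sub>R i)" for x :: 'a
  define g where "g y = (\<Sum>i\<in>Basis. (arcsin (y \<bullet> i) / a) *\<^sub>R i)" for y :: 'a
  let ?S = "cbox (- One) (One :: 'a)"
  have s_in: "s x \<in> ?S" for x
    by (auto simp: mem_box s_def)
  have contg: "continuous_on ?S g"
    unfolding g_def using a
    by (intro continuous_on_sum continuous_on_scaleR continuous_on_divide continuous_on_const
        continuous_on_arcsin continuous_on_inner continuous_on_id) (auto simp: mem_box)
  have gs: "g (s x) = x" if "norm x \<le> K" for x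
  proof -
    have "arcsin (sin (a * (x \<bullet> i))) / a = x \<bullet> i" if i: "i \<in> Basis" for i
    proof -
      have "\<bar>x \<bullet> i\<bar> \<le> K" using Basis_le_norm[OF i, of x] \<open>norm x \<le> K\<close> by simp
      then have "\<bar>a * (x \<bullet> i)\<bar> \<le> a * K" using a by (simp add: abs_mult)
      also have "a * K = pi / 2" using K by (simp add: a_def)
      finally show ?thesis using a by (subst arcsin_sin) auto
    qed
    then show ?thesis unfolding g_def
      by (subst (2) euclidean_representation[symmetric]) (auto intro!: sum.cong simp: s_def)
  qed
  obtain P where P: "real_polynomial_function P" "\<And>y. y \<in> ?S \<Longrightarrow> \<bar>f (g y) - P y\<bar> < e"
    using Stone_Weierstrass_real_polynomial_function[of ?S "\<lambda>y. f (g y)" e]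
      continuous_on_compose2[OF cont contg] e by (metis compact_cbox subset_UNIV)
  have "trig_poly (\<lambda>x. complex_of_real (P (s x)))"
    using P(1)
  proof induction
    case (linear h)
    interpret h: bounded_linear h by fact
    have "trig_poly (\<lambda>x. \<Sum>i\<in>Basis. complex_of_real (h i) * complex_of_real (sin ((a *\<^sub>R i) \<bullet> x)))"
      by (intro trig_poly_sum trig_poly_mult trig_poly_const trig_poly_sin) simp
    then show ?case by (simp add: s_def h.sum h.scale inner_commute mult.commute)
  next
    case (add f g)
    then show ?case using trig_add by fastforce
  next
    case (mult f g)
    then show ?case using trig_poly_mult by fastforce
  qed (simp add: trig_poly_const)
  moreover have "\<bar>P (s x)\<bar> \<le> B + e" for x
    using P(2)[OF s_in[of x]] B[of "g (s x)"] by linarith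
  moreover have "\<bar>P (s x) - f x\<bar> \<le> e" if "norm x \<le> K" for x
    using P(2)[OF s_in[of x]] gs[OF that] by simp
  ultimately show ?thesis using that[of "\<lambda>x. P (s x)"] by blast
qed

section \<open>Convergence of characteristic functions\<close>

lemma borel_measurable_cis [measurable (raw)]:
  "f \<in> borel_measurable M \<Longrightarrow> (\<lambda>x. cis (f x)) \<in> borel_measurable M"
  unfolding cis_conv_exp by measurable

lemma (in prob_space) integrable_cis [simp]:
  "f \<in> borel_measurable M \<Longrightarrow> integrable M (\<lambda>x. cis (f x))"
  by (rule integrable_const_bound[where B=1]) auto

text \<open>Convergence of characteristic functions passes to trigonometric polynomials by
  linearity. Tightness reduces a bounded continuous f to a large ball, where such a polynomial is
  uniformly close to it; the global bound on the polynomial controls the mass outside.\<close>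

lemma (in prob_space) cramer_wold:
  fixes G :: "nat \<Rightarrow> 'a \<Rightarrow> 'b::euclidean_space" and f :: "'b \<Rightarrow> real"
  assumes G[measurable]: "\<And>n. G n \<in> borel_measurable M" and H[measurable]: "H \<in> borel_measurable M"
    and cf: "\<And>v. (\<lambda>n. expectation (\<lambda>\<omega>. cis (v \<bullet> G n \<omega>))) \<longlonglongrightarrow> expectation (\<lambda>\<omega>. cis (v \<bullet> H \<omega>))"
    and tight: "\<And>e. e > 0 \<Longrightarrow> \<exists>K>0. \<forall>n. prob {\<omega>\<in>space M. norm (G n \<omega>) > K} \<le> e"
    and tightH: "\<And>e. e > 0 \<Longrightarrow> \<exists>K>0. prob {\<omega>\<in>space M. norm (H \<omega>) > K} \<le> e"
    and f: "continuous_on UNIV f" "\<And>x. \<bar>f x\<bar> \<le> B"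
  shows "(\<lambda>n. expectation (\<lambda>\<omega>. f (G n \<omega>))) \<longlonglongrightarrow> expectation (\<lambda>\<omega>. f (H \<omega>))"
proof (rule LIMSEQ_I)
  fix r :: real assume r: "r > 0"
  have B: "B \<ge> 0" using f(2) abs_ge_zero order_trans by blast
  \<comment> \<open>Inside the ball f and t differ by at most e, outside by at most 2 B + 1 on an
    event of probability at most e; the total is at most e (2 B + 3), hence at most r / 4.\<close>
  define e where "e = min 1 (r / (4 * (2 * B + 3)))"
  have e: "e > 0" "e \<le> 1" using r B by (auto simp: e_def)
  have "e * (2 * B + 3) \<le> (r / (4 * (2 * B + 3))) * (2 * B + 3)"
    using B by (intro mult_right_mono) (auto simp: e_def)
  also have "\<dots> = r / 4" using B by (simp add: field_simps)
  finally have er: "e * (2 * B + 3) \<le> r / 4" .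
  obtain K1 where K1: "K1 > 0" "\<And>n. prob {\<omega>\<in>space M. norm (G n \<omega>) > K1} \<le> e"
    using tight[OF e(1)] by blast
  obtain K2 where K2: "K2 > 0" "prob {\<omega>\<in>space M. norm (H \<omega>) > K2} \<le> e"
    using tightH[OF e(1)] by blast
  define K where "K = max K1 K2"
  have K: "K > 0" using K1 by (simp add: K_def)
  obtain t where t: "trig_poly (\<lambda>x. complex_of_real (t x))" "\<And>x. \<bar>t x\<bar> \<le> B + e"
    "\<And>x. norm x \<le> K \<Longrightarrow> \<bar>t x - f x\<bar> \<le> e"
    using trig_poly_approx[OF f K e(1)] by blast
  have [measurable]: "f \<in> borel_measurable borel" by (rule borel_measurable_continuous_onI[OF f(1)])
  \<comment> \<open>Measurability and boundedness are carried along because the integral of a sum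
    splits only when both summands are integrable.\<close>
  have conv: "(\<lambda>n. expectation (\<lambda>\<omega>. p (G n \<omega>))) \<longlonglongrightarrow> expectation (\<lambda>\<omega>. p (H \<omega>))
      \<and> p \<in> borel_measurable borel \<and> (\<exists>C. \<forall>x. cmod (p x) \<le> C)" if "trig_poly p" for p
    using that
  proof induction
    case (trig_exp c v)
    have "cmod (c * cis (v \<bullet> x)) \<le> cmod c" for x by (simp add: norm_mult)
    then show ?case by (auto intro!: tendsto_mult cf)
  next
    case (trig_add p q)
    then obtain C D where CD: "\<And>x. cmod (p x) \<le> C" "\<And>x. cmod (q x) \<le> D" by blast
    have [measurable]: "p \<in> borel_measurable borel" "q \<in> borel_measurable borel" using trig_add by auto
    have int: "integrable M (\<lambda>\<omega>. p (X \<omega>))" "integrable M (\<lambda>\<omega>. q (X \<omega>))"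
      if [measurable]: "X \<in> borel_measurable M" for X
      by (rule integrable_const_bound[where B=C]; use CD in simp)
         (rule integrable_const_bound[where B=D]; use CD in simp)
    have "cmod (p x + q x) \<le> C + D" for x using CD norm_triangle_mono by blast
    then show ?case using trig_add by (auto simp: int intro!: tendsto_add)
  qed
  have mt: "t \<in> borel_measurable borel"
    using measurable_compose[OF conv[OF t(1), THEN conjunct2, THEN conjunct1] borel_measurable_Re] by simp
  note [measurable] = mt
  have limt: "(\<lambda>n. expectation (\<lambda>\<omega>. t (G n \<omega>))) \<longlonglongrightarrow> expectation (\<lambda>\<omega>. t (H \<omega>))"
    using tendsto_Re[OF conv[OF t(1), THEN conjunct1]] by (simp add: integral_complex_of_real)
  have close: "\<bar>expectation (\<lambda>\<omega>. f (X \<omega>)) - expectation (\<lambda>\<omega>. t (X \<omega>))\<bar> \<le> r / 4"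
    if [measurable]: "X \<in> borel_measurable M" and X: "prob {\<omega>\<in>space M. norm (X \<omega>) > K} \<le> e" for X
  proof -
    have i: "integrable M (\<lambda>\<omega>. f (X \<omega>))" "integrable M (\<lambda>\<omega>. t (X \<omega>))"
      by (rule integrable_const_bound[where B=B]; use f(2) in simp)
         (rule integrable_const_bound[where B="B + e"]; use t(2) in simp)
    let ?A = "{\<omega>\<in>space M. norm (X \<omega>) > K}"
    have "\<bar>expectation (\<lambda>\<omega>. f (X \<omega>)) - expectation (\<lambda>\<omega>. t (X \<omega>))\<bar> = \<bar>expectation (\<lambda>\<omega>. f (X \<omega>) - t (X \<omega>))\<bar>"
      using i by simp
    also have "\<dots> \<le> expectation (\<lambda>\<omega>. \<bar>f (X \<omega>) - t (X \<omega>)\<bar>)"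
      by (rule integral_abs_bound)
    also have "\<dots> \<le> expectation (\<lambda>\<omega>. e + (2 * B + 1) * indicator ?A \<omega>)"
    proof (rule integral_mono)
      show "integrable M (\<lambda>\<omega>. \<bar>f (X \<omega>) - t (X \<omega>)\<bar>)" using i by simp
      fix \<omega> assume w: "\<omega> \<in> space M"
      show "\<bar>f (X \<omega>) - t (X \<omega>)\<bar> \<le> e + (2 * B + 1) * indicator ?A \<omega>"
        using t(2)[of "X \<omega>"] t(3)[of "X \<omega>"] f(2)[of "X \<omega>"] w e B
        by (auto simp: indicator_def)
    qed (auto intro!: integrable_add integrable_mult_right simp: emeasure_eq_measure)
    also have "\<dots> = e + (2 * B + 1) * prob ?A"
      by (simp add: prob_space emeasure_eq_measure)
    also have "\<dots> \<le> e + (2 * B + 1) * e" using X B by (intro add_left_mono mult_left_mono) auto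
    also have "\<dots> \<le> e * (2 * B + 3)" using e by (simp add: algebra_simps)
    finally show ?thesis using er by linarith
  qed
  have sub: "prob {\<omega>\<in>space M. norm (X \<omega>) > K} \<le> prob {\<omega>\<in>space M. norm (X \<omega>) > K'}"
    if [measurable]: "X \<in> borel_measurable M" and "K' \<le> K" for X :: "'a \<Rightarrow> 'b" and K'
    using that by (intro finite_measure_mono) auto
  have cG: "\<bar>expectation (\<lambda>\<omega>. f (G n \<omega>)) - expectation (\<lambda>\<omega>. t (G n \<omega>))\<bar> \<le> r / 4" for n
    by (intro close order_trans[OF sub K1(2)]) (auto simp: K_def)
  have cH: "\<bar>expectation (\<lambda>\<omega>. f (H \<omega>)) - expectation (\<lambda>\<omega>. t (H \<omega>))\<bar> \<le> r / 4"
    by (intro close order_trans[OF sub K2(2)]) (auto simp: K_def)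
  obtain N where N: "\<And>n. n \<ge> N \<Longrightarrow> norm (expectation (\<lambda>\<omega>. t (G n \<omega>)) - expectation (\<lambda>\<omega>. t (H \<omega>))) < r / 4"
    using LIMSEQ_D[OF limt, of "r / 4"] r by auto
  show "\<exists>N. \<forall>n\<ge>N. norm (expectation (\<lambda>\<omega>. f (G n \<omega>)) - expectation (\<lambda>\<omega>. f (H \<omega>))) < r"
  proof (intro exI allI impI)
    fix n assume "n \<ge> N"
    from N[OF this] cG[of n] cH r
    show "norm (expectation (\<lambda>\<omega>. f (G n \<omega>)) - expectation (\<lambda>\<omega>. f (H \<omega>))) < r"
      unfolding real_norm_def by linarith
  qed
qed

section \<open>Independence from factorising characteristic functions\<close>

lemma trig_poly_indicator:
  obtains t :: "nat \<Rightarrow> real \<Rightarrow> real" where "\<And>m. trig_poly (\<lambda>x. complex_of_real (t m x))"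
    "\<And>m x. \<bar>t m x\<bar> \<le> 2" "\<And>x. (\<lambda>m. t m x) \<longlonglongrightarrow> indicator {..b} x"
proof -
  \<comment> \<open>Continuous ramps falling from 1 at b to 0 at b + 1/m. Approximating
    \<open>h m\<close> within 1/(m+1) on the ball of radius m+1 gives pointwise convergence, and the
    common bound 2 prepares dominated convergence.\<close>
  define h where "h m x = max 0 (min 1 (1 - real m * (x - b)))" for m x
  have h1: "\<bar>h m x\<bar> \<le> 1" for m x by (auto simp: h_def)
  have "\<exists>t. trig_poly (\<lambda>x. complex_of_real (t x)) \<and> (\<forall>x. \<bar>t x\<bar> \<le> 2) \<and>
      (\<forall>x. norm x \<le> real (Suc m) \<longrightarrow> \<bar>t x - h m x\<bar> \<le> 1 / real (Suc m))" for m
  proof -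
    have c: "continuous_on UNIV (h m)" unfolding h_def by (intro continuous_intros)
    obtain t where t: "trig_poly (\<lambda>x. complex_of_real (t x))" "\<And>x. \<bar>t x\<bar> \<le> 1 + 1 / real (Suc m)"
      "\<And>x. norm x \<le> real (Suc m) \<Longrightarrow> \<bar>t x - h m x\<bar> \<le> 1 / real (Suc m)"
      using trig_poly_approx[OF c h1, of "real (Suc m)" "1 / real (Suc m)"] by auto
    have "1 + 1 / real (Suc m) \<le> 2" by simp
    then show ?thesis using t order_trans by blast
  qed
  then obtain t where t: "\<And>m. trig_poly (\<lambda>x. complex_of_real (t m x))" "\<And>m x. \<bar>t m x\<bar> \<le> 2"
    "\<And>m x. norm x \<le> real (Suc m) \<Longrightarrow> \<bar>t m x - h m x\<bar> \<le> 1 / real (Suc m)"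
    by metis
  have "(\<lambda>m. t m x) \<longlonglongrightarrow> indicator {..b} x" for x
  proof -
    have "eventually (\<lambda>m. h m x = indicator {..b} x) sequentially"
    proof (cases "x \<le> b")
      case True
      have "h m x = indicator {..b} x" for m
        using True by (simp add: h_def mult_nonneg_nonpos)
      then show ?thesis by simp
    next
      case False
      have "eventually (\<lambda>m. real m \<ge> 1 / (x - b)) sequentially"
        by (rule eventually_at_top_linorderI[of "nat \<lceil>1 / (x - b)\<rceil>"]) linarith
      then show ?thesis
      proof (rule eventually_mono)
        fix m assume "real m \<ge> 1 / (x - b)"
        then have "real m * (x - b) \<ge> 1" using False by (simp add: field_simps)
        then show "h m x = indicator {..b} x" using False by (simp add: h_def)
      qed
    qed
    then have h: "(\<lambda>m. h m x) \<longlonglongrightarrow> indicator {..b} x" by (rule tendsto_eventually)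
    have "(\<lambda>m. t m x - h m x) \<longlonglongrightarrow> 0"
    proof (rule Lim_null_comparison)
      show "(\<lambda>m. 1 / real (Suc m)) \<longlonglongrightarrow> 0" by (rule LIMSEQ_Suc[OF lim_1_over_n])
      show "eventually (\<lambda>m. norm (t m x - h m x) \<le> 1 / real (Suc m)) sequentially"
      proof (rule eventually_at_top_linorderI)
        fix m assume "m \<ge> nat \<lceil>\<bar>x\<bar>\<rceil>"
        then have "norm x \<le> real (Suc m)" by simp
        from t(3)[OF this] show "norm (t m x - h m x) \<le> 1 / real (Suc m)" by simp
      qed
    qed
    from tendsto_add[OF this h] show ?thesis by simp
  qed
  with t show ?thesis using that by blast
qed

text \<open>Kac's criterion. Factorisation for exponentials extends to products of trigonometric
  polynomials and, by dominated convergence, to indicators of half-lines, which form a generator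
  closed under intersection.\<close>

lemma (in prob_space) indep_vars_char:
  fixes X :: "'i \<Rightarrow> 'a \<Rightarrow> real"
  assumes I: "finite I" "I \<noteq> {}" and X[measurable]: "\<And>i. i \<in> I \<Longrightarrow> X i \<in> borel_measurable M"
    and cf: "\<And>u. expectation (\<lambda>\<omega>. cis (\<Sum>i\<in>I. u i * X i \<omega>)) = (\<Prod>i\<in>I. expectation (\<lambda>\<omega>. cis (u i * X i \<omega>)))"
  shows "indep_vars (\<lambda>_. borel) X I"
proof -
  have fac: "expectation (\<lambda>\<omega>. \<Prod>i\<in>I. T i (X i \<omega>)) = (\<Prod>i\<in>I. expectation (\<lambda>\<omega>. T i (X i \<omega>)))"
    if T: "\<And>i. trig_poly (T i)" for T :: "'i \<Rightarrow> real \<Rightarrow> complex"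
  proof -
    obtain n :: "'i \<Rightarrow> nat" and c :: "'i \<Rightarrow> nat \<Rightarrow> complex" and v :: "'i \<Rightarrow> nat \<Rightarrow> real"
      where T': "\<And>i x. T i x = (\<Sum>j<n i. c i j * cis (v i j \<bullet> x))"
      using trig_poly_repr[OF T] by metis
    have pc: "(\<Prod>i\<in>I. cis (g i)) = cis (\<Sum>i\<in>I. g i)" for g
      using I(1) by (induction I rule: finite_induct) (auto simp: cis_mult)
    have "expectation (\<lambda>\<omega>. \<Prod>i\<in>I. T i (X i \<omega>)) =
        expectation (\<lambda>\<omega>. \<Sum>g\<in>PiE I (\<lambda>i. {..<n i}). \<Prod>i\<in>I. c i (g i) * cis (v i (g i) * X i \<omega>))"
      unfolding T' using I by (subst prod_sum_PiE) auto
    also have "\<dots> = (\<Sum>g\<in>PiE I (\<lambda>i. {..<n i}). expectation (\<lambda>\<omega>. (\<Prod>i\<in>I. c i (g i)) * cis (\<Sum>i\<in>I. v i (g i) * X i \<omega>)))"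
      by (subst Bochner_Integration.integral_sum)
        (auto simp: prod.distrib pc intro!: integrable_mult_right integrable_cis)
    also have "\<dots> = (\<Sum>g\<in>PiE I (\<lambda>i. {..<n i}). \<Prod>i\<in>I. c i (g i) * expectation (\<lambda>\<omega>. cis (v i (g i) * X i \<omega>)))"
      by (simp add: cf prod.distrib)
    also have "\<dots> = (\<Prod>i\<in>I. \<Sum>j<n i. c i j * expectation (\<lambda>\<omega>. cis (v i j * X i \<omega>)))"
      using I by (subst prod_sum_PiE) auto
    also have "\<dots> = (\<Prod>i\<in>I. expectation (\<lambda>\<omega>. T i (X i \<omega>)))"
    proof (rule prod.cong[OF refl])
      fix i assume "i \<in> I"
      then have [measurable]: "X i \<in> borel_measurable M" by simp
      show "(\<Sum>j<n i. c i j * expectation (\<lambda>\<omega>. cis (v i j * X i \<omega>))) = expectation (\<lambda>\<omega>. T i (X i \<omega>))"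
        unfolding T' by (subst Bochner_Integration.integral_sum) (auto intro!: integrable_mult_right)
    qed
    finally show ?thesis .
  qed
  \<comment> \<open>With \<open>UNIV\<close> among the sets, the product formula over all of
    \<open>I\<close> contains the formula for every subset of indices.\<close>
  let ?E = "insert UNIV (range (\<lambda>b::real. {..b}))"
  have ind: "\<exists>t::nat \<Rightarrow> real \<Rightarrow> real. (\<forall>m. trig_poly (\<lambda>x. complex_of_real (t m x))) \<and>
      (\<forall>m x. \<bar>t m x\<bar> \<le> 2) \<and> (\<forall>x. (\<lambda>m. t m x) \<longlonglongrightarrow> indicator A x)" if "A \<in> ?E" for A
    using that
  proof
    assume "A = UNIV"
    then show ?thesis by (intro exI[of _ "\<lambda>_ _. 1"]) (auto intro: trig_poly_const)
  next
    assume "A \<in> range (\<lambda>b::real. {..b})"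
    then obtain b where "A = {..b}" by blast
    then show ?thesis using trig_poly_indicator[of b] by metis
  qed
  have tm: "t \<in> borel_measurable borel" if "trig_poly (\<lambda>x. complex_of_real (t x))" for t :: "real \<Rightarrow> real"
  proof -
    have "p \<in> borel_measurable borel" if "trig_poly p" for p :: "real \<Rightarrow> complex"
      using that by induction auto
    from measurable_compose[OF this[OF that] borel_measurable_Re] show ?thesis by simp
  qed
  show ?thesis
  proof (subst indep_vars_finite[where E="\<lambda>_. ?E"], goal_cases)
    case (3 i)
    have "sets borel = sigma_sets UNIV (range (\<lambda>a::real. {..a}))" 
      by (subst borel_eq_atMost) simp
    also have "\<dots> = sigma_sets UNIV ?E"
    proof (rule antisym)
      show "sigma_sets UNIV (range (\<lambda>a::real. {..a})) \<subseteq> sigma_sets UNIV ?E"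
        by (rule sigma_sets_mono') auto
      show "sigma_sets UNIV ?E \<subseteq> sigma_sets UNIV (range (\<lambda>a::real. {..a}))"
        by (rule sigma_sets_mono, rule insert_subsetI, rule sigma_sets_top)
           (blast intro: sigma_sets.Basic)
    qed
    finally show ?case by simp
  next
    case (5 i)
    show ?case by (auto simp: Int_stable_def)
  next
    case 8
    show ?case
    proof
      fix A assume "A \<in> I \<rightarrow> ?E"
      then have "\<forall>i. \<exists>t::nat \<Rightarrow> real \<Rightarrow> real. i \<in> I \<longrightarrow> (\<forall>m. trig_poly (\<lambda>x. complex_of_real (t m x))) \<and>
        (\<forall>m x. \<bar>t m x\<bar> \<le> 2) \<and> (\<forall>x. (\<lambda>m. t m x) \<longlonglongrightarrow> indicator (A i) x)"
        using ind[OF Pi_mem[OF \<open>A \<in> I \<rightarrow> ?E\<close>]] by simp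
      then obtain t0 :: "'i \<Rightarrow> nat \<Rightarrow> real \<Rightarrow> real" where t0: "\<And>i. i \<in> I \<Longrightarrow> (\<forall>m. trig_poly (\<lambda>x. complex_of_real (t0 i m x))) \<and>
        (\<forall>m x. \<bar>t0 i m x\<bar> \<le> 2) \<and> (\<forall>x. (\<lambda>m. t0 i m x) \<longlonglongrightarrow> indicator (A i) x)" by metis
      \<comment> \<open>\<open>fac\<close> asks for a trigonometric polynomial at every index, so
        the choice is extended by 0 outside \<open>I\<close>.\<close>
      define t where "t i = (if i \<in> I then t0 i else (\<lambda>_ _. 0))" for i
      have t: "trig_poly (\<lambda>x. complex_of_real (t i m x))" "\<bar>t i m x\<bar> \<le> 2" for i m x
        using t0 by (auto simp: t_def trig_poly_const)
      have tl: "(\<lambda>m. t i m x) \<longlonglongrightarrow> indicator (A i) x" if "i \<in> I" for i x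
        using t0 that by (auto simp: t_def)
      note [measurable] = tm[OF t(1)]
      have A[measurable]: "A i \<in> sets borel" if "i \<in> I" for i
        using Pi_mem[OF \<open>A \<in> I \<rightarrow> ?E\<close> that] by auto
      have "(\<lambda>m. expectation (\<lambda>\<omega>. \<Prod>i\<in>I. t i m (X i \<omega>))) \<longlonglongrightarrow> expectation (\<lambda>\<omega>. \<Prod>i\<in>I. indicator (A i) (X i \<omega>))"
      proof (rule integral_dominated_convergence[where w="\<lambda>_. 2 ^ card I"])
        show "AE \<omega> in M. norm (\<Prod>i\<in>I. t i m (X i \<omega>)) \<le> 2 ^ card I" for m
          using t(2) by (auto simp: abs_prod simp flip: prod_constant intro!: prod_mono)
      qed (auto intro!: tendsto_prod tl)
      moreover have "(\<lambda>m. \<Prod>i\<in>I. expectation (\<lambda>\<omega>. t i m (X i \<omega>))) \<longlonglongrightarrow> (\<Prod>i\<in>I. expectation (\<lambda>\<omega>. indicator (A i) (X i \<omega>)))"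
      proof (rule tendsto_prod)
        fix i assume i: "i \<in> I"
        then have [measurable]: "X i \<in> borel_measurable M" "A i \<in> sets borel" by auto
        show "(\<lambda>m. expectation (\<lambda>\<omega>. t i m (X i \<omega>))) \<longlonglongrightarrow> expectation (\<lambda>\<omega>. indicator (A i) (X i \<omega>))"
          by (rule integral_dominated_convergence[where w="\<lambda>_. 2"]) (use t(2) tl[OF i] in auto)
      qed
      moreover have "expectation (\<lambda>\<omega>. \<Prod>i\<in>I. t i m (X i \<omega>)) = (\<Prod>i\<in>I. expectation (\<lambda>\<omega>. t i m (X i \<omega>)))" for m
      proof -
        have "expectation (\<lambda>\<omega>. \<Prod>i\<in>I. complex_of_real (t i m (X i \<omega>))) =
            (\<Prod>i\<in>I. expectation (\<lambda>\<omega>. complex_of_real (t i m (X i \<omega>))))"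
          by (rule fac[OF t(1)])
        then show ?thesis by (simp add: integral_complex_of_real flip: of_real_prod)
      qed
      ultimately have "expectation (\<lambda>\<omega>. \<Prod>i\<in>I. indicat_real (A i) (X i \<omega>)) = (\<Prod>i\<in>I. expectation (\<lambda>\<omega>. indicat_real (A i) (X i \<omega>)))"
        using LIMSEQ_unique by auto
      moreover have "expectation (\<lambda>\<omega>. \<Prod>i\<in>I. indicat_real (A i) (X i \<omega>)) = prob (\<Inter>i\<in>I. X i -` A i \<inter> space M)"
      proof -
        have "expectation (\<lambda>\<omega>. \<Prod>i\<in>I. indicat_real (A i) (X i \<omega>)) = expectation (indicat_real (\<Inter>i\<in>I. X i -` A i \<inter> space M))"
          using I by (intro Bochner_Integration.integral_cong) (auto simp: indicator_def prod_zero_iff)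
        moreover have "(\<Inter>i\<in>I. X i -` A i \<inter> space M) \<inter> space M = (\<Inter>i\<in>I. X i -` A i \<inter> space M)"
          using I by blast
        ultimately show ?thesis by simp
      qed
      moreover have "expectation (\<lambda>\<omega>. indicat_real (A i) (X i \<omega>)) = prob (X i -` A i \<inter> space M)" if "i \<in> I" for i
      proof -
        have "expectation (\<lambda>\<omega>. indicat_real (A i) (X i \<omega>)) = expectation (indicat_real (X i -` A i \<inter> space M))"
          by (intro Bochner_Integration.integral_cong) (auto simp: indicator_def)
        then show ?thesis using that by simp
      qed
      ultimately show "prob (\<Inter>j\<in>I. X j -` A j \<inter> space M) = (\<Prod>j\<in>I. prob (X j -` A j \<inter> space M))"
        by simp
    qed
  qed (use I X in auto)
qed

section \<open>Gaussian noise\<close>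

lemma prob_space_std_normal: "prob_space std_normal_distribution"
  by (intro prob_space_normal_density) simp

lemma gauss_law_moments:
  shows "integrable (gauss_law m s) (\<lambda>x. x)" "integrable (gauss_law m s) (\<lambda>x. x\<^sup>2)"
    "integral\<^sup>L (gauss_law m s) (\<lambda>x. x) = m" "integral\<^sup>L (gauss_law m s) (\<lambda>x. x\<^sup>2) = m\<^sup>2 + s\<^sup>2"
proof -
  define N where "N = std_normal_distribution"
  interpret N: prob_space N unfolding N_def by (rule prob_space_std_normal)
  have [measurable_cong]: "sets N = sets borel" by (simp add: N_def)
  have [simp]: "integrable N (\<lambda>x. x)" "integrable N (\<lambda>x. x\<^sup>2)"
    using integrable_std_normal_distribution_moment[of 1] integrable_std_normal_distribution_moment[of 2]
    by (simp_all add: N_def)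
  have [simp]: "N.expectation (\<lambda>x. x) = 0" "N.expectation (\<lambda>x. x\<^sup>2) = 1"
    using integral_std_normal_distribution_moment_odd[of 1] std_normal_distribution_even_moments(1)[of 1]
    by (simp_all add: N_def fact_numeral)
  have sq: "(\<lambda>x. (m + s * x)\<^sup>2) = (\<lambda>x. m\<^sup>2 + (2 * m * s) * x + s\<^sup>2 * x\<^sup>2)"
    by (simp add: power2_eq_square algebra_simps)
  have [simp]: "N.expectation (\<lambda>_. c) = c" for c :: real using N.prob_space by simp
  have *: "gauss_law m s = distr N borel (\<lambda>x. m + s * x)" by (simp add: gauss_law_def N_def)
  show "integrable (gauss_law m s) (\<lambda>x. x)" unfolding * by (subst integrable_distr_eq) auto
  show "integrable (gauss_law m s) (\<lambda>x. x\<^sup>2)" unfolding *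
    by (subst integrable_distr_eq) (auto simp: sq)
  show "integral\<^sup>L (gauss_law m s) (\<lambda>x. x) = m" unfolding * by (subst integral_distr) (auto simp: N.prob_space)
  show "integral\<^sup>L (gauss_law m s) (\<lambda>x. x\<^sup>2) = m\<^sup>2 + s\<^sup>2" unfolding *
    by (subst integral_distr) (auto simp: sq N.prob_space)
qed

lemma gauss_law_char:
  "integral\<^sup>L (gauss_law m s) (\<lambda>x. cis (t * x)) = cis (t * m) * exp (- (t * s)\<^sup>2 / 2)"
proof -
  have "integral\<^sup>L (gauss_law m s) (\<lambda>x. cis (t * x)) =
      integral\<^sup>L std_normal_distribution (\<lambda>x. cis (t * m) * cis ((t * s) * x))"
    unfolding gauss_law_def by (subst integral_distr) (auto simp: cis_mult algebra_simps)
  also have "\<dots> = cis (t * m) * char std_normal_distribution (t * s)"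
    by (simp add: char_def cis_conv_exp)
  finally show ?thesis by (simp add: char_std_normal_distribution exp_of_real)
qed

lemma gauss_law_0_1: "gauss_law 0 1 = std_normal_distribution"
  unfolding gauss_law_def by (simp add: distr_id2)

subsection \<open>The Levinson--Durbin recursion\<close>

text \<open>With n = Suc m, the shifted sequence gives the error of predicting \<xi>_{n+1} from
  \<xi>_2, ..., \<xi>_n, and the reversed one the backward error at \<xi>_1; \<beta> is their
  covariance over their common variance v, so the new error is orthogonal to \<xi>_1 as well.
  Coefficients outside {1..n} are 0, which makes shift and reversal total.\<close>

primrec levinson :: "(nat \<Rightarrow> real) \<Rightarrow> nat \<Rightarrow> (nat \<Rightarrow> real) \<times> real" where
  "levinson r 0 = ((\<lambda>i. if i = 1 then 1 else 0), 1)"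
| "levinson r (Suc m) = (let K = fst (levinson r m); v = snd (levinson r m);
      \<beta> = (\<Sum>i=1..Suc m. K i * r i) / v
    in ((\<lambda>i. (if i = 0 then 0 else K (i - 1)) - \<beta> * K (Suc (Suc m) - i)), v * (1 - \<beta>\<^sup>2)))"

text \<open>Indices are shifted by one with respect to \<^const>\<open>levinson\<close>: \<open>lev_coeff r n\<close> and
  \<open>lev_var r n\<close> are \<open>k(n, \<cdot>)\<close> and \<open>\<sigma>\<^sub>n\<^sup>2\<close> for \<open>n \<ge> 1\<close>.\<close>

definition lev_coeff :: "(nat \<Rightarrow> real) \<Rightarrow> nat \<Rightarrow> nat \<Rightarrow> real" where
  "lev_coeff r n = fst (levinson r (n - 1))"

definition lev_var :: "(nat \<Rightarrow> real) \<Rightarrow> nat \<Rightarrow> real" where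
  "lev_var r n = snd (levinson r (n - 1))"

definition lev_refl :: "(nat \<Rightarrow> real) \<Rightarrow> nat \<Rightarrow> real" where
  "lev_refl r n = (\<Sum>i=1..n. lev_coeff r n i * r i) / lev_var r n"

lemma lev_var_1 [simp]: "lev_var r (Suc 0) = 1"
  by (simp add: lev_var_def)

lemma lev_var_Suc: "n \<ge> 1 \<Longrightarrow> lev_var r (Suc n) = lev_var r n * (1 - (lev_refl r n)\<^sup>2)"
  by (cases n) (auto simp: lev_var_def lev_refl_def lev_coeff_def Let_def)

lemma lev_coeff_rec:
  "n \<ge> 1 \<Longrightarrow> lev_coeff r (Suc n) i =
    (if i = 0 then 0 else lev_coeff r n (i - 1)) - lev_refl r n * lev_coeff r n (Suc n - i)"
  by (cases n) (auto simp: lev_var_def lev_refl_def lev_coeff_def Let_def)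

lemma lev_coeff_bounds:
  assumes "n \<ge> 1"
  shows "lev_coeff r n 0 = 0 \<and> lev_coeff r n n = 1 \<and> (\<forall>i>n. lev_coeff r n i = 0)"
  using assms
proof (induction n rule: dec_induct)
  case base
  show ?case by (simp add: lev_coeff_def)
next
  case (step n)
  then show ?case by (auto simp: lev_coeff_rec)
qed

lemma lev_coeff_0 [simp]: "n \<ge> 1 \<Longrightarrow> lev_coeff r n 0 = 0"
  and lev_coeff_same [simp]: "n \<ge> 1 \<Longrightarrow> lev_coeff r n n = 1"
  and lev_coeff_beyond: "n \<ge> 1 \<Longrightarrow> i > n \<Longrightarrow> lev_coeff r n i = 0"
  using lev_coeff_bounds by auto

lemma lev_coeff_Suc:
  "n \<ge> 1 \<Longrightarrow> lev_coeff r (Suc n) (Suc i) = lev_coeff r n i - lev_refl r n * lev_coeff r n (n - i)"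
  by (simp add: lev_coeff_rec)

lemma lev_coeff_first: "n \<ge> 1 \<Longrightarrow> lev_coeff r (Suc n) 1 = - lev_refl r n"
  using lev_coeff_Suc[of n r 0] by simp

text \<open>The normal equations. In the step, the Toeplitz form of \<open>R\<close> makes the
  shifted and the reversed sum vanish for 2 \<le> j \<le> n. At j = 1 they are \<beta> V_n and V_n,
  which the choice of \<beta> cancels; at j = n + 1 they are V_n and \<beta> V_n, which gives the
  new variance. Nonvanishing is assumed only below n so that the lemma can serve in proving that the
  variances are positive.\<close>

lemma lev_coeff_orthogonal:
  fixes r :: "nat \<Rightarrow> real"
  defines "R \<equiv> \<lambda>i j. r (nat \<bar>int i - int j\<bar>)"
  assumes n: "n \<ge> 1" and v: "\<And>m. 1 \<le> m \<Longrightarrow> m < n \<Longrightarrow> lev_var r m \<noteq> 0" and r0: "r 0 = 1"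
    and j: "1 \<le> j" "j \<le> n"
  shows "(\<Sum>i=1..n. lev_coeff r n i * R i j) = (if j = n then lev_var r n else 0)"
  using n v j
proof (induction n arbitrary: j rule: dec_induct)
  case base
  then have "j = 1" by simp
  then show ?case by (simp add: R_def r0 lev_var_def lev_coeff_def)
next
  case (step n)
  let ?K = "lev_coeff r" and ?b = "lev_refl r n"
  have n: "n \<ge> 1" using step by simp
  have vn: "lev_var r n \<noteq> 0" using step n by simp
  have b: "(\<Sum>i=1..n. ?K n i * r i) = ?b * lev_var r n"
    using vn by (simp add: lev_refl_def)
  have IH: "(\<Sum>i=1..n. ?K n i * R i j) = (if j = n then lev_var r n else 0)" if "1 \<le> j" "j \<le> n" for j
    using step.IH[of j] step.prems that by simp
  have "(\<Sum>i=1..Suc n. ?K (Suc n) i * R i j) = (\<Sum>i=0..n. ?K (Suc n) (Suc i) * R (Suc i) j)"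
    using sum.shift_bounds_cl_Suc_ivl[of "\<lambda>i. ?K (Suc n) i * R i j" 0 n] by simp
  also have "\<dots> = (\<Sum>i=0..n. ?K n i * R (Suc i) j) - ?b * (\<Sum>i=0..n. ?K n (n - i) * R (Suc i) j)"
    using n by (simp add: lev_coeff_Suc algebra_simps sum_subtractf sum_distrib_left)
  also have "(\<Sum>i=0..n. ?K n (n - i) * R (Suc i) j) = (\<Sum>i=0..n. ?K n i * R (Suc (n - i)) j)"
    using sum.atLeastAtMost_rev[of "\<lambda>i. ?K n (n - i) * R (Suc i) j" 0 n]
    by (auto intro!: sum.cong)
  also have "(\<Sum>i=0..n. ?K n i * R (Suc i) j) = (\<Sum>i=1..n. ?K n i * R (Suc i) j)"
    using n by (simp add: sum.atLeast_Suc_atMost)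
  also have "(\<Sum>i=0..n. ?K n i * R (Suc (n - i)) j) = (\<Sum>i=1..n. ?K n i * R (Suc (n - i)) j)"
    using n by (simp add: sum.atLeast_Suc_atMost)
  finally have eq: "(\<Sum>i=1..Suc n. ?K (Suc n) i * R i j) =
      (\<Sum>i=1..n. ?K n i * R (Suc i) j) - ?b * (\<Sum>i=1..n. ?K n i * R (Suc (n - i)) j)" .
  show ?case
  proof (cases "j = 1")
    case True
    have "(\<Sum>i=1..n. ?K n i * R (Suc i) j) = (\<Sum>i=1..n. ?K n i * r i)"
      by (intro sum.cong) (auto simp: R_def True)
    moreover have "(\<Sum>i=1..n. ?K n i * R (Suc (n - i)) j) = (\<Sum>i=1..n. ?K n i * R i n)"
      by (intro sum.cong) (auto simp: R_def True intro!: arg_cong[where f=r])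
    ultimately show ?thesis using eq b IH[of n] n True by simp
  next
    case False
    then obtain j' where j': "j = Suc j'" "1 \<le> j'" "j' \<le> n" using step.prems by (cases j) auto
    have s1: "(\<Sum>i=1..n. ?K n i * R (Suc i) j) = (if j' = n then lev_var r n else 0)"
      using IH[OF j'(2,3)] by (simp add: R_def j'(1))
    show ?thesis
    proof (cases "j' = n")
      case True
      have "(\<Sum>i=1..n. ?K n i * R (Suc (n - i)) j) = (\<Sum>i=1..n. ?K n i * r i)"
        by (intro sum.cong) (auto simp: R_def True j' intro!: arg_cong[where f=r])
      then have "(\<Sum>i=1..Suc n. ?K (Suc n) i * R i j) = lev_var r n - ?b * (?b * lev_var r n)"
        unfolding eq s1 using b True by simp
      also have "\<dots> = lev_var r (Suc n)"
        using n by (simp add: lev_var_Suc power2_eq_square right_diff_distrib)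
      finally show ?thesis using True j' by simp
    next
      case False
      have "(\<Sum>i=1..n. ?K n i * R (Suc (n - i)) j) = (\<Sum>i=1..n. ?K n i * R i (n - j'))"
        using j' by (intro sum.cong) (auto simp: R_def j' intro!: arg_cong[where f=r])
      also have "\<dots> = 0" using j' False by (subst IH) auto
      finally show ?thesis unfolding eq s1 using False j' by simp
    qed
  qed
qed

subsection \<open>Filtrations generated by independent variables\<close>

lemma subalgebra_past:
  assumes "\<And>i. 1 \<le> i \<Longrightarrow> i < n \<Longrightarrow> X i \<in> borel_measurable M"
  shows "subalgebra M (past M X n)"
proof -
  have "(\<lambda>\<omega>. \<lambda>i\<in>{1..<n}. X i \<omega>) \<in> M \<rightarrow>\<^sub>M PiM {1..<n} (\<lambda>_. borel)"
    using assms by (intro measurable_restrict) auto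
  then show ?thesis
    unfolding subalgebra_def past_def
    by (auto simp: sets_vimage_algebra intro!: sets.sigma_sets_subset measurable_sets)
qed

lemma space_past [simp]: "space (past M X n) = space M"
  by (simp add: past_def)

lemma measurable_past_component:
  assumes "1 \<le> i" "i < n"
  shows "X i \<in> borel_measurable (past M X n)"
proof -
  have "(\<lambda>\<omega>. \<lambda>i\<in>{1..<n}. X i \<omega>) \<in> past M X n \<rightarrow>\<^sub>M PiM {1..<n} (\<lambda>_. borel)"
    unfolding past_def by (intro measurable_vimage_algebra1) (auto simp: space_PiM)
  from measurable_compose[OF this measurable_component_singleton[of i]] show ?thesis
    using assms by simp
qed

lemma sets_past_le:
  assumes "\<And>i. 1 \<le> i \<Longrightarrow> i < n \<Longrightarrow> X i \<in> borel_measurable N" "space N = space M"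
  shows "sets (past M X n) \<subseteq> sets N"
proof -
  have "(\<lambda>\<omega>. \<lambda>i\<in>{1..<n}. X i \<omega>) \<in> N \<rightarrow>\<^sub>M PiM {1..<n} (\<lambda>_. borel)"
    using assms by (intro measurable_restrict) auto
  then show ?thesis using assms(2)
    unfolding past_def
    by (auto simp: sets_vimage_algebra simp flip: assms(2) intro!: sets.sigma_sets_subset measurable_sets)
qed

lemma sigma_sets_vimage_measurable:
  assumes "Y \<in> vimage_algebra \<Omega> X S \<rightarrow>\<^sub>M N"
  shows "sigma_sets \<Omega> {Y -` A \<inter> \<Omega> |A. A \<in> sets N} \<subseteq> sigma_sets \<Omega> {X -` A \<inter> \<Omega> |A. A \<in> sets S}"
proof (rule sigma_sets_mono, safe)
  fix A assume "A \<in> sets N"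
  from measurable_sets[OF assms this]
  show "Y -` A \<inter> \<Omega> \<in> sigma_sets \<Omega> {X -` A \<inter> \<Omega> |A. A \<in> sets S}"
    by (simp add: sets_vimage_algebra)
qed

text \<open>\<open>Y\<close> may be anything measurable in the past, with values in any space: real
  variables, their squares, indicators and pairs are inserted later.\<close>

lemma (in prob_space) indep_var_past:
  assumes ind: "indep_vars (\<lambda>_. borel) X {1..n}" and n: "n \<ge> 1"
    and Y: "Y \<in> past M X n \<rightarrow>\<^sub>M N" and h: "h \<in> borel \<rightarrow>\<^sub>M N'"
  shows "indep_var N Y N' (\<lambda>\<omega>. h (X n \<omega>))"
proof -
  have X: "X i \<in> borel_measurable M" if "1 \<le> i" "i \<le> n" for i
    using ind that by (auto simp: indep_vars_def)
  let ?P = "PiM {1..<n} (\<lambda>_. borel)" and ?Q = "PiM {n} (\<lambda>_. borel)"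
  let ?X = "\<lambda>\<omega>. \<lambda>i\<in>{1..<n}. X i \<omega>" and ?Z = "\<lambda>\<omega>. \<lambda>i\<in>{n}. X i \<omega>"
  have "indep_var ?P ?X ?Q ?Z"
    using n by (intro indep_var_restrict[OF ind]) auto
  then have *: "indep_set (sigma_sets (space M) {?X -` A \<inter> space M |A. A \<in> sets ?P})
      (sigma_sets (space M) {?Z -` A \<inter> space M |A. A \<in> sets ?Q})"
    by (simp add: indep_var_eq)
  have Y': "Y \<in> measurable M N"
    by (rule measurable_from_subalg[OF subalgebra_past Y]) (use X in simp)
  have "?Z \<in> vimage_algebra (space M) ?Z ?Q \<rightarrow>\<^sub>M ?Q"
    by (intro measurable_vimage_algebra1) (auto simp: space_PiM)
  moreover have "(\<lambda>x. h (x n)) \<in> ?Q \<rightarrow>\<^sub>M N'"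
    by (rule measurable_compose[OF _ h], rule measurable_component_singleton) simp
  ultimately have "(\<lambda>\<omega>. h (?Z \<omega> n)) \<in> vimage_algebra (space M) ?Z ?Q \<rightarrow>\<^sub>M N'"
    by (rule measurable_compose)
  then have hX: "(\<lambda>\<omega>. h (X n \<omega>)) \<in> vimage_algebra (space M) ?Z ?Q \<rightarrow>\<^sub>M N'" by simp
  have "indep_set (sigma_sets (space M) {Y -` A \<inter> space M |A. A \<in> sets N})
      (sigma_sets (space M) {(\<lambda>\<omega>. h (X n \<omega>)) -` A \<inter> space M |A. A \<in> sets N'})"
    using * sigma_sets_vimage_measurable[OF Y[unfolded past_def]] sigma_sets_vimage_measurable[OF hX]
    unfolding indep_sets2_eq by blast
  moreover have "(\<lambda>\<omega>. h (X n \<omega>)) \<in> measurable M N'"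
    using measurable_compose[OF X[of n] h] n by simp
  ultimately show ?thesis using Y' by (simp add: indep_var_eq)
qed

subsection \<open>Innovations\<close>

locale gaussian_noise = prob_space M
  for M :: "'w measure" +
  fixes \<xi> :: "nat \<Rightarrow> 'w \<Rightarrow> real"
  assumes gauss: "gaussian_process M \<xi>" and stat: "stationary_process M \<xi>"
    and cent: "centered_process M \<xi>" and unit: "autocov M \<xi> 0 = 1"
    and decorr: "autocov M \<xi> \<longlonglongrightarrow> 0"
begin

abbreviation "r \<equiv> autocov M \<xi>"
abbreviation "lin J c \<equiv> (\<lambda>\<omega>. \<Sum>j\<in>J. c j * \<xi> j \<omega>)"

definition R :: "nat \<Rightarrow> nat \<Rightarrow> real" where "R i j = r (nat \<bar>int i - int j\<bar>)"

lemma xi_measurable [measurable]: "n \<ge> 1 \<Longrightarrow> \<xi> n \<in> borel_measurable M"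
  using gauss by (simp add: gaussian_process_def)

lemma lin_measurable: "J \<subseteq> {1..} \<Longrightarrow> lin J c \<in> borel_measurable M"
  by (intro borel_measurable_sum borel_measurable_times borel_measurable_const xi_measurable) auto

lemma lin_gauss:
  assumes J: "finite J" "J \<subseteq> {1..}"
  obtains m s where "s \<ge> 0" "distr M borel (lin J c) = gauss_law m s"
proof -
  have "\<exists>m s. s \<ge> 0 \<and> distr M borel (lin J c) = gauss_law m s"
    using gauss J by (simp add: gaussian_process_def)
  then show thesis using that by blast
qed

lemma lin_square_integrable:
  assumes J: "finite J" "J \<subseteq> {1..}"
  shows "integrable M (lin J c)" "integrable M (\<lambda>\<omega>. (lin J c \<omega>)\<^sup>2)"
proof -
  obtain m s where "distr M borel (lin J c) = gauss_law m s" using lin_gauss[OF J] .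
  then have "integrable (distr M borel (lin J c)) (\<lambda>x. x)" "integrable (distr M borel (lin J c)) (\<lambda>x. x\<^sup>2)"
    using gauss_law_moments(1,2)[of m s] by simp_all
  then show "integrable M (lin J c)" "integrable M (\<lambda>\<omega>. (lin J c \<omega>)\<^sup>2)"
    using lin_measurable[OF J(2), of c] by (simp_all add: integrable_distr_eq)
qed

lemma xi_integrable: "n \<ge> 1 \<Longrightarrow> integrable M (\<xi> n)" "n \<ge> 1 \<Longrightarrow> integrable M (\<lambda>\<omega>. (\<xi> n \<omega>)\<^sup>2)"
  using lin_square_integrable[of "{n}" "\<lambda>_. 1"] by auto

lemma expectation_lin:
  assumes J: "finite J" "J \<subseteq> {1..}"
  shows "expectation (lin J c) = 0"
proof -
  have "expectation (lin J c) = (\<Sum>j\<in>J. c j * expectation (\<xi> j))"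
    using J by (subst Bochner_Integration.integral_sum) (auto intro!: integrable_mult_right xi_integrable)
  also have "\<dots> = 0" using J cent by (intro sum.neutral) (auto simp: centered_process_def)
  finally show ?thesis .
qed

text \<open>\<open>gaussian_process\<close> only asserts that some parameters exist; they are
  recovered from the first two moments, s \<ge> 0 fixing the sign.\<close>

lemma lin_law:
  assumes J: "finite J" "J \<subseteq> {1..}"
  shows "distr M borel (lin J c) = gauss_law 0 (sqrt (expectation (\<lambda>\<omega>. (lin J c \<omega>)\<^sup>2)))"
proof -
  obtain m s where ms: "s \<ge> 0" "distr M borel (lin J c) = gauss_law m s" using lin_gauss[OF J] .
  have "m = expectation (lin J c)" "m\<^sup>2 + s\<^sup>2 = expectation (\<lambda>\<omega>. (lin J c \<omega>)\<^sup>2)"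
    using gauss_law_moments(3,4)[of m s] lin_measurable[OF J(2), of c]
    by (simp_all add: integral_distr flip: ms(2))
  then have "s = sqrt (expectation (\<lambda>\<omega>. (lin J c \<omega>)\<^sup>2))"
    using expectation_lin[OF J] ms(1) by (metis add_0 power_zero_numeral real_sqrt_unique)
  then show ?thesis using ms expectation_lin[OF J] \<open>m = _\<close> by simp
qed

lemma lin_char:
  assumes J: "finite J" "J \<subseteq> {1..}"
  shows "expectation (\<lambda>\<omega>. cis (lin J c \<omega>)) = complex_of_real (exp (- expectation (\<lambda>\<omega>. (lin J c \<omega>)\<^sup>2) / 2))"
proof -
  have "expectation (\<lambda>\<omega>. cis (lin J c \<omega>)) = integral\<^sup>L (distr M borel (lin J c)) (\<lambda>x. cis (1 * x))"
    using lin_measurable[OF J(2), of c] by (simp add: integral_distr)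
  also have "\<dots> = complex_of_real (exp (- expectation (\<lambda>\<omega>. (lin J c \<omega>)\<^sup>2) / 2))"
    unfolding lin_law[OF J] by (subst gauss_law_char) (simp add: integral_nonneg)
  finally show ?thesis .
qed

lemma cov_integrable:
  assumes "i \<ge> 1" "j \<ge> 1"
  shows "integrable M (\<lambda>\<omega>. \<xi> i \<omega> * \<xi> j \<omega>)"
proof (rule Bochner_Integration.integrable_bound)
  show "integrable M (\<lambda>\<omega>. (\<xi> i \<omega>)\<^sup>2 + (\<xi> j \<omega>)\<^sup>2)"
    using assms by (intro Bochner_Integration.integrable_add xi_integrable)
  show "(\<lambda>\<omega>. \<xi> i \<omega> * \<xi> j \<omega>) \<in> borel_measurable M" using assms by measurable
  have "\<bar>x * y\<bar> \<le> \<bar>x\<^sup>2 + y\<^sup>2\<bar>" for x y :: real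
  proof -
    have "2 * (\<bar>x\<bar> * \<bar>y\<bar>) \<le> x\<^sup>2 + y\<^sup>2"
      using sum_squares_bound[of "\<bar>x\<bar>" "\<bar>y\<bar>"] by (simp add: mult.assoc)
    moreover have "0 \<le> \<bar>x\<bar> * \<bar>y\<bar>" by simp
    ultimately show ?thesis by (simp only: abs_mult)
  qed
  then show "AE \<omega> in M. norm (\<xi> i \<omega> * \<xi> j \<omega>) \<le> norm ((\<xi> i \<omega>)\<^sup>2 + (\<xi> j \<omega>)\<^sup>2)" by simp
qed

lemma cov_le:
  assumes "1 \<le> i" "i \<le> j"
  shows "expectation (\<lambda>\<omega>. \<xi> i \<omega> * \<xi> j \<omega>) = r (j - i)"
proof -
  \<comment> \<open>Chosen so that the first and last entry of the block (\<xi>_{1+h}, ...,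
    \<xi>_{n+h}) are \<xi>_i and \<xi>_j.\<close>
  define n h where "n = Suc (j - i)" and "h = i - 1"
  have m: "(\<lambda>\<omega>. \<lambda>i\<in>{1..n}. \<xi> (i + h) \<omega>) \<in> M \<rightarrow>\<^sub>M PiM {1..n} (\<lambda>_. borel)" for h
    by (intro measurable_restrict xi_measurable) auto
  have c: "(\<lambda>x. x 1 * x n :: real) \<in> borel_measurable (PiM {1..n} (\<lambda>_. borel))"
    by (intro borel_measurable_times measurable_component_singleton) (auto simp: n_def)
  have "distr M (PiM {1..n} (\<lambda>_. borel)) (\<lambda>\<omega>. \<lambda>i\<in>{1..n}. \<xi> (i + h) \<omega>) =
      distr M (PiM {1..n} (\<lambda>_. borel)) (\<lambda>\<omega>. \<lambda>i\<in>{1..n}. \<xi> (i + 0) \<omega>)"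
    using stat by (simp add: stationary_process_def)
  from arg_cong[OF this, of "\<lambda>D. integral\<^sup>L D (\<lambda>x. x 1 * x n)"]
  show ?thesis using assms
    unfolding integral_distr[OF m c] by (simp add: n_def h_def autocov_def)
qed

lemma cov: "i \<ge> 1 \<Longrightarrow> j \<ge> 1 \<Longrightarrow> expectation (\<lambda>\<omega>. \<xi> i \<omega> * \<xi> j \<omega>) = R i j"
proof -
  have "nat \<bar>int i - int j\<bar> = (if i \<le> j then j - i else i - j)" by auto
  then show "i \<ge> 1 \<Longrightarrow> j \<ge> 1 \<Longrightarrow> expectation (\<lambda>\<omega>. \<xi> i \<omega> * \<xi> j \<omega>) = R i j"
    using cov_le[of i j] cov_le[of j i] by (auto simp: R_def mult.commute)
qed

lemma cov_lin_lin:
  assumes J: "finite J" "J \<subseteq> {1..}" and L: "finite L" "L \<subseteq> {1..}"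
  shows "integrable M (\<lambda>\<omega>. lin J c \<omega> * lin L d \<omega>)"
    "expectation (\<lambda>\<omega>. lin J c \<omega> * lin L d \<omega>) = (\<Sum>i\<in>J. \<Sum>j\<in>L. c i * d j * R i j)"
proof -
  have eq: "(\<lambda>\<omega>. lin J c \<omega> * lin L d \<omega>) = (\<lambda>\<omega>. \<Sum>i\<in>J. \<Sum>j\<in>L. (c i * d j) * (\<xi> i \<omega> * \<xi> j \<omega>))"
    by (simp add: sum_product mult_ac)
  have i: "integrable M (\<lambda>\<omega>. (c i * d j) * (\<xi> i \<omega> * \<xi> j \<omega>))" if "i \<in> J" "j \<in> L" for i j
    using that J L by (intro integrable_mult_right cov_integrable) auto
  show "integrable M (\<lambda>\<omega>. lin J c \<omega> * lin L d \<omega>)"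
    unfolding eq by (intro Bochner_Integration.integrable_sum i)
  have "expectation (\<lambda>\<omega>. lin J c \<omega> * lin L d \<omega>) =
      (\<Sum>i\<in>J. expectation (\<lambda>\<omega>. \<Sum>j\<in>L. (c i * d j) * (\<xi> i \<omega> * \<xi> j \<omega>)))"
    unfolding eq by (intro Bochner_Integration.integral_sum Bochner_Integration.integrable_sum i)
  also have "\<dots> = (\<Sum>i\<in>J. \<Sum>j\<in>L. expectation (\<lambda>\<omega>. (c i * d j) * (\<xi> i \<omega> * \<xi> j \<omega>)))"
    by (intro sum.cong refl Bochner_Integration.integral_sum i)
  also have "\<dots> = (\<Sum>i\<in>J. \<Sum>j\<in>L. c i * d j * R i j)"
    using J L by (intro sum.cong refl) (auto simp: cov subset_eq)
  finally show "expectation (\<lambda>\<omega>. lin J c \<omega> * lin L d \<omega>) = (\<Sum>i\<in>J. \<Sum>j\<in>L. c i * d j * R i j)" .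
qed

end

section \<open>Prediction errors: orthogonality and positive variance\<close>

context gaussian_noise
begin

abbreviation "K \<equiv> lev_coeff r"
abbreviation "V \<equiv> lev_var r"

definition \<eta> :: "nat \<Rightarrow> 'w \<Rightarrow> real" where "\<eta> n = lin {1..n} (K n)"

lemma eta_measurable [measurable]: "\<eta> n \<in> borel_measurable M"
  unfolding \<eta>_def by (rule lin_measurable) auto

lemma R_self: "R i i = 1"
  using unit by (simp add: R_def)

lemma eta_orthogonal:
  assumes n: "n \<ge> 1" and v: "\<And>m. 1 \<le> m \<Longrightarrow> m < n \<Longrightarrow> V m \<noteq> 0" and m: "1 \<le> m" "m \<le> n"
  shows "integrable M (\<lambda>\<omega>. \<eta> n \<omega> * \<eta> m \<omega>)"
    "expectation (\<lambda>\<omega>. \<eta> n \<omega> * \<eta> m \<omega>) = (if m = n then V n else 0)"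
proof -
  show "integrable M (\<lambda>\<omega>. \<eta> n \<omega> * \<eta> m \<omega>)" unfolding \<eta>_def by (rule cov_lin_lin) auto
  have "expectation (\<lambda>\<omega>. \<eta> n \<omega> * \<eta> m \<omega>) = (\<Sum>i=1..n. \<Sum>j=1..m. K n i * K m j * R i j)"
    unfolding \<eta>_def by (rule cov_lin_lin) auto
  also have "\<dots> = (\<Sum>j=1..m. K m j * (\<Sum>i=1..n. K n i * R i j))"
    by (subst sum.swap) (simp add: sum_distrib_left mult_ac)
  also have "\<dots> = (\<Sum>j=1..m. K m j * (if j = n then V n else 0))"
    using lev_coeff_orthogonal[OF n v unit] m
    by (intro sum.cong refl) (simp add: R_def)
  also have "\<dots> = (if m = n then V n else 0)"
    using m n by (auto simp: if_distrib[of "\<lambda>x. K _ _ * x"] sum.delta cong: if_cong)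
  finally show "expectation (\<lambda>\<omega>. \<eta> n \<omega> * \<eta> m \<omega>) = (if m = n then V n else 0)" .
qed

text \<open>Coordinates refer to the orthogonal errors \<open>\<eta>\<close>, whose variances are
  known, so that Parseval's identity applies. Equality is almost sure because a vanishing variance
  yields no more.\<close>

definition in_span :: "nat \<Rightarrow> ('w \<Rightarrow> real) \<Rightarrow> bool" where
  "in_span n X \<longleftrightarrow> (\<exists>c. AE \<omega> in M. X \<omega> = (\<Sum>j=1..n. c j * \<eta> j \<omega>))"

lemma in_span_add: "in_span n X \<Longrightarrow> in_span n Y \<Longrightarrow> in_span n (\<lambda>\<omega>. X \<omega> + Y \<omega>)"
proof -
  assume "in_span n X" "in_span n Y"
  then obtain c d where cd: "AE \<omega> in M. X \<omega> = (\<Sum>j=1..n. c j * \<eta> j \<omega>)"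
    "AE \<omega> in M. Y \<omega> = (\<Sum>j=1..n. d j * \<eta> j \<omega>)" by (auto simp: in_span_def)
  have "AE \<omega> in M. X \<omega> + Y \<omega> = (\<Sum>j=1..n. (c j + d j) * \<eta> j \<omega>)"
    using cd by eventually_elim (simp add: distrib_right sum.distrib)
  then show ?thesis unfolding in_span_def by (intro exI[of _ "\<lambda>j. c j + d j"])
qed

lemma in_span_scale: "in_span n X \<Longrightarrow> in_span n (\<lambda>\<omega>. a * X \<omega>)"
proof -
  assume "in_span n X"
  then obtain c where c: "AE \<omega> in M. X \<omega> = (\<Sum>j=1..n. c j * \<eta> j \<omega>)" by (auto simp: in_span_def)
  have "AE \<omega> in M. a * X \<omega> = (\<Sum>j=1..n. (a * c j) * \<eta> j \<omega>)"
    using c by eventually_elim (simp add: sum_distrib_left mult.assoc)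
  then show ?thesis unfolding in_span_def by (intro exI[of _ "\<lambda>j. a * c j"])
qed

lemma in_span_0: "in_span n (\<lambda>\<omega>. 0)"
  unfolding in_span_def by (intro exI[of _ "\<lambda>_. 0"]) simp

lemma in_span_sum:
  "finite S \<Longrightarrow> (\<And>i. i \<in> S \<Longrightarrow> in_span n (X i)) \<Longrightarrow> in_span n (\<lambda>\<omega>. \<Sum>i\<in>S. a i * X i \<omega>)"
  by (induction S rule: finite_induct) (simp_all add: in_span_0 in_span_add in_span_scale)

lemma in_span_eta: "1 \<le> m \<Longrightarrow> m \<le> n \<Longrightarrow> in_span n (\<eta> m)"
  unfolding in_span_def
  by (intro exI[of _ "\<lambda>j. if j = m then 1 else 0"]) (simp add: if_distrib[of "\<lambda>x. x * _"] sum.delta cong: if_cong)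

lemma in_span_cong: "in_span n X \<Longrightarrow> AE \<omega> in M. Y \<omega> = X \<omega> \<Longrightarrow> in_span n Y"
  unfolding in_span_def by (erule exE, rule exI) (auto elim: eventually_elim2)

text \<open>If the prediction error of order \<open>n + 1\<close> vanished, by stationarity the whole process would
  lie in a finite-dimensional space, in which \<open>r \<longlonglongrightarrow> 0\<close> forces the norms to tend to 0.\<close>

lemma lev_var_pos:
  assumes "n \<ge> 1"
  shows "V n > 0"
  using assms
proof (induction n rule: less_induct)
  case (less N)
  show ?case
  proof (cases "N = 1")
    case False
    then obtain n where N: "N = Suc n" "n \<ge> 1" using less.prems by (cases N) auto
    have pos: "V m > 0" if "1 \<le> m" "m \<le> n" for m using less.IH[of m] that N by simp
    have EN: "expectation (\<lambda>\<omega>. \<eta> N \<omega> * \<eta> N \<omega>) = V N"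
      using eta_orthogonal(2)[of N N] pos N less.prems less_imp_neq[OF less.IH] by fastforce
    have "V N \<ge> 0" unfolding EN[symmetric] by (rule Bochner_Integration.integral_nonneg) simp
    moreover have "V N \<noteq> 0"
    proof
      assume V0: "V N = 0"
      \<comment> \<open>The variance of the combination is a quadratic form in \<open>R\<close>,
        which depends on index differences only; so it vanishes at every shift.\<close>
      have shift: "AE \<omega> in M. (\<Sum>i=1..N. K N i * \<xi> (i + h) \<omega>) = 0" for h
      proof -
        let ?c = "\<lambda>j. K N (j - h)"
        have eq: "(\<Sum>i=1..N. K N i * \<xi> (i + h) \<omega>) = lin {1+h..N+h} ?c \<omega>" for \<omega>
          by (subst sum.shift_bounds_cl_nat_ivl) simp
        have "expectation (\<lambda>\<omega>. lin {1+h..N+h} ?c \<omega> * lin {1+h..N+h} ?c \<omega>) =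
            (\<Sum>i=1+h..N+h. \<Sum>j=1+h..N+h. ?c i * ?c j * R i j)"
          by (rule cov_lin_lin) auto
        also have "\<dots> = (\<Sum>i=1..N. \<Sum>j=1..N. K N i * K N j * R i j)"
          unfolding sum.shift_bounds_cl_nat_ivl by (simp add: R_def)
        also have "\<dots> = V N" unfolding EN[symmetric] \<eta>_def by (rule cov_lin_lin(2)[symmetric]) auto
        finally have "expectation (\<lambda>\<omega>. (lin {1+h..N+h} ?c \<omega>)\<^sup>2) = 0"
          by (simp add: V0 power2_eq_square)
        moreover have "integrable M (\<lambda>\<omega>. (lin {1+h..N+h} ?c \<omega>)\<^sup>2)"
          by (rule lin_square_integrable) auto
        ultimately have "AE \<omega> in M. (lin {1+h..N+h} ?c \<omega>)\<^sup>2 = 0"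
          by (subst (asm) integral_nonneg_eq_0_iff_AE) auto
        then show ?thesis unfolding eq by simp
      qed
      \<comment> \<open>Up to n, \<open>\<eta> m\<close> is solved for \<xi>_m; beyond n, the
        shifted relation expresses \<xi>_m by the n preceding variables.\<close>
      have span: "in_span n (\<xi> m)" if "m \<ge> 1" for m
        using that
      proof (induction m rule: less_induct)
        case (less m)
        show ?case
        proof (cases "m \<le> n")
          case True
          have "\<xi> m \<omega> = 1 * \<eta> m \<omega> + (\<Sum>i\<in>{1..<m}. (- K m i) * \<xi> i \<omega>)" for \<omega>
          proof -
            have "{1..m} = insert m {1..<m}" using less.prems by auto
            then show ?thesis using less.prems by (simp add: \<eta>_def sum_negf)
          qed
          then have "AE \<omega> in M. \<xi> m \<omega> = 1 * \<eta> m \<omega> + (\<Sum>i\<in>{1..<m}. (- K m i) * \<xi> i \<omega>)" by simp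
          moreover have "in_span n (\<lambda>\<omega>. 1 * \<eta> m \<omega> + (\<Sum>i\<in>{1..<m}. (- K m i) * \<xi> i \<omega>))"
            using less True by (intro in_span_add in_span_scale in_span_sum in_span_eta) auto
          ultimately show ?thesis by (rule in_span_cong[rotated])
        next
          case False
          define h where "h = m - N"
          have m: "m = N + h" using False N by (simp add: h_def)
          have "AE \<omega> in M. \<xi> m \<omega> = (\<Sum>i\<in>{1..n}. (- K N i) * \<xi> (i + h) \<omega>)"
            using shift[of h]
          proof eventually_elim
            case (elim \<omega>)
            have "K N N = 1" using less.prems \<open>m = N + h\<close> N by simp
            with elim have "(\<Sum>i=1..n. K N i * \<xi> (i + h) \<omega>) + \<xi> (N + h) \<omega> = 0"
              unfolding N by simp
            then show ?case by (simp add: m sum_negf)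
          qed
          moreover have "in_span n (\<lambda>\<omega>. \<Sum>i\<in>{1..n}. (- K N i) * \<xi> (i + h) \<omega>)"
            using less.IH N m by (intro in_span_sum) auto
          ultimately show ?thesis by (rule in_span_cong[rotated])
        qed
      qed
      define b where "b m j = expectation (\<lambda>\<omega>. \<xi> m \<omega> * \<eta> j \<omega>)" for m j
      have int: "integrable M (\<lambda>\<omega>. \<xi> m \<omega> * \<eta> j \<omega>)" if "m \<ge> 1" for m j
        using cov_lin_lin(1)[of "{m}" "{1..j}" "\<lambda>_. 1" "K j"] that by (simp add: \<eta>_def)
      \<comment> \<open>Parseval: the coordinates of \<xi>_m account for its unit norm. Yet each
        \<open>b m j\<close> is a fixed finite combination of values of r at lags growing with m, so
        the same sum tends to 0.\<close>
      have bsum: "(\<Sum>j=1..n. (b m j)\<^sup>2 / V j) = 1" if m: "m \<ge> 1" for m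
      proof -
        obtain c where c: "AE \<omega> in M. \<xi> m \<omega> = (\<Sum>j=1..n. c j * \<eta> j \<omega>)"
          using span[OF m] by (auto simp: in_span_def)
        have ort: "integrable M (\<lambda>\<omega>. \<eta> i \<omega> * \<eta> j \<omega>)"
          "expectation (\<lambda>\<omega>. \<eta> i \<omega> * \<eta> j \<omega>) = (if i = j then V j else 0)"
          if "i \<in> {1..n}" "j \<in> {1..n}" for i j
          using eta_orthogonal[of i j] eta_orthogonal[of j i] pos that
          by (cases "j \<le> i"; force simp: mult.commute)+
        have bj: "b m j = c j * V j" if j: "j \<in> {1..n}" for j
        proof -
          have "b m j = expectation (\<lambda>\<omega>. \<Sum>i=1..n. c i * (\<eta> i \<omega> * \<eta> j \<omega>))"
            unfolding b_def using m
            by (intro integral_cong_AE) (use c in \<open>auto simp: sum_distrib_right mult.assoc elim!: eventually_mono\<close>)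
          also have "\<dots> = (\<Sum>i=1..n. c i * (if i = j then V j else 0))"
            using ort j by (subst Bochner_Integration.integral_sum) auto
          also have "\<dots> = c j * V j" using j by (simp add: if_distrib sum.delta cong: if_cong)
          finally show ?thesis .
        qed
        have "1 = expectation (\<lambda>\<omega>. \<xi> m \<omega> * \<xi> m \<omega>)" using cov[OF m m] by (simp add: R_self)
        also have "\<dots> = expectation (\<lambda>\<omega>. \<Sum>j=1..n. c j * (\<xi> m \<omega> * \<eta> j \<omega>))"
          using m by (intro integral_cong_AE) (use c in \<open>auto simp: sum_distrib_left mult_ac elim!: eventually_mono\<close>)
        also have "\<dots> = (\<Sum>j=1..n. c j * b m j)"
          unfolding b_def using int[OF m] by (subst Bochner_Integration.integral_sum) auto
        also have "\<dots> = (\<Sum>j=1..n. (b m j)\<^sup>2 / V j)"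
          using pos by (intro sum.cong refl) (force simp: bj power2_eq_square)
        finally show ?thesis by simp
      qed
      have blim: "(\<lambda>m. b m j) \<longlonglongrightarrow> 0" for j
      proof -
        have "eventually (\<lambda>m. (\<Sum>i=1..j. K j i * r (m - i)) = b m j) sequentially"
          using eventually_ge_at_top[of "Suc j"]
        proof eventually_elim
          case (elim m)
          have "b m j = (\<Sum>i=1..j. K j i * R m i)"
            unfolding b_def using cov_lin_lin(2)[of "{m}" "{1..j}" "\<lambda>_. 1" "K j"] elim by (simp add: \<eta>_def)
          also have "\<dots> = (\<Sum>i=1..j. K j i * r (m - i))"
            using elim by (intro sum.cong refl) (auto simp: R_def intro!: arg_cong[where f=r])
          finally show ?case by simp
        qed
        moreover have "(\<lambda>m. \<Sum>i=1..j. K j i * r (m - i)) \<longlonglongrightarrow> (\<Sum>i=1..j. K j i * 0)"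
          by (intro tendsto_sum tendsto_mult tendsto_const filterlim_compose[OF decorr filterlim_minus_const_nat_at_top])
        ultimately show ?thesis by (auto intro: Lim_transform_eventually)
      qed
      have "(\<lambda>m. \<Sum>j=1..n. (b m j)\<^sup>2 / V j) \<longlonglongrightarrow> (\<Sum>j=1..n. 0\<^sup>2 / V j)"
        using pos by (intro tendsto_sum tendsto_divide tendsto_power blim tendsto_const) force
      moreover have "(\<lambda>m. \<Sum>j=1..n. (b m j)\<^sup>2 / V j) \<longlonglongrightarrow> 1"
        by (rule tendsto_eventually) (use bsum in \<open>auto simp: eventually_at_top_linorder\<close>)
      ultimately show False using LIMSEQ_unique by fastforce
    qed
    ultimately show ?thesis by simp
  qed simp
qed

lemma E_eta_eta:
  assumes "1 \<le> m" "1 \<le> n"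
  shows "integrable M (\<lambda>\<omega>. \<eta> n \<omega> * \<eta> m \<omega>)"
    "expectation (\<lambda>\<omega>. \<eta> n \<omega> * \<eta> m \<omega>) = (if m = n then V n else 0)"
proof -
  have v: "V j \<noteq> 0" if "j \<ge> 1" for j using lev_var_pos[OF that] by simp
  have "integrable M (\<lambda>\<omega>. \<eta> n \<omega> * \<eta> m \<omega>) \<and>
      expectation (\<lambda>\<omega>. \<eta> n \<omega> * \<eta> m \<omega>) = (if m = n then V n else 0)"
  proof (cases "m \<le> n")
    case True
    then show ?thesis using eta_orthogonal[OF assms(2) v assms(1)] by simp
  next
    case False
    then show ?thesis using eta_orthogonal[OF assms(1) v assms(2)] by (simp add: mult.commute)
  qed
  then show "integrable M (\<lambda>\<omega>. \<eta> n \<omega> * \<eta> m \<omega>)"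
    "expectation (\<lambda>\<omega>. \<eta> n \<omega> * \<eta> m \<omega>) = (if m = n then V n else 0)" by auto
qed

section \<open>Normalised innovations\<close>

definition \<epsilon> :: "nat \<Rightarrow> 'w \<Rightarrow> real" where "\<epsilon> n \<omega> = \<eta> n \<omega> / sqrt (V n)"

lemma eps_measurable [measurable]: "\<epsilon> n \<in> borel_measurable M"
  unfolding \<epsilon>_def by measurable

lemma E_eps_eps:
  assumes "1 \<le> m" "1 \<le> n"
  shows "integrable M (\<lambda>\<omega>. \<epsilon> n \<omega> * \<epsilon> m \<omega>)"
    "expectation (\<lambda>\<omega>. \<epsilon> n \<omega> * \<epsilon> m \<omega>) = (if m = n then 1 else 0)"
proof -
  have eq: "(\<lambda>\<omega>. \<epsilon> n \<omega> * \<epsilon> m \<omega>) = (\<lambda>\<omega>. (1 / (sqrt (V n) * sqrt (V m))) * (\<eta> n \<omega> * \<eta> m \<omega>))"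
    by (simp add: \<epsilon>_def)
  show "integrable M (\<lambda>\<omega>. \<epsilon> n \<omega> * \<epsilon> m \<omega>)"
    unfolding eq by (intro integrable_mult_right E_eta_eta assms)
  show "expectation (\<lambda>\<omega>. \<epsilon> n \<omega> * \<epsilon> m \<omega>) = (if m = n then 1 else 0)"
    unfolding eq integral_mult_right_zero using E_eta_eta(2)[OF assms] lev_var_pos[OF assms(2)] by simp
qed

lemma eps_lin: "(\<Sum>n=1..N. u n * \<epsilon> n \<omega>) = lin {1..N} (\<lambda>i. \<Sum>n=1..N. u n * K n i / sqrt (V n)) \<omega>"
proof -
  have "\<eta> n \<omega> = (\<Sum>i=1..N. K n i * \<xi> i \<omega>)" if "n \<in> {1..N}" for n
    unfolding \<eta>_def using that lev_coeff_beyond[of n] by (intro sum.mono_neutral_left) auto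
  then have "(\<Sum>n=1..N. u n * \<epsilon> n \<omega>) = (\<Sum>n=1..N. \<Sum>i=1..N. (u n * K n i / sqrt (V n)) * \<xi> i \<omega>)"
    by (intro sum.cong refl) (simp add: \<epsilon>_def sum_distrib_left sum_divide_distrib mult.assoc)
  also have "\<dots> = lin {1..N} (\<lambda>i. \<Sum>n=1..N. u n * K n i / sqrt (V n)) \<omega>"
    by (subst sum.swap) (simp add: sum_distrib_right)
  finally show ?thesis .
qed

lemma eps_char: "expectation (\<lambda>\<omega>. cis (\<Sum>n=1..N. u n * \<epsilon> n \<omega>)) = complex_of_real (exp (- (\<Sum>n=1..N. (u n)\<^sup>2) / 2))"
proof -
  have "expectation (\<lambda>\<omega>. (\<Sum>n=1..N. u n * \<epsilon> n \<omega>)\<^sup>2) =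
      expectation (\<lambda>\<omega>. \<Sum>n=1..N. \<Sum>m=1..N. (u n * u m) * (\<epsilon> n \<omega> * \<epsilon> m \<omega>))"
    by (simp add: power2_eq_square sum_product mult_ac)
  also have "\<dots> = (\<Sum>n=1..N. expectation (\<lambda>\<omega>. \<Sum>m=1..N. (u n * u m) * (\<epsilon> n \<omega> * \<epsilon> m \<omega>)))"
    by (intro Bochner_Integration.integral_sum Bochner_Integration.integrable_sum integrable_mult_right E_eps_eps) auto
  also have "\<dots> = (\<Sum>n=1..N. \<Sum>m=1..N. expectation (\<lambda>\<omega>. (u n * u m) * (\<epsilon> n \<omega> * \<epsilon> m \<omega>)))"
    by (intro sum.cong refl Bochner_Integration.integral_sum integrable_mult_right E_eps_eps) auto
  also have "\<dots> = (\<Sum>n=1..N. \<Sum>m=1..N. if m = n then (u n)\<^sup>2 else 0)"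
    by (intro sum.cong refl) (simp add: E_eps_eps power2_eq_square)
  also have "\<dots> = (\<Sum>n=1..N. (u n)\<^sup>2)" by (simp add: sum.delta)
  finally show ?thesis unfolding eps_lin by (subst lin_char) auto
qed

lemma eps_distr: "n \<ge> 1 \<Longrightarrow> distr M borel (\<epsilon> n) = std_normal_distribution"
proof -
  assume n: "n \<ge> 1"
  let ?c = "\<lambda>i. K n i / sqrt (V n)"
  have eq: "\<epsilon> n = lin {1..n} ?c"
    by (simp add: fun_eq_iff \<epsilon>_def \<eta>_def sum_divide_distrib)
  have "distr M borel (\<epsilon> n) = gauss_law 0 (sqrt (expectation (\<lambda>\<omega>. (\<epsilon> n \<omega>)\<^sup>2)))"
    unfolding eq by (rule lin_law) auto
  then show ?thesis using E_eps_eps(2)[OF n n] by (simp add: power2_eq_square gauss_law_0_1)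
qed

text \<open>A linear combination of the \<epsilon>_n is one of the \<xi>_i, hence Gaussian; so
  uncorrelatedness already factorises the joint characteristic function.\<close>

lemma eps_indep: "n \<ge> 1 \<Longrightarrow> indep_vars (\<lambda>_. borel) \<epsilon> {1..n}"
proof (rule indep_vars_char)
  fix u
  have single: "expectation (\<lambda>\<omega>. cis (u i * \<epsilon> i \<omega>)) = complex_of_real (exp (- (u i)\<^sup>2 / 2))" if "i \<in> {1..n}" for i
    using eps_char[of "\<lambda>j. if j = i then u i else 0" i] that
    by (simp add: if_distrib[of "\<lambda>x. x * _"] if_distrib[of "\<lambda>x. x ^ 2"] sum.delta cong: if_cong)
  have "expectation (\<lambda>\<omega>. cis (\<Sum>i=1..n. u i * \<epsilon> i \<omega>)) = complex_of_real (exp (\<Sum>i=1..n. - (u i)\<^sup>2 / 2))"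
    unfolding eps_char by (simp add: sum_negf sum_divide_distrib)
  also have "\<dots> = (\<Prod>i=1..n. expectation (\<lambda>\<omega>. cis (u i * \<epsilon> i \<omega>)))"
    using single by (simp add: exp_sum)
  finally show "expectation (\<lambda>\<omega>. cis (\<Sum>i=1..n. u i * \<epsilon> i \<omega>)) = (\<Prod>i=1..n. expectation (\<lambda>\<omega>. cis (u i * \<epsilon> i \<omega>)))" .
qed auto

text \<open>\<open>K i i = 1\<close> makes the passage from \<xi> to \<epsilon> triangular and
  invertible. Hence the past of \<xi> lies in that of \<epsilon>, and \<epsilon>_n is independent of
  it.\<close>

lemma xi_past_eps: "1 \<le> i \<Longrightarrow> i < n \<Longrightarrow> \<xi> i \<in> borel_measurable (past M \<epsilon> n)"
proof (induction i rule: less_induct)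
  case (less i)
  have "{1..i} = insert i {1..<i}" using less.prems by auto
  then have eq: "\<xi> i = (\<lambda>\<omega>. sqrt (V i) * \<epsilon> i \<omega> - (\<Sum>j\<in>{1..<i}. K i j * \<xi> j \<omega>))"
    using lev_var_pos[of i] less.prems by (auto simp: \<epsilon>_def \<eta>_def fun_eq_iff)
  have "\<epsilon> i \<in> borel_measurable (past M \<epsilon> n)" using less.prems by (intro measurable_past_component)
  then have "(\<lambda>\<omega>. sqrt (V i) * \<epsilon> i \<omega> - (\<Sum>j\<in>{1..<i}. K i j * \<xi> j \<omega>)) \<in> borel_measurable (past M \<epsilon> n)"
    using less by (intro borel_measurable_diff borel_measurable_times borel_measurable_sum) auto
  then show ?case by (subst eq)
qed

lemma innovation_eq: "n \<ge> 1 \<Longrightarrow> AE \<omega> in M. innovation M \<xi> n \<omega> = \<eta> n \<omega>"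
proof -
  assume n: "n \<ge> 1"
  let ?g = "\<lambda>\<omega>. \<Sum>i\<in>{1..<n}. (- K n i) * \<xi> i \<omega>"
  have sub: "subalgebra M (past M \<xi> n)" by (intro subalgebra_past xi_measurable)
  interpret P: finite_measure_subalgebra M "past M \<xi> n" by unfold_locales (rule sub)
  have "{1..n} = insert n {1..<n}" using n by auto
  then have eta: "\<xi> n \<omega> - ?g \<omega> = \<eta> n \<omega>" for \<omega> using n by (simp add: \<eta>_def sum_negf)
  have ig: "integrable M ?g" by (rule lin_square_integrable) auto
  \<comment> \<open>Over an event of the past, the integral of \<xi>_n - g is \<sigma>_n times that
    of \<epsilon>_n, which vanishes because \<epsilon>_n is centered and independent of the event.
    This characterises g.\<close>
  have "AE \<omega> in M. real_cond_exp M (past M \<xi> n) (\<xi> n) \<omega> = ?g \<omega>"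
  proof (rule P.real_cond_exp_charact)
    fix A assume A: "A \<in> sets (past M \<xi> n)"
    then have AM[measurable]: "A \<in> sets M" using sub by (auto simp: subalgebra_def)
    have "sets (past M \<xi> n) \<subseteq> sets (past M \<epsilon> n)"
      by (rule sets_past_le) (auto intro: xi_past_eps)
    then have "A \<in> sets (past M \<epsilon> n)" using A by auto
    then have "indicat_real A \<in> borel_measurable (past M \<epsilon> n)" by simp
    from indep_var_past[OF eps_indep[OF n] n this, of "\<lambda>x. x"]
    have "indep_var borel (indicat_real A) borel (\<epsilon> n)" by simp
    moreover have ie: "integrable M (\<epsilon> n)" "expectation (\<epsilon> n) = 0"
      using lin_square_integrable(1)[of "{1..n}" "K n"] expectation_lin[of "{1..n}" "K n"]
      by (simp_all add: \<epsilon>_def[abs_def] \<eta>_def)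
    ultimately have "expectation (\<lambda>\<omega>. indicat_real A \<omega> * \<epsilon> n \<omega>) = 0"
      by (subst indep_var_lebesgue_integral) (auto simp: emeasure_eq_measure)
    then have "sqrt (V n) * expectation (\<lambda>\<omega>. indicat_real A \<omega> * \<epsilon> n \<omega>) = 0" by simp
    then have "expectation (\<lambda>\<omega>. indicat_real A \<omega> * (\<xi> n \<omega> - ?g \<omega>)) = 0"
      unfolding integral_mult_right_zero[symmetric] eta using lev_var_pos[OF n] by (simp add: \<epsilon>_def mult_ac)
    moreover have "integrable M (\<lambda>\<omega>. indicat_real A \<omega> * \<xi> n \<omega>)" "integrable M (\<lambda>\<omega>. indicat_real A \<omega> * ?g \<omega>)"
      using integrable_mult_indicator[OF AM xi_integrable(1)[OF n]] integrable_mult_indicator[OF AM ig] by simp_all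
    ultimately show "(\<integral>\<omega>\<in>A. \<xi> n \<omega> \<partial>M) = (\<integral>\<omega>\<in>A. ?g \<omega> \<partial>M)"
      by (simp add: set_lebesgue_integral_def right_diff_distrib)
  next
    show "?g \<in> borel_measurable (past M \<xi> n)"
      by (intro borel_measurable_sum borel_measurable_times borel_measurable_const measurable_past_component) auto
  qed (use n ig xi_integrable in auto)
  then show ?thesis
  proof eventually_elim
    case (elim \<omega>)
    show ?case using eta[of \<omega>] by (simp only: innovation_def elim)
  qed
qed

section \<open>Identification of the innovation coefficients\<close>

lemma innov_sd_eq: "n \<ge> 1 \<Longrightarrow> innov_sd M \<xi> n = sqrt (V n)"
proof -
  assume n: "n \<ge> 1"
  have [measurable]: "innovation M \<xi> n \<in> borel_measurable M"
    unfolding innovation_def using n by measurable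
  have "expectation (\<lambda>\<omega>. (innovation M \<xi> n \<omega>)\<^sup>2) = expectation (\<lambda>\<omega>. \<eta> n \<omega> * \<eta> n \<omega>)"
    using innovation_eq[OF n]
    by (intro integral_cong_AE) (auto simp: power2_eq_square elim!: eventually_mono)
  then show ?thesis using E_eta_eta(2)[OF n n] by (simp add: innov_sd_def)
qed

text \<open>Linear independence in L^2, tested against \<open>\<eta> m\<close> for the last index m
  with a nonzero coefficient: all other terms drop out and d_m V_m = 0 remains.\<close>

lemma lin_zero_coeff:
  assumes "AE \<omega> in M. lin {1..n} d \<omega> = 0" "1 \<le> i" "i \<le> n"
  shows "d i = 0"
proof (rule ccontr)
  assume "d i \<noteq> 0"
  define m where "m = Max {j \<in> {1..n}. d j \<noteq> 0}"
  have m: "m \<in> {j \<in> {1..n}. d j \<noteq> 0}" unfolding m_def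
    using assms \<open>d i \<noteq> 0\<close> by (intro Max_in) auto
  have mx: "d j = 0" if "j \<in> {1..n}" "j > m" for j
    using Max_ge[of "{j \<in> {1..n}. d j \<noteq> 0}" j] that unfolding m_def by fastforce
  have "0 = expectation (\<lambda>\<omega>. \<eta> m \<omega> * lin {1..n} d \<omega>)"
    using assms(1) lin_measurable[of "{1..n}" d] by (subst integral_cong_AE[where g="\<lambda>_. 0"]) auto
  also have "\<dots> = (\<Sum>i=1..m. \<Sum>j=1..n. K m i * d j * R i j)"
    unfolding \<eta>_def by (rule cov_lin_lin) auto
  also have "\<dots> = (\<Sum>j=1..n. d j * (\<Sum>i=1..m. K m i * R i j))"
    by (subst sum.swap) (simp add: sum_distrib_left mult_ac)
  also have "\<dots> = (\<Sum>j=1..n. d j * (if j = m then V m else 0))"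
  proof (intro sum.cong refl)
    fix j assume j: "j \<in> {1..n}"
    show "d j * (\<Sum>i=1..m. K m i * R i j) = d j * (if j = m then V m else 0)"
    proof (cases "j > m")
      case False
      then have "(\<Sum>i=1..m. K m i * R i j) = (if j = m then V m else 0)"
        unfolding R_def using m j unit less_imp_neq[OF lev_var_pos, symmetric]
        by (intro lev_coeff_orthogonal) force+
      then show ?thesis by simp
    qed (use mx j in simp)
  qed
  also have "\<dots> = d m * V m" using m by (simp add: if_distrib sum.delta cong: if_cong)
  finally show False using m lev_var_pos[of m] by auto
qed

text \<open>\<open>innov_coeff\<close> is a choice among coefficient sequences; linear independence
  makes it unique on {1..n}.\<close>

lemma innov_coeff_eq:
  assumes "1 \<le> i" "i \<le> n"
  shows "innov_coeff M \<xi> n i = K n i"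
proof -
  have n: "n \<ge> 1" using assms by simp
  let ?P = "\<lambda>c. c n = 1 \<and> (AE \<omega> in M. innovation M \<xi> n \<omega> = (\<Sum>i=1..n. c i * \<xi> i \<omega>))"
  have "?P (K n)" using innovation_eq[OF n] n by (simp add: \<eta>_def)
  then have "?P (innov_coeff M \<xi> n)" unfolding innov_coeff_def by (rule someI[of ?P])
  then have "AE \<omega> in M. innovation M \<xi> n \<omega> = (\<Sum>i=1..n. innov_coeff M \<xi> n i * \<xi> i \<omega>)" by simp
  with innovation_eq[OF n] have "AE \<omega> in M. lin {1..n} (\<lambda>i. innov_coeff M \<xi> n i - K n i) \<omega> = 0"
    by eventually_elim (simp add: \<eta>_def left_diff_distrib sum_subtractf)
  from lin_zero_coeff[OF this assms] show ?thesis by simp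
qed

lemma pacf_eq: "n \<ge> 1 \<Longrightarrow> pacf (innov_coeff M \<xi>) n = lev_refl r n"
  using lev_coeff_first[of n r] by (simp add: pacf_def innov_coeff_eq)

end

section \<open>A law of large numbers for the filtered autoregression\<close>

text \<open>Weights of bounded mass that abandon every fixed index: the finitely many early terms
  lose their weight, the others are uniformly small. Cesaro means and convolution with a geometric
  sequence are both instances.\<close>

lemma toeplitz_null:
  fixes w :: "nat \<Rightarrow> nat \<Rightarrow> real" and d :: "nat \<Rightarrow> real"
  assumes w0: "\<And>n i. 1 \<le> i \<Longrightarrow> i \<le> n \<Longrightarrow> w n i \<ge> 0" and wC: "\<And>n. (\<Sum>i=1..n. w n i) \<le> C"
    and wl: "\<And>i. (\<lambda>n. w n i) \<longlonglongrightarrow> 0" and d: "d \<longlonglongrightarrow> 0"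
  shows "(\<lambda>n. \<Sum>i=1..n. w n i * d i) \<longlonglongrightarrow> 0"
proof (rule LIMSEQ_I)
  fix e :: real assume e: "e > 0"
  define h where "h = e / (2 * (\<bar>C\<bar> + 1))"
  have h: "h > 0" using e by (simp add: h_def)
  have Ch: "C * h \<le> e / 2"
  proof -
    have "C * h \<le> (\<bar>C\<bar> + 1) * h" using h by (intro mult_right_mono) auto
    also have "\<dots> = e / 2" by (simp add: h_def field_simps)
    finally show ?thesis .
  qed
  obtain N where N: "\<And>i. i \<ge> N \<Longrightarrow> \<bar>d i\<bar> < h" using LIMSEQ_D[OF d h] by auto
  have "(\<lambda>n. \<Sum>i=1..N. w n i * \<bar>d i\<bar>) \<longlonglongrightarrow> (\<Sum>i=1..N. 0 * \<bar>d i\<bar>)"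
    by (intro tendsto_sum tendsto_mult wl tendsto_const)
  then have "(\<lambda>n. \<Sum>i=1..N. w n i * \<bar>d i\<bar>) \<longlonglongrightarrow> 0" by simp
  from LIMSEQ_D[OF this, of "e / 2"] e obtain N' where N': "\<And>n. n \<ge> N' \<Longrightarrow> \<bar>\<Sum>i=1..N. w n i * \<bar>d i\<bar>\<bar> < e / 2"
    by auto
  show "\<exists>N. \<forall>n\<ge>N. norm ((\<Sum>i=1..n. w n i * d i) - 0) < e"
  proof (intro exI allI impI)
    fix n assume n: "n \<ge> max N N'"
    have "\<bar>\<Sum>i=1..n. w n i * d i\<bar> \<le> (\<Sum>i=1..n. \<bar>w n i * d i\<bar>)" by (rule sum_abs)
    also have "\<dots> \<le> (\<Sum>i=1..n. (if i \<in> {1..N} then w n i * \<bar>d i\<bar> else 0) + w n i * h)"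
    proof (rule sum_mono)
      fix i assume i: "i \<in> {1..n}"
      show "\<bar>w n i * d i\<bar> \<le> (if i \<in> {1..N} then w n i * \<bar>d i\<bar> else 0) + w n i * h"
        using w0[of i n] i h N[of i] by (cases "i \<le> N") (auto simp: abs_mult intro: mult_left_mono)
    qed
    also have "\<dots> = (\<Sum>i\<in>{1..n} \<inter> {1..N}. w n i * \<bar>d i\<bar>) + (\<Sum>i=1..n. w n i) * h"
      unfolding sum.distrib sum_distrib_right
      by (subst sum.inter_restrict) (auto intro!: sum.cong)
    also have "{1..n} \<inter> {1..N} = {1..N}" using n by auto
    also have "(\<Sum>i=1..N. w n i * \<bar>d i\<bar>) + (\<Sum>i=1..n. w n i) * h < e / 2 + C * h"
      using N'[of n] n wC[of n] h by (intro add_less_le_mono mult_right_mono) auto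
    finally show "norm ((\<Sum>i=1..n. w n i * d i) - 0) < e" using Ch by simp
  qed
qed

lemma cesaro_null:
  fixes d :: "nat \<Rightarrow> real"
  assumes "d \<longlonglongrightarrow> 0"
  shows "(\<lambda>n. (\<Sum>i=1..n. d i) / real n) \<longlonglongrightarrow> 0"
proof -
  have "(\<lambda>n. \<Sum>i=1..n. (1 / real n) * d i) \<longlonglongrightarrow> 0"
    by (rule toeplitz_null[where C=1]) (use assms lim_1_over_n in auto)
  then show ?thesis by (simp add: sum_divide_distrib)
qed

lemma geometric_sum_le:
  fixes q :: real
  assumes "0 < q" "q < 1"
  shows "(\<Sum>i=1..n. q ^ (n - i)) \<le> 1 / (1 - q)"
proof -
  have "(\<Sum>i=1..n. q ^ (n - i)) = (\<Sum>i<n. q ^ i)"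
    by (rule sum.reindex_bij_witness[of _ "\<lambda>i. n - i" "\<lambda>i. n - i"]) auto
  also have "\<dots> \<le> (\<Sum>i. q ^ i)" using assms by (intro sum_le_suminf summable_geometric) auto
  also have "\<dots> = 1 / (1 - q)" using assms by (intro suminf_geometric) auto
  finally show ?thesis .
qed

lemma geometric_null:
  fixes d :: "nat \<Rightarrow> real"
  assumes "d \<longlonglongrightarrow> 0" "0 < q" "q < 1"
  shows "(\<lambda>n. \<Sum>i=1..n. q ^ (n - i) * d i) \<longlonglongrightarrow> 0"
proof (rule toeplitz_null)
  show "(\<lambda>n. q ^ (n - i)) \<longlonglongrightarrow> 0" for i
    using assms by (intro filterlim_compose[OF LIMSEQ_power_zero filterlim_minus_const_nat_at_top]) auto
qed (use assms geometric_sum_le[OF assms(2,3)] in auto)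

subsection \<open>Square integrable random vectors\<close>

context prob_space
begin

definition sq_int :: "('a \<Rightarrow> 'b::euclidean_space) \<Rightarrow> bool" where
  "sq_int X \<longleftrightarrow> X \<in> borel_measurable M \<and> integrable M (\<lambda>\<omega>. (norm (X \<omega>))\<^sup>2)"

definition nrm :: "('a \<Rightarrow> 'b::euclidean_space) \<Rightarrow> real" where
  "nrm X = sqrt (expectation (\<lambda>\<omega>. (norm (X \<omega>))\<^sup>2))"

lemma nrm_nonneg [simp]: "nrm X \<ge> 0"
  by (simp add: nrm_def)

lemma nrm_sq: "(nrm X)\<^sup>2 = expectation (\<lambda>\<omega>. (norm (X \<omega>))\<^sup>2)"
  by (simp add: nrm_def)

lemma sq_intD: "sq_int X \<Longrightarrow> X \<in> borel_measurable M" "sq_int X \<Longrightarrow> integrable M (\<lambda>\<omega>. (norm (X \<omega>))\<^sup>2)"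
  by (auto simp: sq_int_def)

lemma sq_int_mult_norm:
  assumes "sq_int X" "sq_int Y"
  shows "integrable M (\<lambda>\<omega>. norm (X \<omega>) * norm (Y \<omega>))"
proof (rule Bochner_Integration.integrable_bound)
  note [measurable] = sq_intD(1)[OF assms(1)] sq_intD(1)[OF assms(2)]
  show "integrable M (\<lambda>\<omega>. (norm (X \<omega>))\<^sup>2 + (norm (Y \<omega>))\<^sup>2)"
    using assms by (intro Bochner_Integration.integrable_add sq_intD)
  show "(\<lambda>\<omega>. norm (X \<omega>) * norm (Y \<omega>)) \<in> borel_measurable M" by measurable
  have "a * b \<le> a\<^sup>2 + b\<^sup>2" if "a \<ge> 0" "b \<ge> 0" for a b :: real
    using sum_squares_bound[of a b] mult_nonneg_nonneg[OF that] by linarith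
  then show "AE \<omega> in M. norm (norm (X \<omega>) * norm (Y \<omega>)) \<le> norm ((norm (X \<omega>))\<^sup>2 + (norm (Y \<omega>))\<^sup>2)" by simp
qed

lemma nrm_cauchy_schwarz:
  assumes "sq_int X" "sq_int Y"
  shows "expectation (\<lambda>\<omega>. norm (X \<omega>) * norm (Y \<omega>)) \<le> nrm X * nrm Y"
proof -
  define a b c where "a = expectation (\<lambda>\<omega>. (norm (X \<omega>))\<^sup>2)" and "b = expectation (\<lambda>\<omega>. norm (X \<omega>) * norm (Y \<omega>))"
    and "c = expectation (\<lambda>\<omega>. (norm (Y \<omega>))\<^sup>2)"
  have i: "integrable M (\<lambda>\<omega>. (norm (X \<omega>))\<^sup>2)" "integrable M (\<lambda>\<omega>. (norm (Y \<omega>))\<^sup>2)"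
    "integrable M (\<lambda>\<omega>. norm (X \<omega>) * norm (Y \<omega>))"
    using assms by (auto intro: sq_intD sq_int_mult_norm)
  have q: "0 \<le> t\<^sup>2 * a - 2 * t * b + c" for t
  proof -
    have "0 \<le> expectation (\<lambda>\<omega>. (t * norm (X \<omega>) - norm (Y \<omega>))\<^sup>2)" by simp
    also have "(\<lambda>\<omega>. (t * norm (X \<omega>) - norm (Y \<omega>))\<^sup>2) = (\<lambda>\<omega>. t\<^sup>2 * (norm (X \<omega>))\<^sup>2
        - (2 * t) * (norm (X \<omega>) * norm (Y \<omega>)) + (norm (Y \<omega>))\<^sup>2)"
      by (simp add: power2_diff power_mult_distrib algebra_simps)
    also have "expectation \<dots> = t\<^sup>2 * a - 2 * t * b + c"
      using i by (simp add: a_def b_def c_def)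
    finally show ?thesis .
  qed
  have pos: "a \<ge> 0" "b \<ge> 0" "c \<ge> 0" by (auto simp: a_def b_def c_def)
  have "b\<^sup>2 \<le> a * c"
  proof (cases "a = 0")
    case True
    have "b = 0"
    proof (rule ccontr)
      assume "b \<noteq> 0"
      \<comment> \<open>With a = 0 the quadratic is linear in t, and this t gives it the value
        -1.\<close>
      then show False using q[of "(c + 1) / (2 * b)"] True by simp
    qed
    then show ?thesis using True by simp
  next
    case False
    have "0 \<le> a * ((b / a)\<^sup>2 * a - 2 * (b / a) * b + c)" by (rule mult_nonneg_nonneg[OF pos(1) q])
    also have "\<dots> = a * c - b\<^sup>2" using False by (simp add: field_simps power2_eq_square)
    finally show ?thesis by simp
  qed
  then have "b \<le> sqrt (a * c)" using pos real_le_rsqrt by blast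
  then show ?thesis by (simp add: nrm_def real_sqrt_mult a_def b_def c_def)
qed

lemma sq_int_add:
  assumes "sq_int X" "sq_int Y"
  shows "sq_int (\<lambda>\<omega>. X \<omega> + Y \<omega>)" "nrm (\<lambda>\<omega>. X \<omega> + Y \<omega>) \<le> nrm X + nrm Y"
proof -
  note [measurable] = sq_intD(1)[OF assms(1)] sq_intD(1)[OF assms(2)]
  let ?g = "\<lambda>\<omega>. (norm (X \<omega>))\<^sup>2 + 2 * (norm (X \<omega>) * norm (Y \<omega>)) + (norm (Y \<omega>))\<^sup>2"
  have i: "integrable M (\<lambda>\<omega>. (norm (X \<omega>))\<^sup>2)" "integrable M (\<lambda>\<omega>. (norm (Y \<omega>))\<^sup>2)"
    "integrable M (\<lambda>\<omega>. norm (X \<omega>) * norm (Y \<omega>))"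
    using assms by (auto intro: sq_intD sq_int_mult_norm)
  have le: "(norm (X \<omega> + Y \<omega>))\<^sup>2 \<le> ?g \<omega>" for \<omega>
    using power_mono[OF norm_triangle_ineq[of "X \<omega>" "Y \<omega>"] norm_ge_zero, of 2]
    by (simp add: power2_sum algebra_simps)
  have ig: "integrable M ?g" using i by simp
  have int: "integrable M (\<lambda>\<omega>. (norm (X \<omega> + Y \<omega>))\<^sup>2)"
    by (rule Bochner_Integration.integrable_bound[OF ig]) (auto intro: order_trans[OF le])
  then show "sq_int (\<lambda>\<omega>. X \<omega> + Y \<omega>)" by (simp add: sq_int_def)
  have "(nrm (\<lambda>\<omega>. X \<omega> + Y \<omega>))\<^sup>2 \<le> expectation ?g"
    unfolding nrm_sq using le by (intro integral_mono int ig)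
  also have "\<dots> \<le> (nrm X)\<^sup>2 + 2 * (nrm X * nrm Y) + (nrm Y)\<^sup>2"
    using i nrm_cauchy_schwarz[OF assms] by (simp add: nrm_sq)
  also have "\<dots> = (nrm X + nrm Y)\<^sup>2" by (simp add: power2_sum)
  finally show "nrm (\<lambda>\<omega>. X \<omega> + Y \<omega>) \<le> nrm X + nrm Y"
    by (rule power2_le_imp_le) (simp add: add_nonneg_nonneg)
qed

lemma sq_int_bound:
  assumes X: "sq_int X" and Y: "Y \<in> borel_measurable M" and le: "\<And>\<omega>. norm (Y \<omega>) \<le> c * norm (X \<omega>)" and c: "c \<ge> 0"
  shows "sq_int Y" "nrm Y \<le> c * nrm X"
proof -
  have le2: "(norm (Y \<omega>))\<^sup>2 \<le> c\<^sup>2 * (norm (X \<omega>))\<^sup>2" for \<omega>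
    using power_mono[OF le norm_ge_zero, of \<omega> 2] by (simp add: power_mult_distrib)
  have i: "integrable M (\<lambda>\<omega>. c\<^sup>2 * (norm (X \<omega>))\<^sup>2)" using sq_intD[OF X] by simp
  have int: "integrable M (\<lambda>\<omega>. (norm (Y \<omega>))\<^sup>2)"
    using Y by (intro Bochner_Integration.integrable_bound[OF i]) (auto intro: order_trans[OF le2])
  then show "sq_int Y" using Y by (simp add: sq_int_def)
  have "(nrm Y)\<^sup>2 \<le> c\<^sup>2 * (nrm X)\<^sup>2"
    unfolding nrm_sq integral_mult_right_zero[symmetric] by (intro integral_mono int i le2)
  then show "nrm Y \<le> c * nrm X"
    by (intro power2_le_imp_le[of "nrm Y"]) (auto simp: power_mult_distrib c)
qed

lemma sq_int_scaleR:
  assumes "sq_int X"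
  shows "sq_int (\<lambda>\<omega>. c *\<^sub>R X \<omega>)" "nrm (\<lambda>\<omega>. c *\<^sub>R X \<omega>) \<le> \<bar>c\<bar> * nrm X"
  using sq_int_bound[OF assms, of "\<lambda>\<omega>. c *\<^sub>R X \<omega>" "\<bar>c\<bar>"] sq_intD(1)[OF assms] by auto

lemma sq_int_scale_vec:
  fixes f :: "'a \<Rightarrow> real"
  assumes "sq_int f"
  shows "sq_int (\<lambda>\<omega>. f \<omega> *\<^sub>R v)" "nrm (\<lambda>\<omega>. f \<omega> *\<^sub>R v) \<le> norm v * nrm f"
  using sq_int_bound[OF assms, of "\<lambda>\<omega>. f \<omega> *\<^sub>R v" "norm v"] sq_intD(1)[OF assms] by (auto simp: mult.commute)

lemma sq_int_linear:
  assumes "sq_int X" "linear f" "\<And>v. norm (f v) \<le> c * norm v" "c \<ge> 0"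
  shows "sq_int (\<lambda>\<omega>. f (X \<omega>))" "nrm (\<lambda>\<omega>. f (X \<omega>)) \<le> c * nrm X"
proof -
  have "f \<in> borel_measurable borel"
    using assms(2) by (intro borel_measurable_continuous_onI linear_continuous_on) (simp add: linear_conv_bounded_linear)
  then have "(\<lambda>\<omega>. f (X \<omega>)) \<in> borel_measurable M"
    using sq_intD(1)[OF assms(1)] by (rule measurable_compose[rotated])
  from sq_int_bound[OF assms(1) this assms(3,4)]
  show "sq_int (\<lambda>\<omega>. f (X \<omega>))" "nrm (\<lambda>\<omega>. f (X \<omega>)) \<le> c * nrm X" by auto
qed

lemma sq_int_inner:
  assumes "sq_int X"
  shows "sq_int (\<lambda>\<omega>. v \<bullet> X \<omega>)" "nrm (\<lambda>\<omega>. v \<bullet> X \<omega>) \<le> norm v * nrm X"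
  using sq_int_linear[OF assms, of "\<lambda>x. v \<bullet> x" "norm v"]
  by (auto simp: linear_iff inner_add_right Cauchy_Schwarz_ineq2)

lemma sq_int_0: "sq_int (\<lambda>\<omega>. 0)" "nrm (\<lambda>\<omega>. 0 :: 'b::euclidean_space) = 0"
  by (auto simp: sq_int_def nrm_def)

lemma sq_int_sum:
  assumes "finite S" "\<And>i. i \<in> S \<Longrightarrow> sq_int (X i)"
  shows "sq_int (\<lambda>\<omega>. \<Sum>i\<in>S. X i \<omega>) \<and> nrm (\<lambda>\<omega>. \<Sum>i\<in>S. X i \<omega>) \<le> (\<Sum>i\<in>S. nrm (X i))"
  using assms
proof (induction S rule: finite_induct)
  case (insert i S)
  then have "sq_int (\<lambda>\<omega>. \<Sum>i\<in>S. X i \<omega>)" "nrm (\<lambda>\<omega>. \<Sum>i\<in>S. X i \<omega>) \<le> (\<Sum>i\<in>S. nrm (X i))" "sq_int (X i)" by auto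
  from sq_int_add[OF this(3,1)] this(2) insert.hyps show ?case by auto
qed (auto simp: sq_int_0)

lemma nrm_real_sq: "(nrm X)\<^sup>2 = expectation (\<lambda>\<omega>. (X \<omega>)\<^sup>2)" for X :: "'a \<Rightarrow> real"
  by (simp add: nrm_sq)

lemma sq_int_mult:
  fixes X Y :: "'a \<Rightarrow> real"
  assumes "sq_int X" "sq_int Y"
  shows "integrable M (\<lambda>\<omega>. X \<omega> * Y \<omega>)" "expectation (\<lambda>\<omega>. \<bar>X \<omega> * Y \<omega>\<bar>) \<le> nrm X * nrm Y"
proof -
  show "integrable M (\<lambda>\<omega>. X \<omega> * Y \<omega>)"
    by (rule Bochner_Integration.integrable_bound[OF sq_int_mult_norm[OF assms]])
      (use sq_intD(1)[OF assms(1)] sq_intD(1)[OF assms(2)] in \<open>auto simp: abs_mult\<close>)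
  show "expectation (\<lambda>\<omega>. \<bar>X \<omega> * Y \<omega>\<bar>) \<le> nrm X * nrm Y"
    using nrm_cauchy_schwarz[OF assms] by (simp add: abs_mult)
qed

lemma sq_int_const: "sq_int (\<lambda>\<omega>. c)" "nrm (\<lambda>\<omega>. c) = norm c"
  by (auto simp: sq_int_def nrm_def prob_space)

lemma sq_int_integrable:
  fixes X :: "'a \<Rightarrow> real"
  assumes "sq_int X"
  shows "integrable M X" "expectation (\<lambda>\<omega>. \<bar>X \<omega>\<bar>) \<le> nrm X"
  using sq_int_mult[OF assms sq_int_const(1)[of 1]] by (auto simp: sq_int_const)

text \<open>Pythagoras: orthogonality turns n bounded terms into growth sqrt n, the source of the
  rate in the martingale estimates.\<close>

lemma orthogonal_sum_bound:
  fixes D :: "nat \<Rightarrow> 'a \<Rightarrow> real"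
  assumes D: "\<And>i. 1 \<le> i \<Longrightarrow> sq_int (D i)" and K: "\<And>i. 1 \<le> i \<Longrightarrow> nrm (D i) \<le> K"
    and ort: "\<And>i j. 1 \<le> j \<Longrightarrow> j < i \<Longrightarrow> expectation (\<lambda>\<omega>. D i \<omega> * D j \<omega>) = 0"
  shows "nrm (\<lambda>\<omega>. \<Sum>i=1..n. D i \<omega>) \<le> sqrt (real n) * K"
proof -
  have sq: "(nrm (\<lambda>\<omega>. \<Sum>i=1..n. D i \<omega>))\<^sup>2 \<le> real n * K\<^sup>2"
  proof (induction n)
    case (Suc n)
    let ?S = "\<lambda>\<omega>. \<Sum>i=1..n. D i \<omega>"
    have S: "sq_int ?S" using sq_int_sum[of "{1..n}" D] D by auto
    have Dn: "sq_int (D (Suc n))" using D by simp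
    have "expectation (\<lambda>\<omega>. D (Suc n) \<omega> * ?S \<omega>) = (\<Sum>i=1..n. expectation (\<lambda>\<omega>. D (Suc n) \<omega> * D i \<omega>))"
      unfolding sum_distrib_left using D by (intro Bochner_Integration.integral_sum sq_int_mult) auto
    also have "\<dots> = 0" by (intro sum.neutral) (auto intro: ort)
    finally have z: "expectation (\<lambda>\<omega>. D (Suc n) \<omega> * ?S \<omega>) = 0" .
    have "(nrm (\<lambda>\<omega>. \<Sum>i=1..Suc n. D i \<omega>))\<^sup>2 =
        expectation (\<lambda>\<omega>. (?S \<omega>)\<^sup>2 + 2 * (D (Suc n) \<omega> * ?S \<omega>) + (D (Suc n) \<omega>)\<^sup>2)"
      unfolding nrm_real_sq by (intro Bochner_Integration.integral_cong refl) (simp add: power2_sum mult_ac)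
    also have "\<dots> = (nrm ?S)\<^sup>2 + (nrm (D (Suc n)))\<^sup>2"
      using sq_intD(2)[OF S] sq_intD(2)[OF Dn] sq_int_mult(1)[OF Dn S] z
      by (simp add: nrm_real_sq)
    also have "\<dots> \<le> real n * K\<^sup>2 + K\<^sup>2"
      using Suc K[of "Suc n"] by (intro add_mono power_mono) auto
    finally show ?case by (simp add: algebra_simps)
  qed (simp add: sq_int_0)
  have K0: "K \<ge> 0" using K[of 1] nrm_nonneg[of "D 1"] by linarith
  show ?thesis by (rule power2_le_imp_le) (use sq K0 in \<open>auto simp: power_mult_distrib\<close>)
qed

lemma integral_abs_sum_le:
  fixes X :: "'i \<Rightarrow> 'a \<Rightarrow> real"
  assumes "finite S" "\<And>i. i \<in> S \<Longrightarrow> integrable M (X i)"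
  shows "expectation (\<lambda>\<omega>. \<bar>\<Sum>i\<in>S. X i \<omega>\<bar>) \<le> (\<Sum>i\<in>S. expectation (\<lambda>\<omega>. \<bar>X i \<omega>\<bar>))"
proof -
  have "expectation (\<lambda>\<omega>. \<bar>\<Sum>i\<in>S. X i \<omega>\<bar>) \<le> expectation (\<lambda>\<omega>. \<Sum>i\<in>S. \<bar>X i \<omega>\<bar>)"
    using assms by (intro integral_mono integrable_abs Bochner_Integration.integrable_sum sum_abs) auto
  also have "\<dots> = (\<Sum>i\<in>S. expectation (\<lambda>\<omega>. \<bar>X i \<omega>\<bar>))"
    using assms by (intro Bochner_Integration.integral_sum integrable_abs) auto
  finally show ?thesis .
qed

end

lemma sets_past_mono: "m \<le> n \<Longrightarrow> sets (past M X m) \<subseteq> sets (past M X n)"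
  by (rule sets_past_le) (auto intro: measurable_past_component)

lemma measurable_past_mono:
  assumes "m \<le> n" "Y \<in> past M X m \<rightarrow>\<^sub>M N"
  shows "Y \<in> past M X n \<rightarrow>\<^sub>M N"
proof -
  have "subalgebra (past M X n) (past M X m)"
    using sets_past_mono[OF assms(1), of M X] by (simp add: subalgebra_def)
  from measurable_from_subalg[OF this assms(2)] show ?thesis .
qed

text \<open>Separates the asymptotics from the noise and from the companion form: \<open>A\<close>
  is any matrix with decaying powers, \<open>W\<close> stands for the regressor, and the vectors
  \<open>A *v W j \<omega> + (s j * \<epsilon> j \<omega>) *\<^sub>R b\<close> stand for
  Z_j.\<close>

locale innovation_ar = prob_space M
  for M :: "'w measure" +
  fixes \<epsilon> :: "nat \<Rightarrow> 'w \<Rightarrow> real" and \<beta> s :: "nat \<Rightarrow> real"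
    and A :: "real ^ 'n ^ 'n" and b :: "real ^ 'n" and C \<rho> :: real and W :: "nat \<Rightarrow> 'w \<Rightarrow> real ^ 'n"
  assumes eps_measurable [measurable]: "\<And>n. \<epsilon> n \<in> borel_measurable M"
    and eps_law: "\<And>n. n \<ge> 1 \<Longrightarrow> distr M borel (\<epsilon> n) = std_normal_distribution"
    and eps_indep: "\<And>n. n \<ge> 1 \<Longrightarrow> indep_vars (\<lambda>_. borel) \<epsilon> {1..n}"
    and s_1: "s 1 = 1" and s_pos: "\<And>n. n \<ge> 1 \<Longrightarrow> s n > 0"
    and s_Suc: "\<And>n. n \<ge> 1 \<Longrightarrow> (s (Suc n))\<^sup>2 = (s n)\<^sup>2 * (1 - (\<beta> n)\<^sup>2)"
    and \<beta>_summable: "summable (\<lambda>n. (\<beta> n)\<^sup>2)" and \<beta>_null: "(\<lambda>n. real n * (\<beta> n)\<^sup>2) \<longlonglongrightarrow> 0"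
    and decay: "\<And>k v. norm (((*v) A ^^ k) v) \<le> C * \<rho> ^ k * norm v" and \<rho>: "0 < \<rho>" "\<rho> < 1" and C: "C \<ge> 0"
    and W_1: "\<And>\<omega>. W (Suc 0) \<omega> = 0"
    and W_Suc: "\<And>n \<omega>. n \<ge> 1 \<Longrightarrow> W (Suc n) \<omega> = (A *v W n \<omega> + (s n * \<epsilon> n \<omega>) *\<^sub>R b) +
        \<beta> n *\<^sub>R (\<Sum>j=1..<n. \<beta> j *\<^sub>R (A *v W j \<omega> + (s j * \<epsilon> j \<omega>) *\<^sub>R b))"
begin

subsection \<open>The innovations\<close>

lemma eps_integral:
  fixes f :: "real \<Rightarrow> 'b::{banach, second_countable_topology}"
  assumes "n \<ge> 1" "f \<in> borel_measurable borel"
  shows "integrable M (\<lambda>\<omega>. f (\<epsilon> n \<omega>)) \<longleftrightarrow> integrable std_normal_distribution f"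
    "expectation (\<lambda>\<omega>. f (\<epsilon> n \<omega>)) = integral\<^sup>L std_normal_distribution f"
  by (rule integrable_distr_eq[OF eps_measurable[of n] assms(2), unfolded eps_law[OF assms(1)], symmetric],
      rule integral_distr[OF eps_measurable[of n] assms(2), unfolded eps_law[OF assms(1)], symmetric])

lemma eps_moments:
  assumes n: "n \<ge> 1"
  shows "sq_int (\<epsilon> n)" "nrm (\<epsilon> n) = 1" "expectation (\<epsilon> n) = 0"
    "sq_int (\<lambda>\<omega>. (\<epsilon> n \<omega>)\<^sup>2 - 1)" "nrm (\<lambda>\<omega>. (\<epsilon> n \<omega>)\<^sup>2 - 1) = sqrt 2"
    "expectation (\<lambda>\<omega>. (\<epsilon> n \<omega>)\<^sup>2 - 1) = 0"
proof -
  have i: "integrable M (\<lambda>\<omega>. \<epsilon> n \<omega> ^ k)" for k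
    by (subst eps_integral[OF n]) (auto intro: integrable_std_normal_distribution_moment)
  have m: "expectation (\<lambda>\<omega>. (\<epsilon> n \<omega>) ^ 2) = 1" "expectation (\<lambda>\<omega>. (\<epsilon> n \<omega>) ^ 4) = 3"
    "expectation (\<lambda>\<omega>. (\<epsilon> n \<omega>) ^ 1) = 0"
  proof -
    have "expectation (\<lambda>\<omega>. \<epsilon> n \<omega> ^ k) = integral\<^sup>L std_normal_distribution (\<lambda>x. x ^ k)" for k
      by (rule eps_integral(2)[OF n]) simp
    then show "expectation (\<lambda>\<omega>. (\<epsilon> n \<omega>) ^ 2) = 1" "expectation (\<lambda>\<omega>. (\<epsilon> n \<omega>) ^ 4) = 3"
      "expectation (\<lambda>\<omega>. (\<epsilon> n \<omega>) ^ 1) = 0"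
      using std_normal_distribution_even_moments(1)[of 1] std_normal_distribution_even_moments(1)[of 2]
        integral_std_normal_distribution_moment_odd[of 1]
      by (simp_all only: odd_one refl) (simp_all add: fact_numeral)
  qed
  have sq: "(\<lambda>\<omega>. ((\<epsilon> n \<omega>)\<^sup>2 - 1)\<^sup>2) = (\<lambda>\<omega>. \<epsilon> n \<omega> ^ 4 - 2 * (\<epsilon> n \<omega>) ^ 2 + 1)"
    by (simp add: fun_eq_iff power2_diff flip: power_mult)
  show "sq_int (\<epsilon> n)" using i[of 2] by (simp add: sq_int_def)
  show "nrm (\<epsilon> n) = 1" using m by (simp add: nrm_def)
  show "expectation (\<epsilon> n) = 0" using m by simp
  show "sq_int (\<lambda>\<omega>. (\<epsilon> n \<omega>)\<^sup>2 - 1)" using i by (simp add: sq_int_def sq)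
  show "nrm (\<lambda>\<omega>. (\<epsilon> n \<omega>)\<^sup>2 - 1) = sqrt 2" using i m by (simp add: nrm_def sq prob_space)
  show "expectation (\<lambda>\<omega>. (\<epsilon> n \<omega>)\<^sup>2 - 1) = 0" using i[of 2] m by (simp add: prob_space)
qed

lemma past_measurableD: "Y \<in> past M \<epsilon> n \<rightarrow>\<^sub>M N \<Longrightarrow> Y \<in> M \<rightarrow>\<^sub>M N"
  using subalgebra_past[of n \<epsilon> M] by (auto intro: measurable_from_subalg)

text \<open>h(\<epsilon>_n) is centered and independent of the past variable G. The function h is
  kept general because both x and x^2 - 1 occur.\<close>

lemma martingale_difference:
  fixes h :: "real \<Rightarrow> real"
  assumes n: "n \<ge> 1" and G: "G \<in> borel_measurable (past M \<epsilon> n)"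
    and h: "h \<in> borel_measurable borel" "sq_int (\<lambda>\<omega>. h (\<epsilon> n \<omega>))" "expectation (\<lambda>\<omega>. h (\<epsilon> n \<omega>)) = 0"
  shows "integrable M G \<Longrightarrow> expectation (\<lambda>\<omega>. h (\<epsilon> n \<omega>) * G \<omega>) = 0"
    and "sq_int G \<Longrightarrow> sq_int (\<lambda>\<omega>. h (\<epsilon> n \<omega>) * G \<omega>)"
    and "sq_int G \<Longrightarrow> nrm (\<lambda>\<omega>. h (\<epsilon> n \<omega>) * G \<omega>) = nrm (\<lambda>\<omega>. h (\<epsilon> n \<omega>)) * nrm G"
proof -
  have GM[measurable]: "G \<in> borel_measurable M" by (rule past_measurableD[OF G])
  note [measurable] = h(1)
  show "expectation (\<lambda>\<omega>. h (\<epsilon> n \<omega>) * G \<omega>) = 0" if "integrable M G"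
    using indep_var_lebesgue_integral[OF indep_var_past[OF eps_indep[OF n] n G h(1)] that sq_int_integrable(1)[OF h(2)]] h(3)
    by (simp add: mult.commute)
  assume sG: "sq_int G"
  have G2: "(\<lambda>\<omega>. (G \<omega>)\<^sup>2) \<in> borel_measurable (past M \<epsilon> n)" using G by measurable
  have h2: "(\<lambda>x. (h x)\<^sup>2) \<in> borel_measurable borel" using h(1) by measurable
  have i: "integrable M (\<lambda>\<omega>. (G \<omega>)\<^sup>2)" "integrable M (\<lambda>\<omega>. (h (\<epsilon> n \<omega>))\<^sup>2)"
    using sq_intD(2)[OF sG] sq_intD(2)[OF h(2)] by simp_all
  have int: "integrable M (\<lambda>\<omega>. (h (\<epsilon> n \<omega>) * G \<omega>)\<^sup>2)"
    using indep_var_integrable[OF indep_var_past[OF eps_indep[OF n] n G2 h2] i]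
    by (simp add: power_mult_distrib mult.commute)
  then show "sq_int (\<lambda>\<omega>. h (\<epsilon> n \<omega>) * G \<omega>)" by (simp add: sq_int_def)
  have "expectation (\<lambda>\<omega>. (h (\<epsilon> n \<omega>) * G \<omega>)\<^sup>2) = expectation (\<lambda>\<omega>. (h (\<epsilon> n \<omega>))\<^sup>2) * expectation (\<lambda>\<omega>. (G \<omega>)\<^sup>2)"
    using indep_var_lebesgue_integral[OF indep_var_past[OF eps_indep[OF n] n G2 h2] i]
    by (simp add: power_mult_distrib mult.commute)
  then show "nrm (\<lambda>\<omega>. h (\<epsilon> n \<omega>) * G \<omega>) = nrm (\<lambda>\<omega>. h (\<epsilon> n \<omega>)) * nrm G"
    by (simp add: nrm_def real_sqrt_mult power_mult_distrib)
qed

lemma martingale_sum_bound: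
  fixes h :: "real \<Rightarrow> real"
  assumes G: "\<And>i. i \<ge> 1 \<Longrightarrow> G i \<in> borel_measurable (past M \<epsilon> i)" "\<And>i. i \<ge> 1 \<Longrightarrow> sq_int (G i)"
    and K: "\<And>i. i \<ge> 1 \<Longrightarrow> nrm (G i) \<le> K"
    and h: "h \<in> borel_measurable borel" "\<And>i. i \<ge> 1 \<Longrightarrow> sq_int (\<lambda>\<omega>. h (\<epsilon> i \<omega>))"
      "\<And>i. i \<ge> 1 \<Longrightarrow> expectation (\<lambda>\<omega>. h (\<epsilon> i \<omega>)) = 0" "\<And>i. i \<ge> 1 \<Longrightarrow> nrm (\<lambda>\<omega>. h (\<epsilon> i \<omega>)) \<le> H"
  shows "sq_int (\<lambda>\<omega>. \<Sum>i=1..n. h (\<epsilon> i \<omega>) * G i \<omega>) \<and>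
    nrm (\<lambda>\<omega>. \<Sum>i=1..n. h (\<epsilon> i \<omega>) * G i \<omega>) \<le> sqrt (real n) * (H * K)"
proof
  note md = martingale_difference[OF _ G(1) h(1,2,3)]
  have sq: "sq_int (\<lambda>\<omega>. h (\<epsilon> i \<omega>) * G i \<omega>)" if "i \<ge> 1" for i using md(2) G(2) that by blast
  show "sq_int (\<lambda>\<omega>. \<Sum>i=1..n. h (\<epsilon> i \<omega>) * G i \<omega>)"
    using sq_int_sum[of "{1..n}" "\<lambda>i \<omega>. h (\<epsilon> i \<omega>) * G i \<omega>"] sq by auto
  show "nrm (\<lambda>\<omega>. \<Sum>i=1..n. h (\<epsilon> i \<omega>) * G i \<omega>) \<le> sqrt (real n) * (H * K)"
  proof (rule orthogonal_sum_bound[OF sq])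
    fix i :: nat assume i: "i \<ge> 1"
    have "H \<ge> 0" using h(4)[OF i] nrm_nonneg order_trans by blast
    then show "nrm (\<lambda>\<omega>. h (\<epsilon> i \<omega>) * G i \<omega>) \<le> H * K"
      using md(3)[OF i i i i] G(2)[OF i] h(4)[OF i] K[OF i] by (simp add: mult_mono)
  next
    fix i j :: nat assume j: "1 \<le> j" "j < i"
    then have i: "i \<ge> 1" by simp
    have hj: "(\<lambda>\<omega>. h (\<epsilon> j \<omega>)) \<in> borel_measurable (past M \<epsilon> i)"
      using j by (intro measurable_compose[OF measurable_past_component h(1)]) auto
    \<comment> \<open>For j < i everything except h(\<epsilon>_i) is measurable in the past of i, so
      the product has mean 0.\<close>
    have "(\<lambda>\<omega>. G i \<omega> * (h (\<epsilon> j \<omega>) * G j \<omega>)) \<in> borel_measurable (past M \<epsilon> i)"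
      using j by (intro borel_measurable_times hj G(1)[OF i] measurable_past_mono[OF _ G(1)[OF j(1)]]) auto
    moreover have "integrable M (\<lambda>\<omega>. G i \<omega> * (h (\<epsilon> j \<omega>) * G j \<omega>))"
      by (intro sq_int_mult G(2)[OF i] sq[OF j(1)])
    ultimately have "expectation (\<lambda>\<omega>. h (\<epsilon> i \<omega>) * (G i \<omega> * (h (\<epsilon> j \<omega>) * G j \<omega>))) = 0"
      by (rule martingale_difference(1)[OF i _ h(1) h(2)[OF i] h(3)[OF i]])
    then show "expectation (\<lambda>\<omega>. h (\<epsilon> i \<omega>) * G i \<omega> * (h (\<epsilon> j \<omega>) * G j \<omega>)) = 0"
      by (simp add: mult.assoc)
  qed auto
qed

subsection \<open>The innovation variances\<close>

lemma s_antimono: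
  assumes "1 \<le> m" "m \<le> n"
  shows "s n \<le> s m"
  using assms(2)
proof (induction n rule: dec_induct)
  case (step n)
  then have n: "n \<ge> 1" using assms by simp
  have "(s (Suc n))\<^sup>2 \<le> (s n)\<^sup>2"
    unfolding s_Suc[OF n] by (simp add: right_diff_distrib)
  then have "s (Suc n) \<le> s n" using s_pos[OF n] power2_le_imp_le[of "s (Suc n)" "s n"] by simp
  then show ?case using step by simp
qed simp

lemma s_le_1: "n \<ge> 1 \<Longrightarrow> s n \<le> 1"
  using s_antimono[of 1 n] s_1 by simp

text \<open>A product of factors 1 - \<beta>_i^2 is at least 1 minus the sum of the \<beta>_i^2.
  From an index m on, where that sum stays below 1/2, s_n^2 keeps at least half of s_m^2.\<close>

lemma s_lower: "\<exists>c>0. \<forall>n\<ge>1. s n \<ge> c"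
proof -
  obtain N where N: "\<And>m n. m \<ge> N \<Longrightarrow> \<bar>\<Sum>i=m..<n. (\<beta> i)\<^sup>2\<bar> < 1/2"
    using \<beta>_summable[unfolded summable_Cauchy] by (metis half_gt_zero_iff real_norm_def zero_less_one)
  define m where "m = Suc N"
  have m: "m \<ge> 1" "m \<ge> N" by (auto simp: m_def)
  have *: "(s n)\<^sup>2 \<ge> (s m)\<^sup>2 * (1 - (\<Sum>i=m..<n. (\<beta> i)\<^sup>2))" if "n \<ge> m" for n
    using that
  proof (induction n rule: dec_induct)
    case (step n)
    then have n: "n \<ge> 1" using m by simp
    let ?S = "\<Sum>i=m..<n. (\<beta> i)\<^sup>2"
    have S: "?S \<ge> 0" "?S < 1/2" using N[OF m(2), of n] by (auto intro: sum_nonneg)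
    have b: "(\<beta> n)\<^sup>2 \<le> 1/2"
      using N[of n "Suc n"] step m by (simp add: abs_if)
    have "(s m)\<^sup>2 * (1 - (\<Sum>i=m..<Suc n. (\<beta> i)\<^sup>2)) \<le> (s m)\<^sup>2 * ((1 - ?S) * (1 - (\<beta> n)\<^sup>2))"
      using step S by (intro mult_left_mono) (auto simp: algebra_simps)
    also have "\<dots> \<le> (s n)\<^sup>2 * (1 - (\<beta> n)\<^sup>2)"
      using step b by (simp add: mult.assoc[symmetric] mult_right_mono)
    finally show ?case using s_Suc[OF n] by simp
  qed simp
  have "s n \<ge> s m / 2" if "n \<ge> 1" for n
  proof (cases "n \<ge> m")
    case True
    have "(s m / 2)\<^sup>2 \<le> (s m)\<^sup>2 * (1/2)" by (simp add: power_divide)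
    also have "\<dots> \<le> (s m)\<^sup>2 * (1 - (\<Sum>i=m..<n. (\<beta> i)\<^sup>2))"
      using N[OF m(2), of n] by (intro mult_left_mono) auto
    also have "\<dots> \<le> (s n)\<^sup>2" by (rule *[OF True])
    finally have "(s m / 2)\<^sup>2 \<le> (s n)\<^sup>2" .
    then show ?thesis by (rule power2_le_imp_le[OF _ less_imp_le[OF s_pos[OF that]]])
  next
    case False
    then show ?thesis using s_antimono[OF that, of m] s_pos[OF m(1)] by simp
  qed
  then show ?thesis using s_pos[OF m(1)] by (intro exI[of _ "s m / 2"]) auto
qed

text \<open>s decreases and stays above a positive constant, so 1/s converges. The difference is the
  cost of normalising W_{n+1} by s_n in place of s_{n+1}.\<close>

lemma inverse_s_diff: "(\<lambda>n. 1 / s (Suc n) - 1 / s n) \<longlonglongrightarrow> 0"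
proof -
  obtain c where c: "c > 0" "\<And>n. n \<ge> 1 \<Longrightarrow> s n \<ge> c" using s_lower by blast
  have "decseq (\<lambda>n. s (Suc n))" by (intro decseq_SucI s_antimono) auto
  then obtain L where L: "(\<lambda>n. s (Suc n)) \<longlonglongrightarrow> L"
    by (rule decseq_convergent[of _ 0]) (use s_pos less_imp_le in auto)
  have "L \<ge> c" by (rule LIMSEQ_le_const[OF L]) (use c in auto)
  have 1: "(\<lambda>n. 1 / s (Suc n)) \<longlonglongrightarrow> 1 / L"
    using \<open>L \<ge> c\<close> c by (intro tendsto_divide tendsto_const L) auto
  then have 2: "(\<lambda>n. 1 / s n) \<longlonglongrightarrow> 1 / L" by (simp add: filterlim_sequentially_Suc[of "\<lambda>n. 1 / s n"])
  from tendsto_diff[OF 1 2] show ?thesis by simp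
qed

text \<open>A bound for the L^2 norm of the memory term when all Z_j have norm at most 1.\<close>

definition \<delta> :: "nat \<Rightarrow> real" where "\<delta> n = \<bar>\<beta> n\<bar> * (\<Sum>j=1..<n. \<bar>\<beta> j\<bar>)"

lemma delta_nonneg: "\<delta> n \<ge> 0"
  by (simp add: \<delta>_def sum_nonneg)

lemma delta_null: "\<delta> \<longlonglongrightarrow> 0"
proof -
  let ?T = "\<Sum>n. (\<beta> n)\<^sup>2"
  have le: "(\<delta> n)\<^sup>2 \<le> (real n * (\<beta> n)\<^sup>2) * ?T" for n
  proof -
    have "(\<Sum>j=1..<n. \<bar>\<beta> j\<bar>)\<^sup>2 \<le> (\<Sum>j=1..<n. 1\<^sup>2) * (\<Sum>j=1..<n. \<bar>\<beta> j\<bar>\<^sup>2)"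
      using Cauchy_Schwarz_ineq_sum[of "\<lambda>_. 1" "\<lambda>j. \<bar>\<beta> j\<bar>" "{1..<n}"] by simp
    also have "\<dots> \<le> real n * ?T"
    proof (rule mult_mono)
      show "(\<Sum>j=1..<n. \<bar>\<beta> j\<bar>\<^sup>2) \<le> ?T"
        unfolding power2_abs by (rule sum_le_suminf[OF \<beta>_summable]) auto
    qed (auto intro: sum_nonneg)
    finally have "(\<beta> n)\<^sup>2 * (\<Sum>j=1..<n. \<bar>\<beta> j\<bar>)\<^sup>2 \<le> (\<beta> n)\<^sup>2 * (real n * ?T)"
      by (intro mult_left_mono) auto
    then show ?thesis by (simp add: \<delta>_def power_mult_distrib mult_ac)
  qed
  have "(\<lambda>n. (real n * (\<beta> n)\<^sup>2) * ?T) \<longlonglongrightarrow> 0"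
    using tendsto_mult_left_zero[OF \<beta>_null, of ?T] by simp
  then have "(\<lambda>n. (\<delta> n)\<^sup>2) \<longlonglongrightarrow> 0"
    by (rule Lim_null_comparison[rotated]) (use le in auto)
  then have "(\<lambda>n. sqrt ((\<delta> n)\<^sup>2)) \<longlonglongrightarrow> sqrt 0" by (rule tendsto_real_sqrt)
  then show ?thesis using delta_nonneg by simp
qed

subsection \<open>Uniform bounds\<close>

definition Zv :: "nat \<Rightarrow> 'w \<Rightarrow> real ^ 'n" where "Zv n \<omega> = A *v W n \<omega> + (s n * \<epsilon> n \<omega>) *\<^sub>R b"

definition Y :: "nat \<Rightarrow> 'w \<Rightarrow> real ^ 'n" where
  "Y n \<omega> = (s n * \<epsilon> n \<omega>) *\<^sub>R b + \<beta> n *\<^sub>R (\<Sum>j=1..<n. \<beta> j *\<^sub>R Zv j \<omega>)"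

lemma W_Suc': "n \<ge> 1 \<Longrightarrow> W (Suc n) \<omega> = A *v W n \<omega> + Y n \<omega>"
  by (simp add: W_Suc Y_def Zv_def add.assoc)

lemma matrix_linear: "linear ((*v) A)"
  by (rule matrix_vector_mul_linear)

lemma matrix_measurable [measurable]: "(*v) A \<in> borel_measurable borel"
  by (intro borel_measurable_continuous_onI linear_continuous_on) (simp add: matrix_vector_mul_bounded_linear)

lemma W_past: "1 \<le> n \<Longrightarrow> n \<le> N \<Longrightarrow> W n \<in> borel_measurable (past M \<epsilon> N)"
proof (induction n rule: less_induct)
  case (less n)
  show ?case
  proof (cases "n = 1")
    case True
    have "W 1 = (\<lambda>_. 0)" using W_1 by auto
    then show ?thesis using True by simp
  next
    case False
    then obtain m where m: "n = Suc m" "m \<ge> 1" using less.prems by (cases n) auto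
    have Z: "(\<lambda>\<omega>. A *v W j \<omega> + (s j * \<epsilon> j \<omega>) *\<^sub>R b) \<in> borel_measurable (past M \<epsilon> N)" if "1 \<le> j" "j \<le> m" for j
      using less.IH[of j] less.prems that m
      by (intro borel_measurable_add borel_measurable_scaleR borel_measurable_times borel_measurable_const
          measurable_past_component measurable_compose[OF _ matrix_measurable]) auto
    have "(\<lambda>\<omega>. (A *v W m \<omega> + (s m * \<epsilon> m \<omega>) *\<^sub>R b) +
        \<beta> m *\<^sub>R (\<Sum>j=1..<m. \<beta> j *\<^sub>R (A *v W j \<omega> + (s j * \<epsilon> j \<omega>) *\<^sub>R b))) \<in> borel_measurable (past M \<epsilon> N)"
      using m(2) by (intro borel_measurable_add borel_measurable_scaleR borel_measurable_sum borel_measurable_const Z) auto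
    moreover have "W n = (\<lambda>\<omega>. (A *v W m \<omega> + (s m * \<epsilon> m \<omega>) *\<^sub>R b) +
        \<beta> m *\<^sub>R (\<Sum>j=1..<m. \<beta> j *\<^sub>R (A *v W j \<omega> + (s j * \<epsilon> j \<omega>) *\<^sub>R b)))"
      unfolding m(1) using W_Suc[OF m(2)] by (rule ext)
    ultimately show ?thesis by simp
  qed
qed

lemma decay1: "norm (A *v v) \<le> (C * \<rho>) * norm v"
  using decay[of 1 v] by simp

lemma C\<rho>_nonneg: "C * \<rho> \<ge> 0"
  using C \<rho> by simp

text \<open>\<open>B\<close> is left free because the resulting bound on the next \<open>W\<close>
  will be compared with \<open>B\<close> itself. The memory term is kept apart, since its factor
  \<open>\<delta> n\<close> tends to 0.\<close>

lemma Zv_Y_bounds: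
  assumes "n \<ge> 1" and W: "\<And>j. 1 \<le> j \<Longrightarrow> j \<le> n \<Longrightarrow> sq_int (W j) \<and> nrm (W j) \<le> B"
  shows "sq_int (Y n)" "nrm (\<lambda>\<omega>. \<beta> n *\<^sub>R (\<Sum>j=1..<n. \<beta> j *\<^sub>R Zv j \<omega>)) \<le> \<delta> n * (C * \<rho> * B + norm b)"
    "sq_int (\<lambda>\<omega>. \<beta> n *\<^sub>R (\<Sum>j=1..<n. \<beta> j *\<^sub>R Zv j \<omega>))"
    "nrm (Y n) \<le> norm b + \<delta> n * (C * \<rho> * B + norm b)"
proof -
  have e: "sq_int (\<lambda>\<omega>. (s j * \<epsilon> j \<omega>) *\<^sub>R b) \<and> nrm (\<lambda>\<omega>. (s j * \<epsilon> j \<omega>) *\<^sub>R b) \<le> norm b" if j: "j \<ge> 1" for j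
  proof -
    have "sq_int (\<lambda>\<omega>. s j *\<^sub>R \<epsilon> j \<omega>)" "nrm (\<lambda>\<omega>. s j *\<^sub>R \<epsilon> j \<omega>) \<le> \<bar>s j\<bar> * nrm (\<epsilon> j)"
      using sq_int_scaleR[OF eps_moments(1)[OF j]] by auto
    moreover have "\<bar>s j\<bar> * nrm (\<epsilon> j) \<le> 1" using s_le_1[OF j] s_pos[OF j] eps_moments(2)[OF j] by simp
    ultimately have 1: "sq_int (\<lambda>\<omega>. s j * \<epsilon> j \<omega>)" "nrm (\<lambda>\<omega>. s j * \<epsilon> j \<omega>) \<le> 1" by auto
    have "norm b * nrm (\<lambda>\<omega>. s j * \<epsilon> j \<omega>) \<le> norm b" using 1(2) by (simp add: mult_left_le)
    then show ?thesis using sq_int_scale_vec[OF 1(1), of b] by auto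
  qed
  have Z: "sq_int (Zv j) \<and> nrm (Zv j) \<le> C * \<rho> * B + norm b" if j: "1 \<le> j" "j \<le> n" for j
  proof -
    have AW: "sq_int (\<lambda>\<omega>. A *v W j \<omega>)" "nrm (\<lambda>\<omega>. A *v W j \<omega>) \<le> C * \<rho> * nrm (W j)"
      using sq_int_linear[OF _ matrix_linear decay1 C\<rho>_nonneg] W[OF j] by auto
    have "C * \<rho> * nrm (W j) \<le> C * \<rho> * B" using W[OF j] C\<rho>_nonneg by (intro mult_left_mono) auto
    then show ?thesis using sq_int_add[OF AW(1)] e[OF j(1)] AW(2) unfolding Zv_def[abs_def]
      by (meson add_mono order_trans)
  qed
  let ?S = "\<lambda>\<omega>. \<Sum>j=1..<n. \<beta> j *\<^sub>R Zv j \<omega>"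
  have S: "sq_int ?S" "nrm ?S \<le> (\<Sum>j=1..<n. nrm (\<lambda>\<omega>. \<beta> j *\<^sub>R Zv j \<omega>))"
  proof -
    have "sq_int (\<lambda>\<omega>. \<beta> j *\<^sub>R Zv j \<omega>)" if "j \<in> {1..<n}" for j
      using Z[of j] that by (intro sq_int_scaleR) auto
    from sq_int_sum[of "{1..<n}" "\<lambda>j \<omega>. \<beta> j *\<^sub>R Zv j \<omega>", OF _ this] show "sq_int ?S" "nrm ?S \<le> (\<Sum>j=1..<n. nrm (\<lambda>\<omega>. \<beta> j *\<^sub>R Zv j \<omega>))"
      by auto
  qed
  have "(\<Sum>j=1..<n. nrm (\<lambda>\<omega>. \<beta> j *\<^sub>R Zv j \<omega>)) \<le> (\<Sum>j=1..<n. \<bar>\<beta> j\<bar> * (C * \<rho> * B + norm b))"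
  proof (rule sum_mono)
    fix j assume "j \<in> {1..<n}"
    then have z: "sq_int (Zv j)" "nrm (Zv j) \<le> C * \<rho> * B + norm b" using Z by auto
    show "nrm (\<lambda>\<omega>. \<beta> j *\<^sub>R Zv j \<omega>) \<le> \<bar>\<beta> j\<bar> * (C * \<rho> * B + norm b)"
      using sq_int_scaleR(2)[OF z(1), of "\<beta> j"] mult_left_mono[OF z(2), of "\<bar>\<beta> j\<bar>"] by simp
  qed
  then have S2: "nrm ?S \<le> (\<Sum>j=1..<n. \<bar>\<beta> j\<bar>) * (C * \<rho> * B + norm b)"
    using S(2) by (simp add: sum_distrib_right)
  show sE: "sq_int (\<lambda>\<omega>. \<beta> n *\<^sub>R ?S \<omega>)" by (rule sq_int_scaleR(1)[OF S(1)])
  show nE: "nrm (\<lambda>\<omega>. \<beta> n *\<^sub>R ?S \<omega>) \<le> \<delta> n * (C * \<rho> * B + norm b)"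
    using sq_int_scaleR(2)[OF S(1), of "\<beta> n"] mult_left_mono[OF S2, of "\<bar>\<beta> n\<bar>"] by (simp add: \<delta>_def mult.assoc)
  show "sq_int (Y n)" "nrm (Y n) \<le> norm b + \<delta> n * (C * \<rho> * B + norm b)"
    using sq_int_add[OF _ sE, of "\<lambda>\<omega>. (s n * \<epsilon> n \<omega>) *\<^sub>R b"] e[OF assms(1)] nE
    unfolding Y_def[abs_def] by auto
qed

lemma W_unrolled: "n \<ge> 1 \<Longrightarrow> W (Suc n) \<omega> = (\<Sum>i=1..n. ((*v) A ^^ (n - i)) (Y i \<omega>))"
proof (induction n rule: dec_induct)
  case base
  show ?case using W_Suc'[of 1 \<omega>] by (simp add: W_1)
next
  case (step n)
  have "W (Suc (Suc n)) \<omega> = A *v (\<Sum>i=1..n. ((*v) A ^^ (n - i)) (Y i \<omega>)) + Y (Suc n) \<omega>"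
    using step W_Suc'[of "Suc n" \<omega>] by simp
  also have "A *v (\<Sum>i=1..n. ((*v) A ^^ (n - i)) (Y i \<omega>)) = (\<Sum>i=1..n. ((*v) A ^^ (Suc n - i)) (Y i \<omega>))"
    unfolding linear_sum[OF matrix_linear] by (intro sum.cong refl) (simp add: Suc_diff_le)
  finally show ?case by simp
qed

lemma linear_funpow: "linear ((*v) A ^^ k)"
  by (induction k) (auto intro: linear_compose[OF _ matrix_linear, unfolded comp_def] simp: linear_iff matrix_vector_right_distrib matrix_vector_mult_scaleR)

text \<open>In the unrolled recursion the innovations contribute at most the constant
  \<open>c1\<close>, while the memory terms contribute \<open>B\<close> with the factor \<kappa>_n C
  \<rho>, where \<kappa>_n is a geometrically weighted sum of \<delta> and tends to 0. Once this
  factor is below 1/2, the bound reproduces itself.\<close>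

lemma W_bounded: "\<exists>B\<ge>0. \<forall>n\<ge>1. sq_int (W n) \<and> nrm (W n) \<le> B"
proof -
  have sq: "sq_int (W n)" if "n \<ge> 1" for n
    using that
  proof (induction n rule: less_induct)
    case (less n)
    show ?case
    proof (cases "n = 1")
      case True
      have "W 1 = (\<lambda>_. 0)" using W_1 by auto
      then show ?thesis using True by (simp add: sq_int_0)
    next
      case False
      then obtain m where m: "n = Suc m" "m \<ge> 1" using less.prems by (cases n) auto
      \<comment> \<open>Only square integrability is wanted here, so this bound may depend on
        m.\<close>
      define B where "B = (\<Sum>j=1..m. nrm (W j))"
      have "sq_int (W j) \<and> nrm (W j) \<le> B" if "1 \<le> j" "j \<le> m" for j
        using less.IH[of j] that m by (auto simp: B_def intro!: member_le_sum)
      from Zv_Y_bounds(1)[OF m(2) this] have "sq_int (Y m)" .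
      moreover have "sq_int (\<lambda>\<omega>. A *v W m \<omega>)"
        using less.IH[of m] m by (intro sq_int_linear[OF _ matrix_linear decay1 C\<rho>_nonneg]) auto
      moreover have "W n = (\<lambda>\<omega>. A *v W m \<omega> + Y m \<omega>)" using m W_Suc' by auto
      ultimately show ?thesis using sq_int_add(1) by metis
    qed
  qed
  define \<kappa> where "\<kappa> n = C * (\<Sum>i=1..n. \<rho> ^ (n - i) * \<delta> i)" for n
  define c1 where "c1 = C / (1 - \<rho>) * norm b"
  have step: "nrm (W (Suc n)) \<le> c1 + \<kappa> n * (C * \<rho> * B + norm b)"
    if n: "n \<ge> 1" and B: "\<And>j. 1 \<le> j \<Longrightarrow> j \<le> n \<Longrightarrow> nrm (W j) \<le> B" for n B
  proof -
    have yb: "sq_int (Y i) \<and> nrm (Y i) \<le> norm b + \<delta> i * (C * \<rho> * B + norm b)" if "i \<in> {1..n}" for i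
      using Zv_Y_bounds(1,4)[of i B] sq B that by auto
    have fb: "sq_int (\<lambda>\<omega>. ((*v) A ^^ (n - i)) (Y i \<omega>)) \<and>
        nrm (\<lambda>\<omega>. ((*v) A ^^ (n - i)) (Y i \<omega>)) \<le> C * \<rho> ^ (n - i) * nrm (Y i)" if "i \<in> {1..n}" for i
      using sq_int_linear[OF _ linear_funpow decay, of "Y i" "n - i"] yb[OF that] C \<rho> by auto
    have "nrm (W (Suc n)) = nrm (\<lambda>\<omega>. \<Sum>i=1..n. ((*v) A ^^ (n - i)) (Y i \<omega>))"
      using W_unrolled[OF n] by (intro arg_cong[where f=nrm]) auto
    also have "\<dots> \<le> (\<Sum>i=1..n. nrm (\<lambda>\<omega>. ((*v) A ^^ (n - i)) (Y i \<omega>)))"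
      using sq_int_sum[of "{1..n}" "\<lambda>i \<omega>. ((*v) A ^^ (n - i)) (Y i \<omega>)"] fb by auto
    also have "\<dots> \<le> (\<Sum>i=1..n. C * \<rho> ^ (n - i) * (norm b + \<delta> i * (C * \<rho> * B + norm b)))"
    proof (rule sum_mono)
      fix i assume i: "i \<in> {1..n}"
      have "C * \<rho> ^ (n - i) * nrm (Y i) \<le> C * \<rho> ^ (n - i) * (norm b + \<delta> i * (C * \<rho> * B + norm b))"
        using yb[OF i] C \<rho> by (intro mult_left_mono) auto
      then show "nrm (\<lambda>\<omega>. ((*v) A ^^ (n - i)) (Y i \<omega>)) \<le> C * \<rho> ^ (n - i) * (norm b + \<delta> i * (C * \<rho> * B + norm b))"
        using fb[OF i] by simp
    qed
    also have "\<dots> = C * (\<Sum>i=1..n. \<rho> ^ (n - i)) * norm b + \<kappa> n * (C * \<rho> * B + norm b)"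
      by (simp add: \<kappa>_def sum_distrib_left sum_distrib_right sum.distrib algebra_simps)
    also have "C * (\<Sum>i=1..n. \<rho> ^ (n - i)) * norm b \<le> c1"
      unfolding c1_def using mult_left_mono[OF geometric_sum_le[OF \<rho>, of n] C]
      by (intro mult_right_mono) auto
    finally show ?thesis by simp
  qed
  have "\<kappa> \<longlonglongrightarrow> C * 0" unfolding \<kappa>_def by (intro tendsto_mult tendsto_const geometric_null delta_null \<rho>)
  then have "\<kappa> \<longlonglongrightarrow> 0" by simp
  then have "(\<lambda>n. \<kappa> n * (C * \<rho>)) \<longlonglongrightarrow> 0" by (rule tendsto_mult_left_zero)
  from order_tendstoD(2)[OF this, of "1/2"] order_tendstoD(2)[OF \<open>\<kappa> \<longlonglongrightarrow> 0\<close>, of 1]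
  have "eventually (\<lambda>n. \<kappa> n * (C * \<rho>) < 1/2 \<and> \<kappa> n < 1) sequentially"
    by (intro eventually_conj) simp_all
  then obtain N where N: "\<And>n. n \<ge> N \<Longrightarrow> \<kappa> n * (C * \<rho>) < 1/2 \<and> \<kappa> n < 1"
    by (auto simp: eventually_at_top_linorder)
  \<comment> \<open>The first entry ensures c1 + B/2 + norm b \<le> B, the second covers the times
    before \<kappa> is small.\<close>
  define B where "B = max (2 * (c1 + norm b)) (\<Sum>j=1..Suc N. nrm (W j))"
  have "c1 \<ge> 0" using C \<rho> by (simp add: c1_def)
  then have B0: "B \<ge> 0" by (auto simp: B_def le_max_iff_disj)
  have "nrm (W n) \<le> B" if "n \<ge> 1" for n
    using that
  proof (induction n rule: less_induct)
    case (less n)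
    show ?case
    proof (cases "n \<le> Suc N")
      case True
      then have "nrm (W n) \<le> (\<Sum>j=1..Suc N. nrm (W j))" using less.prems by (intro member_le_sum) auto
      then show ?thesis by (simp add: B_def)
    next
      case False
      then obtain m where m: "n = Suc m" "m \<ge> 1" "m \<ge> N" by (cases n) auto
      have "nrm (W n) \<le> c1 + \<kappa> m * (C * \<rho> * B + norm b)"
        unfolding m(1) using less.IH m by (intro step) auto
      also have "\<dots> = c1 + (\<kappa> m * (C * \<rho>)) * B + \<kappa> m * norm b" by (simp add: algebra_simps)
      also have "\<dots> \<le> c1 + (1/2) * B + 1 * norm b"
        using N[OF m(3)] B0 by (intro add_mono mult_right_mono) auto
      also have "2 * (c1 + norm b) \<le> B" by (simp add: B_def)
      then have "c1 + (1/2) * B + 1 * norm b \<le> B" by simp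
      finally show ?thesis .
    qed
  qed
  then show ?thesis using sq B0 by blast
qed

end

section \<open>The regressor divided by \<sigma>_n\<close>

context innovation_ar
begin

definition U :: "nat \<Rightarrow> 'w \<Rightarrow> real ^ 'n" where "U n \<omega> = (1 / s n) *\<^sub>R W n \<omega>"

text \<open>The two defects in the recursion for \<open>U\<close>: the change of normalisation from
  s_n to s_{n+1}, and the memory term.\<close>

definition E :: "nat \<Rightarrow> 'w \<Rightarrow> real ^ 'n" where
  "E n \<omega> = (1 / s (Suc n) - 1 / s n) *\<^sub>R W (Suc n) \<omega> + (1 / s n) *\<^sub>R (\<beta> n *\<^sub>R (\<Sum>j=1..<n. \<beta> j *\<^sub>R Zv j \<omega>))"

lemma U_1: "U (Suc 0) \<omega> = 0"
  by (simp add: U_def W_1)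

lemma U_Suc: "n \<ge> 1 \<Longrightarrow> U (Suc n) \<omega> = A *v U n \<omega> + \<epsilon> n \<omega> *\<^sub>R b + E n \<omega>"
proof -
  assume n: "n \<ge> 1"
  have "(1 / s n) *\<^sub>R W (Suc n) \<omega> = A *v U n \<omega> + \<epsilon> n \<omega> *\<^sub>R b +
      (1 / s n) *\<^sub>R (\<beta> n *\<^sub>R (\<Sum>j=1..<n. \<beta> j *\<^sub>R Zv j \<omega>))"
    using s_pos[OF n] by (simp add: W_Suc'[OF n] Y_def U_def scaleR_add_right matrix_vector_mult_scaleR add.assoc)
  then show ?thesis by (simp add: U_def E_def scaleR_diff_left)
qed

lemma U_past: "1 \<le> n \<Longrightarrow> U n \<in> borel_measurable (past M \<epsilon> n)"
  unfolding U_def[abs_def] by (intro borel_measurable_scaleR borel_measurable_const W_past) auto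

lemma U_bounded: "\<exists>B\<ge>0. \<forall>n\<ge>1. sq_int (U n) \<and> nrm (U n) \<le> B"
proof -
  obtain B where B: "B \<ge> 0" "\<And>n. n \<ge> 1 \<Longrightarrow> sq_int (W n) \<and> nrm (W n) \<le> B" using W_bounded by blast
  obtain c where c: "c > 0" "\<And>n. n \<ge> 1 \<Longrightarrow> s n \<ge> c" using s_lower by blast
  have "sq_int (U n) \<and> nrm (U n) \<le> (1 / c) * B" if n: "n \<ge> 1" for n
  proof -
    have Wn: "sq_int (W n)" using B(2)[OF n] by blast
    have "nrm (U n) \<le> \<bar>1 / s n\<bar> * nrm (W n)" "sq_int (U n)"
      unfolding U_def[abs_def] by (rule sq_int_scaleR(2)[OF Wn], rule sq_int_scaleR(1)[OF Wn])
    moreover have "\<bar>1 / s n\<bar> * nrm (W n) \<le> (1 / c) * B"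
      using B(2)[OF n] c(2)[OF n] c(1) by (intro mult_mono) (auto simp: frac_le)
    ultimately show ?thesis by simp
  qed
  then show ?thesis using B(1) c(1) by (intro exI[of _ "(1 / c) * B"]) auto
qed

lemma E_null: "(\<lambda>n. nrm (E n)) \<longlonglongrightarrow> 0" and E_sq_int: "n \<ge> 1 \<Longrightarrow> sq_int (E n)"
proof -
  obtain B where B: "B \<ge> 0" "\<And>n. n \<ge> 1 \<Longrightarrow> sq_int (W n) \<and> nrm (W n) \<le> B" using W_bounded by blast
  obtain c where c: "c > 0" "\<And>n. n \<ge> 1 \<Longrightarrow> s n \<ge> c" using s_lower by blast
  let ?K = "C * \<rho> * B + norm b"
  have K: "?K \<ge> 0" using B(1) C\<rho>_nonneg by simp
  have *: "sq_int (E n) \<and> nrm (E n) \<le> \<bar>1 / s (Suc n) - 1 / s n\<bar> * B + (1 / c) * (\<delta> n * ?K)" if n: "n \<ge> 1" for n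
  proof -
    have 1: "sq_int (\<lambda>\<omega>. (1 / s (Suc n) - 1 / s n) *\<^sub>R W (Suc n) \<omega>)"
      "nrm (\<lambda>\<omega>. (1 / s (Suc n) - 1 / s n) *\<^sub>R W (Suc n) \<omega>) \<le> \<bar>1 / s (Suc n) - 1 / s n\<bar> * nrm (W (Suc n))"
    proof -
      have Wn: "sq_int (W (Suc n))" using B(2)[of "Suc n"] by simp
      show "sq_int (\<lambda>\<omega>. (1 / s (Suc n) - 1 / s n) *\<^sub>R W (Suc n) \<omega>)"
        "nrm (\<lambda>\<omega>. (1 / s (Suc n) - 1 / s n) *\<^sub>R W (Suc n) \<omega>) \<le> \<bar>1 / s (Suc n) - 1 / s n\<bar> * nrm (W (Suc n))"
        by (rule sq_int_scaleR(1)[OF Wn], rule sq_int_scaleR(2)[OF Wn])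
    qed
    have zy: "nrm (\<lambda>\<omega>. \<beta> n *\<^sub>R (\<Sum>j=1..<n. \<beta> j *\<^sub>R Zv j \<omega>)) \<le> \<delta> n * ?K"
      "sq_int (\<lambda>\<omega>. \<beta> n *\<^sub>R (\<Sum>j=1..<n. \<beta> j *\<^sub>R Zv j \<omega>))"
      using Zv_Y_bounds(2,3)[OF n, of B] B(2) by blast+
    have 2: "sq_int (\<lambda>\<omega>. (1 / s n) *\<^sub>R (\<beta> n *\<^sub>R (\<Sum>j=1..<n. \<beta> j *\<^sub>R Zv j \<omega>)))"
      "nrm (\<lambda>\<omega>. (1 / s n) *\<^sub>R (\<beta> n *\<^sub>R (\<Sum>j=1..<n. \<beta> j *\<^sub>R Zv j \<omega>))) \<le> \<bar>1 / s n\<bar> * nrm (\<lambda>\<omega>. \<beta> n *\<^sub>R (\<Sum>j=1..<n. \<beta> j *\<^sub>R Zv j \<omega>))"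
      by (rule sq_int_scaleR(1)[OF zy(2)], rule sq_int_scaleR(2)[OF zy(2)])
    have 3: "\<bar>1 / s (Suc n) - 1 / s n\<bar> * nrm (W (Suc n)) \<le> \<bar>1 / s (Suc n) - 1 / s n\<bar> * B"
      using B(2)[of "Suc n"] by (intro mult_left_mono) auto
    have 4: "\<bar>1 / s n\<bar> * nrm (\<lambda>\<omega>. \<beta> n *\<^sub>R (\<Sum>j=1..<n. \<beta> j *\<^sub>R Zv j \<omega>)) \<le> (1 / c) * (\<delta> n * ?K)"
      using c(2)[OF n] c(1) zy(1) B(2) by (intro mult_mono) (auto simp: frac_le)
    show ?thesis unfolding E_def[abs_def] using sq_int_add[OF 1(1) 2(1)] 1(2) 2(2) 3 4 by linarith
  qed
  then show "n \<ge> 1 \<Longrightarrow> sq_int (E n)" by blast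
  have "(\<lambda>n. \<bar>1 / s (Suc n) - 1 / s n\<bar> * B + (1 / c) * (\<delta> n * ?K)) \<longlonglongrightarrow> \<bar>0\<bar> * B + (1 / c) * (0 * ?K)"
    by (intro tendsto_add tendsto_mult tendsto_const tendsto_rabs inverse_s_diff delta_null)
  then have lim: "(\<lambda>n. \<bar>1 / s (Suc n) - 1 / s n\<bar> * B + (1 / c) * (\<delta> n * ?K)) \<longlonglongrightarrow> 0" by simp
  show "(\<lambda>n. nrm (E n)) \<longlonglongrightarrow> 0"
  proof (rule Lim_null_comparison[OF _ lim])
    show "\<forall>\<^sub>F n in sequentially. norm (nrm (E n)) \<le> \<bar>1 / s (Suc n) - 1 / s n\<bar> * B + (1 / c) * (\<delta> n * ?K)"
      using eventually_ge_at_top[of 1] by eventually_elim (use * in simp)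
  qed
qed

subsection \<open>Law of large numbers\<close>

text \<open>The quadratic variation of <v, M_n / sqrt n>; for v = u it is also the quadratic term of
  the log-likelihood ratio.\<close>

definition q :: "nat \<Rightarrow> real ^ 'n \<Rightarrow> 'w \<Rightarrow> real" where
  "q n v \<omega> = (\<Sum>i=1..n. (v \<bullet> U i \<omega>)\<^sup>2) / real n"

lemma U_inner:
  assumes B': "\<forall>n\<ge>1. sq_int (U n) \<and> nrm (U n) \<le> B" and n: "n \<ge> 1"
  shows "sq_int (\<lambda>\<omega>. v \<bullet> U n \<omega>)" "nrm (\<lambda>\<omega>. v \<bullet> U n \<omega>) \<le> norm v * B"
    "integrable M (\<lambda>\<omega>. (v \<bullet> U n \<omega>)\<^sup>2)" "expectation (\<lambda>\<omega>. (v \<bullet> U n \<omega>)\<^sup>2) \<le> (norm v * B)\<^sup>2"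
proof -
  have B: "n \<ge> 1 \<Longrightarrow> sq_int (U n) \<and> nrm (U n) \<le> B" for n using B' by blast
  show 1: "sq_int (\<lambda>\<omega>. v \<bullet> U n \<omega>)" using sq_int_inner(1) B[OF n] by blast
  have "norm v * nrm (U n) \<le> norm v * B" using B[OF n] by (intro mult_left_mono) auto
  then show 2: "nrm (\<lambda>\<omega>. v \<bullet> U n \<omega>) \<le> norm v * B" using sq_int_inner(2)[of "U n" v] B[OF n] by simp
  show "integrable M (\<lambda>\<omega>. (v \<bullet> U n \<omega>)\<^sup>2)" using sq_intD(2)[OF 1] by simp
  show "expectation (\<lambda>\<omega>. (v \<bullet> U n \<omega>)\<^sup>2) \<le> (norm v * B)\<^sup>2"
    unfolding nrm_real_sq[symmetric] using 2 by (intro power_mono) auto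
qed

lemma q_integrable: "integrable M (q n v)"
proof -
  obtain B where B: "\<forall>n\<ge>1. sq_int (U n) \<and> nrm (U n) \<le> B" using U_bounded by blast
  show ?thesis unfolding q_def[abs_def]
    by (intro integrable_divide_zero Bochner_Integration.integrable_sum impI U_inner(3)[OF B]) auto
qed

text \<open>One squares <v, U_{i+1}> = <A^T v, U_i> + <v, b> \<epsilon>_i + <v, E_i> and sums over
  i. The terms \<epsilon>_i^2 - 1 and \<epsilon>_i <A^T v, U_i> are martingale differences, and
  whatever involves E_i is small in L^1.\<close>

lemma q_step: "(\<lambda>n. expectation (\<lambda>\<omega>. \<bar>q n v \<omega> - q n (transpose A *v v) \<omega> - (v \<bullet> b)\<^sup>2\<bar>)) \<longlonglongrightarrow> 0"
proof -
  define w where "w = transpose A *v v"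
  define a where "a = v \<bullet> b"
  obtain B where B0: "B \<ge> 0" and B: "\<forall>n\<ge>1. sq_int (U n) \<and> nrm (U n) \<le> B" using U_bounded by blast
  note Ui = U_inner[OF B]
  define R where "R i \<omega> = 2 * ((v \<bullet> E i \<omega>) * (w \<bullet> U i \<omega> + a * \<epsilon> i \<omega>)) + (v \<bullet> E i \<omega>)\<^sup>2" for i \<omega>
  define T2 where "T2 n \<omega> = (\<Sum>i=1..n. ((\<epsilon> i \<omega>)\<^sup>2 - 1) * 1)" for n \<omega>
  define T3 where "T3 n \<omega> = (\<Sum>i=1..n. \<epsilon> i \<omega> * (w \<bullet> U i \<omega>))" for n \<omega>
  define T4 where "T4 n \<omega> = (\<Sum>i=1..n. R i \<omega>)" for n \<omega>
  have vU: "v \<bullet> U (Suc i) \<omega> = w \<bullet> U i \<omega> + a * \<epsilon> i \<omega> + v \<bullet> E i \<omega>" if "i \<ge> 1" for i \<omega>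
    using matrix_funpow_adjoint[of 1 A v "U i \<omega>"]
    by (simp add: U_Suc[OF that] inner_add_right w_def a_def mult.commute del: transpose_matrix_vector)
  have incr: "(v \<bullet> U (Suc i) \<omega>)\<^sup>2 - (w \<bullet> U i \<omega>)\<^sup>2 - a\<^sup>2 =
      a\<^sup>2 * (((\<epsilon> i \<omega>)\<^sup>2 - 1) * 1) + (2 * a) * (\<epsilon> i \<omega> * (w \<bullet> U i \<omega>)) + R i \<omega>" if "i \<ge> 1" for i \<omega>
    unfolding vU[OF that] R_def by (simp add: power2_eq_square algebra_simps)
  \<comment> \<open>The index shift costs only the last square, because U_1 = 0.\<close>
  have eq: "real n * (q n v \<omega> - q n w \<omega> - a\<^sup>2) =
      - (v \<bullet> U (Suc n) \<omega>)\<^sup>2 + a\<^sup>2 * T2 n \<omega> + (2 * a) * T3 n \<omega> + T4 n \<omega>" if n: "n \<ge> 1" for n \<omega>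
  proof -
    have "(\<Sum>i=1..n. (v \<bullet> U (Suc i) \<omega>)\<^sup>2) + (v \<bullet> U 1 \<omega>)\<^sup>2 = (\<Sum>i=1..n. (v \<bullet> U i \<omega>)\<^sup>2) + (v \<bullet> U (Suc n) \<omega>)\<^sup>2"
      by (induction n) auto
    then have "(\<Sum>i=1..n. (v \<bullet> U i \<omega>)\<^sup>2) = (\<Sum>i=1..n. (v \<bullet> U (Suc i) \<omega>)\<^sup>2) - (v \<bullet> U (Suc n) \<omega>)\<^sup>2"
      by (simp add: U_1)
    moreover have "(\<Sum>i=1..n. (v \<bullet> U (Suc i) \<omega>)\<^sup>2 - (w \<bullet> U i \<omega>)\<^sup>2 - a\<^sup>2) = a\<^sup>2 * T2 n \<omega> + (2 * a) * T3 n \<omega> + T4 n \<omega>"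
      unfolding T2_def T3_def T4_def sum_distrib_left sum.distrib[symmetric]
      by (intro sum.cong refl) (rule incr, simp)
    moreover have "(\<Sum>i=1..n. (v \<bullet> U (Suc i) \<omega>)\<^sup>2 - (w \<bullet> U i \<omega>)\<^sup>2 - a\<^sup>2) =
        (\<Sum>i=1..n. (v \<bullet> U (Suc i) \<omega>)\<^sup>2) - (\<Sum>i=1..n. (w \<bullet> U i \<omega>)\<^sup>2) - real n * a\<^sup>2"
      by (simp add: sum_subtractf)
    moreover have "real n * (q n v \<omega> - q n w \<omega> - a\<^sup>2) = (\<Sum>i=1..n. (v \<bullet> U i \<omega>)\<^sup>2) - (\<Sum>i=1..n. (w \<bullet> U i \<omega>)\<^sup>2) - real n * a\<^sup>2"
      using n by (simp add: q_def algebra_simps)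
    ultimately show ?thesis by linarith
  qed
  define e where "e i = 2 * (norm v * nrm (E i) * (norm w * B + \<bar>a\<bar>)) + (norm v * nrm (E i))\<^sup>2" for i
  have R: "integrable M (R i) \<and> expectation (\<lambda>\<omega>. \<bar>R i \<omega>\<bar>) \<le> e i" if i: "i \<ge> 1" for i
  proof -
    have vE: "sq_int (\<lambda>\<omega>. v \<bullet> E i \<omega>)" "nrm (\<lambda>\<omega>. v \<bullet> E i \<omega>) \<le> norm v * nrm (E i)"
      using sq_int_inner[OF E_sq_int[OF i]] by auto
    have ae: "sq_int (\<lambda>\<omega>. a * \<epsilon> i \<omega>)" "nrm (\<lambda>\<omega>. a * \<epsilon> i \<omega>) \<le> \<bar>a\<bar>"
      using sq_int_scaleR[OF eps_moments(1)[OF i], of a] eps_moments(2)[OF i] by auto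
    have we: "sq_int (\<lambda>\<omega>. w \<bullet> U i \<omega> + a * \<epsilon> i \<omega>)" "nrm (\<lambda>\<omega>. w \<bullet> U i \<omega> + a * \<epsilon> i \<omega>) \<le> norm w * B + \<bar>a\<bar>"
      using sq_int_add[OF Ui(1)[OF i, of w] ae(1)] Ui(2)[OF i, of w] ae(2) by auto
    note p = sq_int_mult[OF vE(1) we(1)]
    have "nrm (\<lambda>\<omega>. v \<bullet> E i \<omega>) * nrm (\<lambda>\<omega>. w \<bullet> U i \<omega> + a * \<epsilon> i \<omega>) \<le> norm v * nrm (E i) * (norm w * B + \<bar>a\<bar>)"
      using vE(2) we(2) by (intro mult_mono) auto
    with p(2) have p2: "expectation (\<lambda>\<omega>. \<bar>(v \<bullet> E i \<omega>) * (w \<bullet> U i \<omega> + a * \<epsilon> i \<omega>)\<bar>) \<le> norm v * nrm (E i) * (norm w * B + \<bar>a\<bar>)"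
      by simp
    have i2: "integrable M (\<lambda>\<omega>. (v \<bullet> E i \<omega>)\<^sup>2)" using sq_intD(2)[OF vE(1)] by simp
    have e2: "expectation (\<lambda>\<omega>. (v \<bullet> E i \<omega>)\<^sup>2) \<le> (norm v * nrm (E i))\<^sup>2"
      unfolding nrm_real_sq[symmetric] using vE(2) by (intro power_mono) auto
    have iR: "integrable M (R i)" unfolding R_def[abs_def]
      by (intro Bochner_Integration.integrable_add integrable_mult_right p(1) i2)
    have "expectation (\<lambda>\<omega>. \<bar>R i \<omega>\<bar>) \<le> expectation (\<lambda>\<omega>. 2 * \<bar>(v \<bullet> E i \<omega>) * (w \<bullet> U i \<omega> + a * \<epsilon> i \<omega>)\<bar> + (v \<bullet> E i \<omega>)\<^sup>2)"
    proof (rule integral_mono)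
      show "\<bar>R i \<omega>\<bar> \<le> 2 * \<bar>(v \<bullet> E i \<omega>) * (w \<bullet> U i \<omega> + a * \<epsilon> i \<omega>)\<bar> + (v \<bullet> E i \<omega>)\<^sup>2" for \<omega>
        unfolding R_def by (rule order_trans[OF abs_triangle_ineq]) (simp add: abs_mult)
    qed (intro integrable_abs iR Bochner_Integration.integrable_add integrable_mult_right p(1) i2)+
    also have "\<dots> = 2 * expectation (\<lambda>\<omega>. \<bar>(v \<bullet> E i \<omega>) * (w \<bullet> U i \<omega> + a * \<epsilon> i \<omega>)\<bar>) + expectation (\<lambda>\<omega>. (v \<bullet> E i \<omega>)\<^sup>2)"
      using p(1) i2 by (subst Bochner_Integration.integral_add) (auto intro!: integrable_mult_right integrable_abs)
    also have "\<dots> \<le> e i" unfolding e_def using p2 e2 by simp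
    finally show ?thesis using iR by simp
  qed
  have T2: "integrable M (T2 n)" "expectation (\<lambda>\<omega>. \<bar>T2 n \<omega>\<bar>) \<le> sqrt (real n) * sqrt 2" for n
  proof -
    have "sq_int (T2 n) \<and> nrm (T2 n) \<le> sqrt (real n) * (sqrt 2 * 1)"
      unfolding T2_def[abs_def]
    proof (rule martingale_sum_bound[of "\<lambda>_ _. 1" 1 "\<lambda>x. x\<^sup>2 - 1" "sqrt 2" n])
      fix i :: nat assume "i \<ge> 1"
      then show "sq_int (\<lambda>\<omega>. (\<epsilon> i \<omega>)\<^sup>2 - 1)" "expectation (\<lambda>\<omega>. (\<epsilon> i \<omega>)\<^sup>2 - 1) = 0"
        "nrm (\<lambda>\<omega>. (\<epsilon> i \<omega>)\<^sup>2 - 1) \<le> sqrt 2"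
        using eps_moments(4-6)[of i] by simp_all
    qed (simp_all add: sq_int_const)
    then show "integrable M (T2 n)" "expectation (\<lambda>\<omega>. \<bar>T2 n \<omega>\<bar>) \<le> sqrt (real n) * sqrt 2"
      using sq_int_integrable[of "T2 n"] by auto
  qed
  have T3: "integrable M (T3 n)" "expectation (\<lambda>\<omega>. \<bar>T3 n \<omega>\<bar>) \<le> sqrt (real n) * (norm w * B)" for n
  proof -
    have "sq_int (T3 n) \<and> nrm (T3 n) \<le> sqrt (real n) * (1 * (norm w * B))"
      unfolding T3_def[abs_def]
    proof (rule martingale_sum_bound[of "\<lambda>i \<omega>. w \<bullet> U i \<omega>" "norm w * B" "\<lambda>x. x" 1 n])
      fix i :: nat assume i: "i \<ge> 1"
      show "sq_int (\<lambda>\<omega>. \<epsilon> i \<omega>)" "expectation (\<lambda>\<omega>. \<epsilon> i \<omega>) = 0" "nrm (\<lambda>\<omega>. \<epsilon> i \<omega>) \<le> 1"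
        using eps_moments(1-3)[OF i] by simp_all
      show "(\<lambda>\<omega>. w \<bullet> U i \<omega>) \<in> borel_measurable (past M \<epsilon> i)"
        by (intro borel_measurable_inner borel_measurable_const U_past i)
      show "sq_int (\<lambda>\<omega>. w \<bullet> U i \<omega>)" "nrm (\<lambda>\<omega>. w \<bullet> U i \<omega>) \<le> norm w * B"
        using Ui(1,2)[OF i] by blast+
    qed simp
    then show "integrable M (T3 n)" "expectation (\<lambda>\<omega>. \<bar>T3 n \<omega>\<bar>) \<le> sqrt (real n) * (norm w * B)"
      using sq_int_integrable[of "T3 n"] by auto
  qed
  have T4: "integrable M (T4 n)" "expectation (\<lambda>\<omega>. \<bar>T4 n \<omega>\<bar>) \<le> (\<Sum>i=1..n. e i)" for n
  proof -
    show "integrable M (T4 n)" unfolding T4_def[abs_def] using R by (intro Bochner_Integration.integrable_sum) auto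
    have "expectation (\<lambda>\<omega>. \<bar>T4 n \<omega>\<bar>) \<le> (\<Sum>i=1..n. expectation (\<lambda>\<omega>. \<bar>R i \<omega>\<bar>))"
      unfolding T4_def using R by (intro integral_abs_sum_le) auto
    also have "\<dots> \<le> (\<Sum>i=1..n. e i)" using R by (intro sum_mono) auto
    finally show "expectation (\<lambda>\<omega>. \<bar>T4 n \<omega>\<bar>) \<le> (\<Sum>i=1..n. e i)" .
  qed
  \<comment> \<open>Before division by n, the boundary term is bounded, the martingale sums
    \<open>T2\<close> and \<open>T3\<close> are of order sqrt n, and the defects have a vanishing
    Cesaro mean.\<close>
  let ?bd = "\<lambda>n. (norm v * B)\<^sup>2 * (1 / real n) + (a\<^sup>2 * sqrt 2 + 2 * \<bar>a\<bar> * (norm w * B)) * (1 / sqrt (real n)) + (\<Sum>i=1..n. e i) / real n"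
  have bd: "expectation (\<lambda>\<omega>. \<bar>q n v \<omega> - q n w \<omega> - a\<^sup>2\<bar>) \<le> ?bd n" if n: "n \<ge> 1" for n
  proof -
    have n0: "real n > 0" using n by simp
    have "real n * expectation (\<lambda>\<omega>. \<bar>q n v \<omega> - q n w \<omega> - a\<^sup>2\<bar>) =
        expectation (\<lambda>\<omega>. \<bar>real n * (q n v \<omega> - q n w \<omega> - a\<^sup>2)\<bar>)"
      by (simp add: abs_mult)
    also have "\<dots> \<le> expectation (\<lambda>\<omega>. (v \<bullet> U (Suc n) \<omega>)\<^sup>2 + a\<^sup>2 * \<bar>T2 n \<omega>\<bar> + (2 * \<bar>a\<bar>) * \<bar>T3 n \<omega>\<bar> + \<bar>T4 n \<omega>\<bar>)"
    proof (rule integral_mono)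
      show "\<bar>real n * (q n v \<omega> - q n w \<omega> - a\<^sup>2)\<bar> \<le>
          (v \<bullet> U (Suc n) \<omega>)\<^sup>2 + a\<^sup>2 * \<bar>T2 n \<omega>\<bar> + (2 * \<bar>a\<bar>) * \<bar>T3 n \<omega>\<bar> + \<bar>T4 n \<omega>\<bar>" for \<omega>
      proof -
        have "\<bar>a\<^sup>2 * T2 n \<omega>\<bar> = a\<^sup>2 * \<bar>T2 n \<omega>\<bar>" "\<bar>(2 * a) * T3 n \<omega>\<bar> = (2 * \<bar>a\<bar>) * \<bar>T3 n \<omega>\<bar>" by (auto simp: abs_mult)
        then show ?thesis unfolding eq[OF n] using zero_le_power2[of "v \<bullet> U (Suc n) \<omega>"] by linarith
      qed
      show "integrable M (\<lambda>\<omega>. \<bar>real n * (q n v \<omega> - q n w \<omega> - a\<^sup>2)\<bar>)"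
        by (intro integrable_abs integrable_mult_right Bochner_Integration.integrable_diff q_integrable integrable_const)
      show "integrable M (\<lambda>\<omega>. (v \<bullet> U (Suc n) \<omega>)\<^sup>2 + a\<^sup>2 * \<bar>T2 n \<omega>\<bar> + (2 * \<bar>a\<bar>) * \<bar>T3 n \<omega>\<bar> + \<bar>T4 n \<omega>\<bar>)"
        by (intro Bochner_Integration.integrable_add integrable_mult_right integrable_abs T2 T3 T4 Ui) simp
    qed
    also have "\<dots> = expectation (\<lambda>\<omega>. (v \<bullet> U (Suc n) \<omega>)\<^sup>2) + a\<^sup>2 * expectation (\<lambda>\<omega>. \<bar>T2 n \<omega>\<bar>) +
        (2 * \<bar>a\<bar>) * expectation (\<lambda>\<omega>. \<bar>T3 n \<omega>\<bar>) + expectation (\<lambda>\<omega>. \<bar>T4 n \<omega>\<bar>)"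
      using T2(1)[of n] T3(1)[of n] T4(1)[of n] Ui(3)[of "Suc n"] by simp
    also have "\<dots> \<le> (norm v * B)\<^sup>2 + a\<^sup>2 * (sqrt (real n) * sqrt 2) + (2 * \<bar>a\<bar>) * (sqrt (real n) * (norm w * B)) + (\<Sum>i=1..n. e i)"
      by (intro add_mono mult_left_mono T2 T3 T4 Ui) auto
    also have "\<dots> = real n * ?bd n"
    proof -
      have rn: "real n * (1 / sqrt (real n)) = sqrt (real n)" using n0 by (simp add: real_div_sqrt)
      have ex: "real n * (x * (1 / real n) + y * (1 / sqrt (real n)) + z / real n) = x + y * (real n * (1 / sqrt (real n))) + z"
        for x y z using n0 by (simp add: distrib_left)
      show ?thesis unfolding ex rn by (simp add: algebra_simps)
    qed
    finally show ?thesis using n0 by (simp only: mult_le_cancel_left_pos)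
  qed
  have "e \<longlonglongrightarrow> 2 * (norm v * 0 * (norm w * B + \<bar>a\<bar>)) + (norm v * 0)\<^sup>2"
    unfolding e_def by (intro tendsto_add tendsto_mult tendsto_power tendsto_const E_null)
  then have "e \<longlonglongrightarrow> 0" by simp
  from cesaro_null[OF this] have ce: "(\<lambda>n. (\<Sum>i=1..n. e i) / real n) \<longlonglongrightarrow> 0" .
  have sq: "(\<lambda>n. 1 / sqrt (real n)) \<longlonglongrightarrow> 0"
    using tendsto_real_sqrt[OF lim_1_over_n] by (simp add: real_sqrt_divide)
  have "?bd \<longlonglongrightarrow> (norm v * B)\<^sup>2 * 0 + (a\<^sup>2 * sqrt 2 + 2 * \<bar>a\<bar> * (norm w * B)) * 0 + 0"
    by (intro tendsto_add tendsto_mult tendsto_const lim_1_over_n sq ce)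
  then have lim: "?bd \<longlonglongrightarrow> 0" by simp
  show ?thesis unfolding w_def[symmetric] a_def[symmetric]
  proof (rule Lim_null_comparison[OF _ lim])
    show "\<forall>\<^sub>F n in sequentially. norm (expectation (\<lambda>\<omega>. \<bar>q n v \<omega> - q n w \<omega> - a\<^sup>2\<bar>)) \<le> ?bd n"
      using eventually_ge_at_top[of 1] by eventually_elim (use bd in simp)
  qed
qed

text \<open>J comparisons split q_n(v) - Q(v) into J errors that vanish as n grows and a remainder
  at (A^T)^J v that is small uniformly in n; hence J is fixed before n. The limit enters through the
  Lyapunov identity and a quadratic bound.\<close>

lemma q_law_of_large_numbers:
  assumes Q: "\<And>v. Q v - Q (transpose A *v v) = (v \<bullet> b)\<^sup>2" and QK: "\<And>v. \<bar>Q v\<bar> \<le> KQ * (norm v)\<^sup>2"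
  shows "(\<lambda>n. expectation (\<lambda>\<omega>. \<bar>q n v \<omega> - Q v\<bar>)) \<longlonglongrightarrow> 0"
proof (rule LIMSEQ_I)
  fix r :: real assume r: "r > 0"
  obtain B where B0: "B \<ge> 0" and B: "\<forall>n\<ge>1. sq_int (U n) \<and> nrm (U n) \<le> B" using U_bounded by blast
  note Ui = U_inner[OF B]
  let ?T = "\<lambda>j. ((*v) (transpose A) ^^ j) v"
  have "(\<lambda>j. (B\<^sup>2 + KQ) * (C * \<rho> ^ j * norm v)\<^sup>2) \<longlonglongrightarrow> (B\<^sup>2 + KQ) * (C * 0 * norm v)\<^sup>2"
    using \<rho> by (intro tendsto_mult tendsto_power tendsto_const LIMSEQ_power_zero) auto
  then have "(\<lambda>j. (B\<^sup>2 + KQ) * (C * \<rho> ^ j * norm v)\<^sup>2) \<longlonglongrightarrow> 0" by simp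
  from order_tendstoD(2)[OF this, of "r / 2"] obtain J where J: "(B\<^sup>2 + KQ) * (C * \<rho> ^ J * norm v)\<^sup>2 < r / 2"
    using r by (auto simp: eventually_at_top_linorder)
  \<comment> \<open>\<open>KQ \<ge> 0\<close> comes from evaluating the bound on \<open>Q\<close> at
    a unit vector.\<close>
  have K0: "B\<^sup>2 + KQ \<ge> 0" 
    using QK[of "axis undefined 1"] abs_ge_zero[of "Q (axis undefined 1)"] zero_le_power2[of B]
    by (simp add: norm_axis_1)
  define D where "D n j \<omega> = q n (?T j) \<omega> - q n (?T (Suc j)) \<omega> - (?T j \<bullet> b)\<^sup>2" for n j \<omega>
  have Dint: "integrable M (D n j)" for n j
    unfolding D_def[abs_def] by (intro Bochner_Integration.integrable_diff q_integrable integrable_const)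
  have tele: "q n v \<omega> - Q v = (\<Sum>j<J. D n j \<omega>) + (q n (?T J) \<omega> - Q (?T J))" for n \<omega>
  proof (induction J)
    case (Suc J)
    then show ?case using Q[of "?T J"] by (simp add: D_def del: transpose_matrix_vector)
  qed simp
  have bound: "expectation (\<lambda>\<omega>. \<bar>q n v \<omega> - Q v\<bar>) \<le> (\<Sum>j<J. expectation (\<lambda>\<omega>. \<bar>D n j \<omega>\<bar>)) + (B\<^sup>2 + KQ) * (C * \<rho> ^ J * norm v)\<^sup>2"
    if n: "n \<ge> 1" for n
  proof -
    have q0: "q n x \<omega> \<ge> 0" for x \<omega> by (simp add: q_def sum_nonneg)
    have Eq: "expectation (q n x) \<le> (norm x * B)\<^sup>2" for x
    proof -
      have "expectation (q n x) = (\<Sum>i=1..n. expectation (\<lambda>\<omega>. (x \<bullet> U i \<omega>)\<^sup>2)) / real n"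
        unfolding q_def using Ui(3) by (subst Bochner_Integration.integral_divide_zero, subst Bochner_Integration.integral_sum) auto
      also have "\<dots> \<le> (\<Sum>i=1..n. (norm x * B)\<^sup>2) / real n"
        by (intro divide_right_mono sum_mono Ui(4)) auto
      also have "\<dots> = (norm x * B)\<^sup>2" using n by simp
      finally show ?thesis .
    qed
    let ?x = "?T J"
    have "expectation (\<lambda>\<omega>. \<bar>q n v \<omega> - Q v\<bar>) \<le> expectation (\<lambda>\<omega>. \<bar>\<Sum>j<J. D n j \<omega>\<bar> + (q n ?x \<omega> + KQ * (norm ?x)\<^sup>2))"
    proof (rule integral_mono)
      show "integrable M (\<lambda>\<omega>. \<bar>q n v \<omega> - Q v\<bar>)"
        by (intro integrable_abs Bochner_Integration.integrable_diff q_integrable integrable_const)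
      show "integrable M (\<lambda>\<omega>. \<bar>\<Sum>j<J. D n j \<omega>\<bar> + (q n ?x \<omega> + KQ * (norm ?x)\<^sup>2))"
        by (intro Bochner_Integration.integrable_add integrable_abs Bochner_Integration.integrable_sum Dint q_integrable integrable_const)
      show "\<bar>q n v \<omega> - Q v\<bar> \<le> \<bar>\<Sum>j<J. D n j \<omega>\<bar> + (q n ?x \<omega> + KQ * (norm ?x)\<^sup>2)" for \<omega>
        unfolding tele using QK[of ?x] q0[of ?x \<omega>] by linarith
    qed
    also have "\<dots> = expectation (\<lambda>\<omega>. \<bar>\<Sum>j<J. D n j \<omega>\<bar>) + (expectation (q n ?x) + KQ * (norm ?x)\<^sup>2)"
      using q_integrable Dint
      by (subst Bochner_Integration.integral_add) (auto simp: prob_space intro!: Bochner_Integration.integrable_add)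
    also have "\<dots> \<le> (\<Sum>j<J. expectation (\<lambda>\<omega>. \<bar>D n j \<omega>\<bar>)) + ((norm ?x * B)\<^sup>2 + KQ * (norm ?x)\<^sup>2)"
      by (intro add_mono integral_abs_sum_le Dint Eq) auto
    also have "(norm ?x * B)\<^sup>2 + KQ * (norm ?x)\<^sup>2 = (B\<^sup>2 + KQ) * (norm ?x)\<^sup>2"
      by (simp add: power_mult_distrib algebra_simps)
    also have "(B\<^sup>2 + KQ) * (norm ?x)\<^sup>2 \<le> (B\<^sup>2 + KQ) * (C * \<rho> ^ J * norm v)\<^sup>2"
      using matrix_decay_transpose[OF decay, of J v] K0 by (intro mult_left_mono power_mono) auto
    finally show ?thesis by simp
  qed
  have "(\<lambda>n. \<Sum>j<J. expectation (\<lambda>\<omega>. \<bar>D n j \<omega>\<bar>)) \<longlonglongrightarrow> (\<Sum>j<J. 0)"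
    unfolding D_def using q_step by (intro tendsto_sum) (simp del: transpose_matrix_vector)
  then have "(\<lambda>n. \<Sum>j<J. expectation (\<lambda>\<omega>. \<bar>D n j \<omega>\<bar>)) \<longlonglongrightarrow> 0" by simp
  from order_tendstoD(2)[OF this, of "r / 2"] r
  obtain N where N: "\<And>n. n \<ge> N \<Longrightarrow> (\<Sum>j<J. expectation (\<lambda>\<omega>. \<bar>D n j \<omega>\<bar>)) < r / 2"
    by (auto simp: eventually_at_top_linorder)
  show "\<exists>N. \<forall>n\<ge>N. norm (expectation (\<lambda>\<omega>. \<bar>q n v \<omega> - Q v\<bar>) - 0) < r"
  proof (intro exI allI impI)
    fix n assume "n \<ge> max N 1"
    then show "norm (expectation (\<lambda>\<omega>. \<bar>q n v \<omega> - Q v\<bar>) - 0) < r"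
      using bound[of n] N[of n] J by simp
  qed
qed

end

section \<open>The central limit theorem\<close>

lemma (in prob_space) tight_single:
  fixes H :: "'a \<Rightarrow> 'b::euclidean_space"
  assumes [measurable]: "H \<in> borel_measurable M" and e: "e > 0"
  shows "\<exists>K>0. prob {\<omega>\<in>space M. norm (H \<omega>) > K} \<le> e"
proof -
  let ?A = "\<lambda>n::nat. {\<omega>\<in>space M. norm (H \<omega>) > real n}"
  have "(\<lambda>n. prob (?A n)) \<longlonglongrightarrow> prob (\<Inter>n. ?A n)"
    by (intro finite_Lim_measure_decseq) (auto simp: decseq_def)
  moreover have "(\<Inter>n. ?A n) = {}"
  proof safe
    fix \<omega> assume \<omega>: "\<omega> \<in> (\<Inter>n. ?A n)"
    obtain n where "norm (H \<omega>) < real n" using reals_Archimedean2 by blast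
    then show "\<omega> \<in> {}" using \<omega> by (auto dest!: spec[of _ n])
  qed
  ultimately have "(\<lambda>n. prob (?A n)) \<longlonglongrightarrow> 0" by simp
  from order_tendstoD(2)[OF this e] obtain N where "\<And>n. n \<ge> N \<Longrightarrow> prob (?A n) < e"
    by (auto simp: eventually_at_top_linorder)
  from this[of "Suc N"] show ?thesis by (intro exI[of _ "real (Suc N)"]) auto
qed

lemma (in prob_space) chebyshev_nrm:
  assumes "sq_int X" "nrm X \<le> B" "K > 0"
  shows "prob {\<omega>\<in>space M. norm (X \<omega>) > K} \<le> B\<^sup>2 / K\<^sup>2"
proof -
  note [measurable] = sq_intD(1)[OF assms(1)]
  let ?A = "{\<omega>\<in>space M. norm (X \<omega>) > K}"
  have "K\<^sup>2 * prob ?A = expectation (\<lambda>\<omega>. K\<^sup>2 * indicat_real ?A \<omega>)" by simp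
  also have "\<dots> \<le> expectation (\<lambda>\<omega>. (norm (X \<omega>))\<^sup>2)"
  proof (rule integral_mono)
    fix \<omega>
    show "K\<^sup>2 * indicat_real ?A \<omega> \<le> (norm (X \<omega>))\<^sup>2"
      using assms(3) by (auto simp: indicator_def intro: power_mono)
  qed (use sq_intD(2)[OF assms(1)] in \<open>auto simp: emeasure_eq_measure\<close>)
  also have "\<dots> \<le> B\<^sup>2" unfolding nrm_sq[symmetric] using assms(2) by (intro power_mono) auto
  finally show ?thesis using assms(3) by (simp add: pos_le_divide_eq mult.commute)
qed

text \<open>The threshold matches the event q_n(v) \<le> c + 1, on which (q_n(v) - c) / 2 \<le>
  1/2.\<close>

lemma abs_one_minus_exp_le:
  assumes "x \<le> (1/2 :: real)"
  shows "\<bar>1 - exp x\<bar> \<le> 2 * \<bar>x\<bar>"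
proof (cases "x \<ge> 0")
  case True
  have "exp x \<le> 1 + x + x\<^sup>2" using exp_bound[of x] True assms by simp
  moreover have "x\<^sup>2 \<le> x" using True assms mult_left_mono[of x 1 x] by (simp add: power2_eq_square)
  moreover have "exp x \<ge> 1" using True by simp
  ultimately show ?thesis using True by simp
next
  case False
  then have "exp x \<le> 1" by simp
  then have "\<bar>1 - exp x\<bar> = 1 - exp x" by simp
  also have "\<dots> \<le> - x" using exp_ge_add_one_self[of x] by linarith
  also have "\<dots> \<le> 2 * \<bar>x\<bar>" using False by simp
  finally show ?thesis .
qed

section \<open>Exponential martingales\<close>

context innovation_ar
begin

lemma eps_cf: "n \<ge> 1 \<Longrightarrow> expectation (\<lambda>\<omega>. cis (\<epsilon> n \<omega> * t)) = complex_of_real (exp (- t\<^sup>2 / 2))"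
proof -
  assume n: "n \<ge> 1"
  have "expectation (\<lambda>\<omega>. cis (\<epsilon> n \<omega> * t)) = integral\<^sup>L std_normal_distribution (\<lambda>x. cis (x * t))"
    by (rule eps_integral(2)[OF n]) measurable
  also have "\<dots> = char std_normal_distribution t"
    by (simp add: char_def cis_conv_exp mult.commute)
  finally show ?thesis by (simp add: char_std_normal_distribution)
qed

text \<open>Given the past, \<epsilon>_n g has mean exponential exp(- g^2 / 2), which the extra
  factor cancels. Conditioning is carried out by Fubini on the product of the laws of (g, L) and of
  \<epsilon>_n; the bound gives integrability.\<close>

lemma conditional_cf:
  assumes n: "n \<ge> 1" and g: "g \<in> borel_measurable (past M \<epsilon> n)" and L: "L \<in> borel_measurable (past M \<epsilon> n)"
    and bd: "\<And>\<omega>. cmod (L \<omega>) * exp ((g \<omega>)\<^sup>2 / 2) \<le> K"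
  shows "expectation (\<lambda>\<omega>. L \<omega> * (cis (\<epsilon> n \<omega> * g \<omega>) * complex_of_real (exp ((g \<omega>)\<^sup>2 / 2)))) = expectation L"
proof -
  define \<Phi> where "\<Phi> \<omega> = (g \<omega>, L \<omega>)" for \<omega>
  \<comment> \<open>The zero component gives both variables the same type, as
    \<open>indep_var\<close> requires.\<close>
  define \<Psi> where "\<Psi> \<omega> = (\<epsilon> n \<omega>, 0 :: complex)" for \<omega>
  have "\<Phi> \<in> borel_measurable (past M \<epsilon> n)" unfolding \<Phi>_def[abs_def] using g L by measurable
  from indep_var_past[OF eps_indep[OF n] n this, of "\<lambda>x. (x, 0)" borel]
  have ind: "indep_var borel \<Phi> borel \<Psi>" unfolding \<Psi>_def[abs_def] by simp
  then have m[measurable]: "\<Phi> \<in> borel_measurable M" "\<Psi> \<in> borel_measurable M"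
    by (auto dest: indep_var_rv1 indep_var_rv2)
  define N1 N2 where "N1 = distr M borel \<Phi>" and "N2 = distr M borel \<Psi>"
  have pair: "N1 \<Otimes>\<^sub>M N2 = distr M (borel \<Otimes>\<^sub>M borel) (\<lambda>\<omega>. (\<Phi> \<omega>, \<Psi> \<omega>))"
    using ind by (simp add: indep_var_distribution_eq N1_def N2_def)
  interpret N1: prob_space N1 unfolding N1_def by (rule prob_space_distr) simp
  interpret N2: prob_space N2 unfolding N2_def by (rule prob_space_distr) simp
  interpret P: pair_prob_space N1 N2 ..
  define F :: "(real \<times> complex) \<times> (real \<times> complex) \<Rightarrow> complex" where
    "F z = snd (fst z) * (cis (fst (snd z) * fst (fst z)) * complex_of_real (exp ((fst (fst z))\<^sup>2 / 2)))" for z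
  have contF: "continuous_on UNIV F"
    unfolding F_def[abs_def] cis_conv_exp by (intro continuous_intros) auto
  have F[measurable]: "F \<in> borel_measurable (borel \<Otimes>\<^sub>M borel)"
    unfolding borel_prod by (rule borel_measurable_continuous_onI[OF contF])
  have mF: "(\<lambda>\<omega>. F (\<Phi> \<omega>, \<Psi> \<omega>)) \<in> borel_measurable M" by measurable
  have "integrable M (\<lambda>\<omega>. F (\<Phi> \<omega>, \<Psi> \<omega>))"
    by (rule integrable_const_bound[OF _ mF, where B=K]) (use bd in \<open>simp add: F_def \<Phi>_def norm_mult\<close>)
  then have intF: "integrable (N1 \<Otimes>\<^sub>M N2) F" unfolding pair by (simp add: integrable_distr_eq)
  have "expectation (\<lambda>\<omega>. F (\<Phi> \<omega>, \<Psi> \<omega>)) = integral\<^sup>L (N1 \<Otimes>\<^sub>M N2) F"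
    unfolding pair by (simp add: integral_distr)
  also have "\<dots> = (\<integral>x. (\<integral>y. F (x, y) \<partial>N2) \<partial>N1)" by (rule P.integral_fst'[OF intF, symmetric])
  also have "(\<lambda>x. \<integral>y. F (x, y) \<partial>N2) = snd"
  proof
    fix x :: "real \<times> complex"
    have [measurable]: "(\<lambda>y. F (x, y)) \<in> borel_measurable borel"
      by (intro borel_measurable_continuous_onI continuous_on_compose2[OF contF] continuous_intros) auto
    have "(\<integral>y. F (x, y) \<partial>N2) = expectation (\<lambda>\<omega>. F (x, \<Psi> \<omega>))"
      unfolding N2_def by (rule integral_distr) measurable
    also have "\<dots> = expectation (\<lambda>\<omega>. snd x * complex_of_real (exp ((fst x)\<^sup>2 / 2)) * cis (\<epsilon> n \<omega> * fst x))"
      by (simp add: F_def \<Psi>_def mult_ac)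
    also have "\<dots> = snd x * complex_of_real (exp ((fst x)\<^sup>2 / 2)) * complex_of_real (exp (- (fst x)\<^sup>2 / 2))"
      using eps_cf[OF n, of "fst x"] by simp
    also have "\<dots> = snd x * complex_of_real (exp ((fst x)\<^sup>2 / 2) * exp (- (fst x)\<^sup>2 / 2))" by (simp only: of_real_mult mult.assoc)
    also have "\<dots> = snd x" by (simp flip: exp_add)
    finally show "(\<integral>y. F (x, y) \<partial>N2) = snd x" .
  qed
  also have "integral\<^sup>L N1 snd = expectation L"
  proof -
    have "(snd :: real \<times> complex \<Rightarrow> complex) \<in> borel_measurable borel"
      by (intro borel_measurable_continuous_onI continuous_on_snd continuous_on_id)
    from integral_distr[OF m(1) this] show ?thesis unfolding N1_def by (simp add: \<Phi>_def)
  qed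
  finally show ?thesis by (simp add: F_def \<Phi>_def \<Psi>_def)
qed

text \<open>The bound on the sums of squares keeps the exponential bounded at every step. The lemma
  serves twice: for the stopped score, and with deterministic coefficients for the limit
  vector.\<close>

lemma exponential_martingale:
  assumes g: "\<And>i. i \<ge> 1 \<Longrightarrow> g i \<in> borel_measurable (past M \<epsilon> i)"
    and K: "\<And>\<omega> m. (\<Sum>i=1..m. (g i \<omega>)\<^sup>2) \<le> K"
  shows "expectation (\<lambda>\<omega>. cis (\<Sum>i=1..m. \<epsilon> i \<omega> * g i \<omega>) * complex_of_real (exp ((\<Sum>i=1..m. (g i \<omega>)\<^sup>2) / 2))) = 1"
proof (induction m)
  case 0
  then show ?case by (simp add: prob_space)
next
  case (Suc m)
  define L where "L \<omega> = cis (\<Sum>i=1..m. \<epsilon> i \<omega> * g i \<omega>) * complex_of_real (exp ((\<Sum>i=1..m. (g i \<omega>)\<^sup>2) / 2))" for \<omega>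
  have [measurable]: "g i \<in> borel_measurable (past M \<epsilon> (Suc m))" "\<epsilon> i \<in> borel_measurable (past M \<epsilon> (Suc m))"
    if "i \<in> {1..m}" for i
    using that measurable_past_mono[where n="Suc m", OF _ g[of i]] measurable_past_component[of i "Suc m" \<epsilon> M] by auto
  have L: "L \<in> borel_measurable (past M \<epsilon> (Suc m))" unfolding L_def[abs_def] by measurable
  have "expectation (\<lambda>\<omega>. L \<omega> * (cis (\<epsilon> (Suc m) \<omega> * g (Suc m) \<omega>) * complex_of_real (exp ((g (Suc m) \<omega>)\<^sup>2 / 2)))) = expectation L"
  proof (rule conditional_cf[OF _ g L])
    fix \<omega>
    have "cmod (L \<omega>) * exp ((g (Suc m) \<omega>)\<^sup>2 / 2) = exp ((\<Sum>i=1..Suc m. (g i \<omega>)\<^sup>2) / 2)"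
      by (simp add: L_def norm_mult add_divide_distrib exp_add)
    also have "\<dots> \<le> exp (K / 2)" using K[of \<omega> "Suc m"] by simp
    finally show "cmod (L \<omega>) * exp ((g (Suc m) \<omega>)\<^sup>2 / 2) \<le> exp (K / 2)" .
  qed auto
  moreover have "L \<omega> * (cis (\<epsilon> (Suc m) \<omega> * g (Suc m) \<omega>) * complex_of_real (exp ((g (Suc m) \<omega>)\<^sup>2 / 2))) =
      cis (\<Sum>i=1..Suc m. \<epsilon> i \<omega> * g i \<omega>) * complex_of_real (exp ((\<Sum>i=1..Suc m. (g i \<omega>)\<^sup>2) / 2))" for \<omega>
    by (simp add: L_def add_divide_distrib exp_add cis_mult[symmetric] mult_ac)
  ultimately show ?case using Suc by (simp add: L_def[abs_def])
qed

text \<open>The martingale is stopped before its quadratic variation exceeds \<open>c + 1\<close>; the exponential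
  martingale of the stopped sum then has mean 1, and both the stopping and the deviation of the
  quadratic variation from \<open>c\<close> are controlled by \<open>\<bar>q\<^sub>n(v) - c\<bar>\<close>.\<close>

lemma cf_score_bound:
  assumes n: "n \<ge> 1" and c: "c \<ge> 0"
  shows "cmod (expectation (\<lambda>\<omega>. cis (\<Sum>i=1..n. \<epsilon> i \<omega> * ((v \<bullet> U i \<omega>) / sqrt (real n)))) - complex_of_real (exp (- c / 2)))
    \<le> 3 * expectation (\<lambda>\<omega>. \<bar>q n v \<omega> - c\<bar>)"
proof -
  define w where "w i \<omega> = (v \<bullet> U i \<omega>) / sqrt (real n)" for i \<omega>
  define S where "S m \<omega> = (\<Sum>i=1..m. (w i \<omega>)\<^sup>2)" for m \<omega>
  \<comment> \<open>The test includes the i-th square and still lies in the past of i, because w_i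
    does; so the stopped sum never overshoots c + 1.\<close>
  define g where "g i \<omega> = (if S i \<omega> \<le> c + 1 then w i \<omega> else 0)" for i \<omega>
  define G where "G m \<omega> = (\<Sum>i=1..m. (g i \<omega>)\<^sup>2)" for m \<omega>
  have S_n: "S n \<omega> = q n v \<omega>" for \<omega>
    using n by (simp add: S_def q_def w_def power_divide sum_divide_distrib)
  have S_mono: "i \<le> j \<Longrightarrow> S i \<omega> \<le> S j \<omega>" for i j \<omega>
    unfolding S_def by (intro sum_mono2) auto
  have G_bd: "G m \<omega> \<le> S m \<omega> \<and> G m \<omega> \<le> c + 1" for m \<omega>
  proof (induction m)
    case 0
    then show ?case using c by (simp add: G_def S_def)
  next
    case (Suc m)
    have "G (Suc m) \<omega> = G m \<omega> + (g (Suc m) \<omega>)\<^sup>2" "S (Suc m) \<omega> = S m \<omega> + (w (Suc m) \<omega>)\<^sup>2"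
      by (simp_all add: G_def S_def)
    then show ?case using Suc by (auto simp: g_def)
  qed
  have w_past: "w i \<in> borel_measurable (past M \<epsilon> i)" if "i \<ge> 1" for i
    unfolding w_def[abs_def] using that
    by (intro borel_measurable_divide borel_measurable_inner borel_measurable_const U_past)
  have g_past: "g i \<in> borel_measurable (past M \<epsilon> i)" if i: "i \<ge> 1" for i
  proof -
    have [measurable]: "w j \<in> borel_measurable (past M \<epsilon> i)" if "j \<in> {1..i}" for j
      using measurable_past_mono[OF _ w_past[of j]] that by auto
    have [measurable]: "w i \<in> borel_measurable (past M \<epsilon> i)" by (rule w_past[OF i])
    show ?thesis unfolding g_def[abs_def] S_def by measurable
  qed
  have [measurable]: "w i \<in> borel_measurable M" "g i \<in> borel_measurable M" if "i \<in> {1..n}" for i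
    using that by (auto intro!: past_measurableD[OF w_past] past_measurableD[OF g_past])
  let ?f = "\<lambda>\<omega>. cis (\<Sum>i=1..n. \<epsilon> i \<omega> * w i \<omega>)"
  let ?L = "\<lambda>\<omega>. complex_of_real (exp (- c / 2)) * (cis (\<Sum>i=1..n. \<epsilon> i \<omega> * g i \<omega>) * complex_of_real (exp (G n \<omega> / 2)))"
  have ee: "exp ((x - c) / 2) = exp (- c / 2) * exp (x / 2)" for x :: real
    by (subst exp_add[symmetric]) (simp add: diff_divide_distrib)
  have L_norm: "cmod (?L \<omega>) = exp ((G n \<omega> - c) / 2)" for \<omega>
    unfolding ee by (simp only: norm_mult norm_cis norm_of_real abs_exp_cancel mult_1)
  have L_le: "cmod (?L \<omega>) \<le> 2" for \<omega>
  proof -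
    have "exp ((G n \<omega> - c) / 2) \<le> exp (1/2)" using G_bd[of n \<omega>] by simp
    also have "exp (1/2 :: real) \<le> 2" using exp_bound[of "1/2"] by (simp add: power2_eq_square)
    finally show ?thesis unfolding L_norm .
  qed
  have Lint: "integrable M ?L"
  proof (rule integrable_const_bound[where B=2])
    show "?L \<in> borel_measurable M" unfolding G_def by measurable
  qed (use L_le in simp)
  have fint: "integrable M ?f" by simp
  have EL: "expectation ?L = complex_of_real (exp (- c / 2))"
    using exponential_martingale[OF g_past, of "c + 1" n] G_bd by (simp add: G_def)
  have pt: "cmod (?f \<omega> - ?L \<omega>) \<le> 3 * \<bar>q n v \<omega> - c\<bar>" for \<omega>
  proof (cases "q n v \<omega> \<le> c + 1")
    case True
    then have "S i \<omega> \<le> c + 1" if "i \<in> {1..n}" for i using S_mono[of i n \<omega>] that by (simp add: S_n)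
    then have gw: "g i \<omega> = w i \<omega>" if "i \<in> {1..n}" for i using that by (simp add: g_def)
    have G: "G n \<omega> = q n v \<omega>" unfolding G_def S_n[symmetric] S_def by (intro sum.cong) (auto simp: gw)
    have "(\<Sum>i=1..n. \<epsilon> i \<omega> * g i \<omega>) = (\<Sum>i=1..n. \<epsilon> i \<omega> * w i \<omega>)" by (intro sum.cong) (auto simp: gw)
    then have "?L \<omega> = ?f \<omega> * complex_of_real (exp ((q n v \<omega> - c) / 2))"
      unfolding ee by (simp only: G of_real_mult mult_ac)
    then have "?f \<omega> - ?L \<omega> = ?f \<omega> * complex_of_real (1 - exp ((q n v \<omega> - c) / 2))"
      by (simp add: right_diff_distrib)
    then have "cmod (?f \<omega> - ?L \<omega>) = \<bar>1 - exp ((q n v \<omega> - c) / 2)\<bar>"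
      by (simp only: norm_mult norm_cis norm_of_real mult_1)
    also have "\<dots> \<le> 2 * \<bar>(q n v \<omega> - c) / 2\<bar>" using True by (intro abs_one_minus_exp_le) simp
    also have "\<dots> \<le> 3 * \<bar>q n v \<omega> - c\<bar>" by simp
    finally show ?thesis .
  next
    \<comment> \<open>Here |q_n(v) - c| > 1, so the crude bound 1 + 2 suffices; this is the origin
      of the constant 3.\<close>
    case False
    have "cmod (?f \<omega> - ?L \<omega>) \<le> cmod (?f \<omega>) + cmod (?L \<omega>)" by (rule norm_triangle_ineq4)
    also have "\<dots> \<le> 3" using L_le[of \<omega>] by (simp only: norm_cis)
    also have "\<dots> \<le> 3 * \<bar>q n v \<omega> - c\<bar>" using False by simp
    finally show ?thesis .
  qed
  have "expectation (\<lambda>\<omega>. ?f \<omega> - ?L \<omega>) = expectation ?f - complex_of_real (exp (- c / 2))"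
    using Bochner_Integration.integral_diff[OF fint Lint] by (simp only: EL)
  then have "cmod (expectation ?f - complex_of_real (exp (- c / 2))) = cmod (expectation (\<lambda>\<omega>. ?f \<omega> - ?L \<omega>))"
    by (simp only:)
  also have "\<dots> \<le> expectation (\<lambda>\<omega>. cmod (?f \<omega> - ?L \<omega>))" by (rule integral_norm_bound)
  also have "\<dots> \<le> expectation (\<lambda>\<omega>. 3 * \<bar>q n v \<omega> - c\<bar>)"
  proof (rule integral_mono)
    show "integrable M (\<lambda>\<omega>. cmod (?f \<omega> - ?L \<omega>))"
      by (intro integrable_norm Bochner_Integration.integrable_diff fint Lint)
    show "integrable M (\<lambda>\<omega>. 3 * \<bar>q n v \<omega> - c\<bar>)"
      by (intro integrable_mult_right integrable_abs Bochner_Integration.integrable_diff q_integrable integrable_const)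
  qed (rule pt)
  finally show ?thesis by (simp add: w_def)
qed

text \<open>Realising the limit law on the same probability space avoids a factorisation of the
  covariance matrix.\<close>

definition gauss_vec :: "'w \<Rightarrow> real ^ 'n" where
  "gauss_vec \<omega> = (\<Sum>k. \<epsilon> (Suc k) \<omega> *\<^sub>R ((*v) A ^^ k) b)"

lemma gauss_vec_measurable [measurable]: "gauss_vec \<in> borel_measurable M"
  unfolding gauss_vec_def[abs_def] by measurable

text \<open>E|\<epsilon>_k| \<le> 1 and the decay of A^k b make the expected sum of the norms
  finite, hence almost sure absolute convergence.\<close>

lemma gauss_vec_sums: "AE \<omega> in M. (\<lambda>k. \<epsilon> (Suc k) \<omega> *\<^sub>R ((*v) A ^^ k) b) sums gauss_vec \<omega>"
proof -
  let ?h = "\<lambda>k \<omega>. \<bar>\<epsilon> (Suc k) \<omega>\<bar> * norm (((*v) A ^^ k) b)"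
  have le: "(\<integral>\<^sup>+\<omega>. ennreal (?h k \<omega>) \<partial>M) \<le> ennreal (C * \<rho> ^ k * norm b)" for k
  proof -
    have i: "integrable M (\<lambda>\<omega>. \<bar>\<epsilon> (Suc k) \<omega>\<bar>)" "expectation (\<lambda>\<omega>. \<bar>\<epsilon> (Suc k) \<omega>\<bar>) \<le> 1"
      using sq_int_integrable[OF eps_moments(1)[of "Suc k"]] eps_moments(2)[of "Suc k"] by auto
    have "(\<integral>\<^sup>+\<omega>. ennreal (?h k \<omega>) \<partial>M) = ennreal (expectation (?h k))"
      using i by (intro nn_integral_eq_integral) auto
    also have "expectation (?h k) \<le> 1 * (C * \<rho> ^ k * norm b)"
      using i(2) decay[of k b] by (simp only: integral_mult_left_zero) (intro mult_mono, auto)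
    finally show ?thesis by (simp add: ennreal_leI)
  qed
  have "(\<integral>\<^sup>+\<omega>. (\<Sum>k. ennreal (?h k \<omega>)) \<partial>M) = (\<Sum>k. \<integral>\<^sup>+\<omega>. ennreal (?h k \<omega>) \<partial>M)"
    by (rule nn_integral_suminf) measurable
  also have "\<dots> \<le> (\<Sum>k. ennreal (C * \<rho> ^ k * norm b))" by (intro suminf_le le) auto
  also have "\<dots> < \<infinity>"
  proof -
    have "summable (\<lambda>k. C * \<rho> ^ k * norm b)"
      using \<rho> by (intro summable_mult2 summable_mult summable_geometric) auto
    then show ?thesis using C \<rho> by (subst suminf_ennreal2) (auto simp: less_top[symmetric])
  qed
  finally have "AE \<omega> in M. (\<Sum>k. ennreal (?h k \<omega>)) \<noteq> \<infinity>"
    by (intro nn_integral_noteq_infinite) (auto simp: less_top[symmetric])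
  then show ?thesis
  proof eventually_elim
    case (elim \<omega>)
    have "summable (\<lambda>k. ?h k \<omega>)"
      by (rule summable_suminf_not_top) (use elim in auto)
    then have "summable (\<lambda>k. norm (\<epsilon> (Suc k) \<omega> *\<^sub>R ((*v) A ^^ k) b))" by simp
    from summable_norm_cancel[OF this] show ?case
      unfolding gauss_vec_def by (rule summable_sums)
  qed
qed

lemma gauss_vec_cf:
  assumes Q: "(\<lambda>k. (v \<bullet> ((*v) A ^^ k) b) * (v \<bullet> ((*v) A ^^ k) b)) sums Q"
  shows "expectation (\<lambda>\<omega>. cis (v \<bullet> gauss_vec \<omega>)) = complex_of_real (exp (- Q / 2))"
proof (rule LIMSEQ_unique)
  let ?a = "\<lambda>k. v \<bullet> ((*v) A ^^ k) b"
  let ?X = "\<lambda>m \<omega>. \<Sum>k<m. \<epsilon> (Suc k) \<omega> * ?a k"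
  show "(\<lambda>m. expectation (\<lambda>\<omega>. cis (?X m \<omega>))) \<longlonglongrightarrow> expectation (\<lambda>\<omega>. cis (v \<bullet> gauss_vec \<omega>))"
  proof (rule integral_dominated_convergence[where w="\<lambda>_. 1"])
    show "AE \<omega> in M. (\<lambda>m. cis (?X m \<omega>)) \<longlonglongrightarrow> cis (v \<bullet> gauss_vec \<omega>)"
      using gauss_vec_sums
    proof eventually_elim
      case (elim \<omega>)
      have "(\<lambda>m. v \<bullet> (\<Sum>k<m. \<epsilon> (Suc k) \<omega> *\<^sub>R ((*v) A ^^ k) b)) \<longlonglongrightarrow> v \<bullet> gauss_vec \<omega>"
        using elim unfolding sums_def by (intro tendsto_inner tendsto_const)
      then have "(\<lambda>m. ?X m \<omega>) \<longlonglongrightarrow> v \<bullet> gauss_vec \<omega>" by (simp add: inner_sum_right)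
      then show ?case by (intro tendsto_cis)
    qed
  qed auto
  have "expectation (\<lambda>\<omega>. cis (?X m \<omega>)) = complex_of_real (exp (- (\<Sum>k<m. ?a k * ?a k) / 2))" for m
  proof -
    \<comment> \<open>Cut off after m, so that the sums of squares are bounded for every length, as
      \<open>exponential_martingale\<close> asks.\<close>
    define g where "g i \<omega> = (if i \<le> m then ?a (i - 1) else 0)" for i :: nat and \<omega> :: 'w
    have sh: "(\<Sum>i=1..m. f (i - 1)) = (\<Sum>k<m. f k)" for f :: "nat \<Rightarrow> real"
      by (rule sum.reindex_bij_witness[of _ Suc "\<lambda>i. i - 1"]) auto
    have G: "(\<Sum>i=1..m. (g i \<omega>)\<^sup>2) = (\<Sum>k<m. ?a k * ?a k)" for \<omega>
      using sh[of "\<lambda>k. ?a k * ?a k"] by (simp add: g_def power2_eq_square)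
    have X: "(\<Sum>i=1..m. \<epsilon> i \<omega> * g i \<omega>) = ?X m \<omega>" for \<omega>
    proof -
      have "(\<Sum>i=1..m. \<epsilon> i \<omega> * g i \<omega>) = (\<Sum>i=1..m. \<epsilon> (Suc (i - 1)) \<omega> * ?a (i - 1))"
        by (intro sum.cong refl) (auto simp: g_def)
      then show ?thesis using sh[of "\<lambda>k. \<epsilon> (Suc k) \<omega> * ?a k"] by simp
    qed
    have bd: "(\<Sum>i=1..j. (g i \<omega>)\<^sup>2) \<le> (\<Sum>k<m. ?a k * ?a k)" for j \<omega>
    proof -
      have "(\<Sum>i=1..j. (g i \<omega>)\<^sup>2) = (\<Sum>i\<in>{1..j} \<inter> {1..m}. (g i \<omega>)\<^sup>2)"
        by (rule sum.mono_neutral_right) (auto simp: g_def)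
      also have "\<dots> \<le> (\<Sum>i=1..m. (g i \<omega>)\<^sup>2)" by (rule sum_mono2) auto
      finally show ?thesis by (simp only: G)
    qed
    have "expectation (\<lambda>\<omega>. cis (?X m \<omega>) * complex_of_real (exp ((\<Sum>k<m. ?a k * ?a k) / 2))) = 1"
    proof -
      have "expectation (\<lambda>\<omega>. cis (\<Sum>i=1..m. \<epsilon> i \<omega> * g i \<omega>) * complex_of_real (exp ((\<Sum>i=1..m. (g i \<omega>)\<^sup>2) / 2))) = 1"
        by (rule exponential_martingale[OF _ bd]) (simp add: g_def[abs_def])
      then show ?thesis unfolding X G .
    qed
    then have "expectation (\<lambda>\<omega>. cis (?X m \<omega>)) * complex_of_real (exp ((\<Sum>k<m. ?a k * ?a k) / 2)) = 1" by simp
    then show ?thesis by (simp add: exp_minus field_simps)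
  qed
  moreover have "(\<lambda>m. complex_of_real (exp (- (\<Sum>k<m. ?a k * ?a k) / 2))) \<longlonglongrightarrow> complex_of_real (exp (- Q / 2))"
    using Q unfolding sums_def by (intro tendsto_of_real tendsto_exp tendsto_divide tendsto_minus tendsto_const) auto
  ultimately show "(\<lambda>m. expectation (\<lambda>\<omega>. cis (?X m \<omega>))) \<longlonglongrightarrow> complex_of_real (exp (- Q / 2))" by simp
qed

text \<open>Characteristic functions converge by the law of large numbers for q. Tightness is
  Chebyshev's inequality: each coordinate of the normalised score is a martingale sum bounded in
  L^2.\<close>

lemma martingale_clt:
  fixes f :: "real ^ 'n \<Rightarrow> real" and Q :: "real ^ 'n \<Rightarrow> real"
  assumes Q: "\<And>v. (\<lambda>k. (v \<bullet> ((*v) A ^^ k) b) * (v \<bullet> ((*v) A ^^ k) b)) sums Q v"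
    and lln: "\<And>v. (\<lambda>n. expectation (\<lambda>\<omega>. \<bar>q n v \<omega> - Q v\<bar>)) \<longlonglongrightarrow> 0"
    and f: "continuous_on UNIV f" "\<And>x. \<bar>f x\<bar> \<le> K"
  shows "(\<lambda>n. expectation (\<lambda>\<omega>. f ((1 / sqrt (real n)) *\<^sub>R (\<Sum>i=1..n. \<epsilon> i \<omega> *\<^sub>R U i \<omega>)))) \<longlonglongrightarrow>
    expectation (\<lambda>\<omega>. f (gauss_vec \<omega>))"
proof -
  let ?G = "\<lambda>n \<omega>. (1 / sqrt (real n)) *\<^sub>R (\<Sum>i=1..n. \<epsilon> i \<omega> *\<^sub>R U i \<omega>)"
  have Um: "U i \<in> borel_measurable M" if "i \<in> {1..n}" for i n
    using past_measurableD[OF U_past, of i] that by simp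
  have Gm: "?G n \<in> borel_measurable M" for n
    by (intro borel_measurable_scaleR borel_measurable_const borel_measurable_sum eps_measurable Um)
  have vG: "v \<bullet> ?G n \<omega> = (\<Sum>i=1..n. \<epsilon> i \<omega> * ((v \<bullet> U i \<omega>) / sqrt (real n)))" for v n \<omega>
    by (simp add: inner_sum_right sum_divide_distrib)
  have Q0: "Q v \<ge> 0" for v by (rule sums_le[OF _ sums_zero Q]) simp
  have cf: "(\<lambda>n. expectation (\<lambda>\<omega>. cis (v \<bullet> ?G n \<omega>))) \<longlonglongrightarrow> expectation (\<lambda>\<omega>. cis (v \<bullet> gauss_vec \<omega>))" for v
  proof -
    have "(\<lambda>n. 3 * expectation (\<lambda>\<omega>. \<bar>q n v \<omega> - Q v\<bar>)) \<longlonglongrightarrow> 0"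
      using tendsto_mult_right_zero[OF lln] by simp
    then have "(\<lambda>n. expectation (\<lambda>\<omega>. cis (v \<bullet> ?G n \<omega>)) - complex_of_real (exp (- Q v / 2))) \<longlonglongrightarrow> 0"
    proof (rule Lim_null_comparison[rotated])
      show "\<forall>\<^sub>F n in sequentially. norm (expectation (\<lambda>\<omega>. cis (v \<bullet> ?G n \<omega>)) - complex_of_real (exp (- Q v / 2)))
          \<le> 3 * expectation (\<lambda>\<omega>. \<bar>q n v \<omega> - Q v\<bar>)"
        using eventually_ge_at_top[of 1]
        by eventually_elim (unfold vG, rule cf_score_bound, use Q0 in auto)
    qed
    then show ?thesis unfolding gauss_vec_cf[OF Q] by (simp only: LIM_zero_iff)
  qed
  obtain B where B0: "B \<ge> 0" and B: "\<forall>n\<ge>1. sq_int (U n) \<and> nrm (U n) \<le> B" using U_bounded by blast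
  let ?D = "(\<Sum>i\<in>(Basis :: (real ^ 'n) set). B)"
  have G: "sq_int (?G n) \<and> nrm (?G n) \<le> ?D" for n
  proof -
    have comp: "sq_int (\<lambda>\<omega>. (e \<bullet> ?G n \<omega>) *\<^sub>R e) \<and> nrm (\<lambda>\<omega>. (e \<bullet> ?G n \<omega>) *\<^sub>R e) \<le> B" if e: "e \<in> Basis" for e
    proof -
      have ms: "sq_int (\<lambda>\<omega>. \<Sum>i=1..n. \<epsilon> i \<omega> * (e \<bullet> U i \<omega>)) \<and>
          nrm (\<lambda>\<omega>. \<Sum>i=1..n. \<epsilon> i \<omega> * (e \<bullet> U i \<omega>)) \<le> sqrt (real n) * (1 * B)"
      proof (rule martingale_sum_bound[of "\<lambda>i \<omega>. e \<bullet> U i \<omega>" B "\<lambda>x. x" 1 n])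
        fix i :: nat assume i: "i \<ge> 1"
        show "sq_int (\<lambda>\<omega>. \<epsilon> i \<omega>)" "expectation (\<lambda>\<omega>. \<epsilon> i \<omega>) = 0" "nrm (\<lambda>\<omega>. \<epsilon> i \<omega>) \<le> 1"
          using eps_moments(1-3)[OF i] by simp_all
        show "(\<lambda>\<omega>. e \<bullet> U i \<omega>) \<in> borel_measurable (past M \<epsilon> i)"
          by (intro borel_measurable_inner borel_measurable_const U_past i)
        show "sq_int (\<lambda>\<omega>. e \<bullet> U i \<omega>)" "nrm (\<lambda>\<omega>. e \<bullet> U i \<omega>) \<le> B"
          using U_inner(1,2)[OF B i, of e] e by simp_all
      qed simp
      then have s: "sq_int (\<lambda>\<omega>. \<Sum>i=1..n. \<epsilon> i \<omega> * (e \<bullet> U i \<omega>))" by blast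
      have eG: "(\<lambda>\<omega>. e \<bullet> ?G n \<omega>) = (\<lambda>\<omega>. (1 / sqrt (real n)) *\<^sub>R (\<Sum>i=1..n. \<epsilon> i \<omega> * (e \<bullet> U i \<omega>)))"
        by (simp add: inner_sum_right)
      have "sq_int (\<lambda>\<omega>. e \<bullet> ?G n \<omega>)" "nrm (\<lambda>\<omega>. e \<bullet> ?G n \<omega>) \<le> \<bar>1 / sqrt (real n)\<bar> * (sqrt (real n) * B)"
        unfolding eG using sq_int_scaleR[OF s, of "1 / sqrt (real n)"] ms
          mult_left_mono[OF conjunct2[OF ms], of "\<bar>1 / sqrt (real n)\<bar>"] by auto
      moreover have "\<bar>1 / sqrt (real n)\<bar> * (sqrt (real n) * B) \<le> B"
        using B0 by (cases "n = 0") auto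
      ultimately have "sq_int (\<lambda>\<omega>. e \<bullet> ?G n \<omega>)" "nrm (\<lambda>\<omega>. e \<bullet> ?G n \<omega>) \<le> B" by auto
      then show ?thesis using sq_int_scale_vec[of "\<lambda>\<omega>. e \<bullet> ?G n \<omega>" e] e by auto
    qed
    have "?G n = (\<lambda>\<omega>. \<Sum>e\<in>Basis. (e \<bullet> ?G n \<omega>) *\<^sub>R e)"
      by (rule ext) (subst inner_commute, rule euclidean_representation[symmetric])
    moreover have "sq_int (\<lambda>\<omega>. \<Sum>e\<in>Basis. (e \<bullet> ?G n \<omega>) *\<^sub>R e) \<and>
        nrm (\<lambda>\<omega>. \<Sum>e\<in>Basis. (e \<bullet> ?G n \<omega>) *\<^sub>R e) \<le> (\<Sum>e\<in>Basis. nrm (\<lambda>\<omega>. (e \<bullet> ?G n \<omega>) *\<^sub>R e))"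
      by (rule sq_int_sum) (use comp in auto)
    moreover have "(\<Sum>e\<in>Basis. nrm (\<lambda>\<omega>. (e \<bullet> ?G n \<omega>) *\<^sub>R e)) \<le> ?D"
      by (intro sum_mono) (use comp in auto)
    ultimately show ?thesis by (metis (no_types, lifting) order_trans)
  qed
  have tight: "\<exists>K>0. \<forall>n. prob {\<omega>\<in>space M. norm (?G n \<omega>) > K} \<le> e" if e: "e > 0" for e
  proof -
    \<comment> \<open>Chebyshev bounds the probability by D^2 / K^2 \<le> e; the summand 1 keeps K
      positive when D = 0.\<close>
    define K where "K = sqrt ((?D\<^sup>2 + 1) / e)"
    have K: "K > 0" "K\<^sup>2 = (?D\<^sup>2 + 1) / e" using e by (auto simp: K_def intro!: divide_pos_pos add_nonneg_pos)
    have "?D\<^sup>2 / K\<^sup>2 \<le> e" unfolding K(2) using e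
      by (simp add: divide_le_eq mult_left_le add_nonneg_pos) 
    then have "prob {\<omega>\<in>space M. norm (?G n \<omega>) > K} \<le> e" for n
      using chebyshev_nrm[OF conjunct1[OF G] conjunct2[OF G] K(1), of n] by (rule order_trans[rotated])
    then show ?thesis using K(1) by blast
  qed
  show ?thesis by (rule cramer_wold[OF Gm gauss_vec_measurable cf tight tight_single[OF gauss_vec_measurable] f])
qed

end

section \<open>The likelihood of the autoregressive model\<close>

lemma pos_strict_mono: "i < j \<Longrightarrow> pos i < pos j"
  unfolding pos_def by (intro psubset_card_mono) auto

lemma inj_pos: "inj pos"
  by (metis injI linorder_neqE pos_strict_mono less_irrefl)

lemma range_pos: "range (pos :: 'p::{finite,linorder} \<Rightarrow> nat) = {1..CARD('p)}"
proof (rule card_subset_eq)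
  show "range (pos :: 'p \<Rightarrow> nat) \<subseteq> {1..CARD('p)}"
    using pos_pos by (auto simp: pos_def Suc_le_eq card_mono)
  show "card (range (pos :: 'p \<Rightarrow> nat)) = card {1..CARD('p)}"
    by (simp add: card_image inj_pos)
qed simp

lemma pos_pred:
  assumes "pos (i :: 'p::{finite,linorder}) \<noteq> 1"
  obtains j :: "'p::{finite,linorder}" where "pos i = pos j + 1"
proof -
  have "pos i \<in> {1..CARD('p)}" unfolding range_pos[symmetric] by simp
  then have "pos i - 1 \<in> range (pos :: 'p \<Rightarrow> nat)" using assms unfolding range_pos by auto
  then obtain j :: 'p where "pos i - 1 = pos j" by blast
  moreover have "pos i = Suc (pos i - 1)" using pos_pos[of i] by simp
  ultimately show thesis using that[of j] by simp
qed

lemma pos_first: obtains i :: "'p::{finite,linorder}" where "pos i = 1"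
proof -
  have "1 \<in> range (pos :: 'p \<Rightarrow> nat)" unfolding range_pos by (simp add: Suc_le_eq)
  then show thesis using that by (metis imageE)
qed

lemma first_unit_axis: "pos i = 1 \<Longrightarrow> first_unit = axis i 1"
  using inj_eq[OF inj_pos, of _ i] by (auto simp: first_unit_def axis_def vec_eq_iff)

lemma first_unit_inner_self: "first_unit \<bullet> first_unit = 1"
proof -
  obtain i :: 'a where "pos i = 1" by (rule pos_first)
  then show ?thesis by (simp add: first_unit_axis inner_axis)
qed

text \<open>The first row of the companion matrix is \<theta>; through it the parameter enters the
  residual linearly.\<close>

lemma first_unit_companion: "first_unit \<bullet> (companion \<theta> *v w) = \<theta> \<bullet> w"
proof -
  obtain i :: 'a where i: "pos i = 1" by (rule pos_first)
  show ?thesis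
    unfolding first_unit_axis[OF i] inner_axis'
    by (simp add: companion_def matrix_vector_mult_def inner_vec_def i)
qed

lemma sum_plus_UNIV:
  fixes f :: "'a::finite + 'b::finite \<Rightarrow> 'c::comm_monoid_add"
  shows "(\<Sum>x\<in>UNIV. f x) = (\<Sum>a\<in>UNIV. f (Inl a)) + (\<Sum>b\<in>UNIV. f (Inr b))"
  using sum.Plus[of "UNIV :: 'a set" "UNIV :: 'b set" f] by (simp add: comp_def)

text \<open>\<open>regressor k x n\<close> is \<open>a\<^sup>*\<^bsub>n-1\<^esub> \<zeta>\<^bsub>n-1\<^esub>\<close>.\<close>

definition regressor ::
    "(nat \<Rightarrow> nat \<Rightarrow> real) \<Rightarrow> (nat \<Rightarrow> real) \<Rightarrow> nat \<Rightarrow> real ^ 'p::{finite,linorder}" where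
  "regressor k x n = (if n \<le> 1 then 0 else
     Z_vec k x (n - 1) + pacf k (n - 1) *\<^sub>R (\<Sum>j=1..<n - 1. pacf k j *\<^sub>R Z_vec k x j))"

lemma a_mat_stack: "transpose (a_mat k n) *v stack z s = z + pacf k n *\<^sub>R (s :: real ^ 'p)"
  by (simp add: vec_eq_iff matrix_vector_mult_def transpose_def a_mat_def stack_def sum_plus_UNIV mat_def
      if_distrib[of "\<lambda>x. x * _"] if_distrib[of "\<lambda>x. _ * x"] sum.delta sum.delta' cong: if_cong del: transpose_matrix_vector)

lemma zeta_pos: "n \<ge> 1 \<Longrightarrow> zeta k x n = stack (Z_vec k x n) (\<Sum>j=1..<n. pacf k j *\<^sub>R Z_vec k x j)"
  by (simp add: zeta_def)

lemma regressor_eq: "n \<ge> 1 \<Longrightarrow> transpose (a_mat k (n - 1)) *v zeta k x (n - 1) = regressor k x n"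
proof (cases "n = 1")
  case True
  then show ?thesis by (simp add: zeta_def regressor_def del: transpose_matrix_vector)
next
  case False
  assume "n \<ge> 1"
  with False have "n - 1 \<ge> 1" "\<not> n \<le> 1" by auto
  then show ?thesis by (simp add: zeta_pos a_mat_stack regressor_def del: transpose_matrix_vector)
qed

lemma inner_stack: "stack u 0 \<bullet> v = (\<Sum>i\<in>UNIV. u $ i * v $ Inl i)"
  by (simp add: inner_vec_def stack_def sum_plus_UNIV)

lemma A_tilde_stack_Inl:
  "(A_tilde k \<theta> n *v stack z s) $ Inl i = (companion \<theta> *v (z + pacf k n *\<^sub>R s)) $ i"
  by (simp add: matrix_vector_mult_def A_tilde_def stack_def sum_plus_UNIV algebra_simps sum.distrib)

text \<open>The upper block row of \<open>A_tilde\<close> is the companion matrix times the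
  transpose of \<open>a_mat\<close>, so the first coordinate sees the past only through the
  regressor.\<close>

lemma residual_eq:
  fixes \<theta> :: "real ^ 'p::{finite,linorder}"
  assumes "n \<ge> 1"
  shows "residual k s \<theta> x n = ((first_unit :: real ^ 'p::{finite,linorder}) \<bullet> Z_vec k x n - \<theta> \<bullet> regressor k x n) / s n"
proof -
  \<comment> \<open>For n = 1 this writes \<open>zeta k x 0 = 0\<close> as a stack of zeros, so that
    one block formula covers all n.\<close>
  have z: "zeta k x (n - 1) = stack (if n = 1 then 0 else Z_vec k x (n - 1))
      (if n = 1 then 0 else (\<Sum>j=1..<n - 1. pacf k j *\<^sub>R Z_vec k x j))"
    using assms by (auto simp: zeta_def stack_def vec_eq_iff split: sum.splits)
  have "stack (first_unit :: real ^ 'p::{finite,linorder}) 0 \<bullet> (zeta k x n - A_tilde k \<theta> (n - 1) *v zeta k x (n - 1)) =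
      (first_unit :: real ^ 'p::{finite,linorder}) \<bullet> Z_vec k x n - first_unit \<bullet> (companion \<theta> *v regressor k x n)"
  proof -
    have "(zeta k x n) $ Inl i = Z_vec k x n $ i" for i :: 'p using assms by (simp add: zeta_pos stack_def)
    moreover have "(A_tilde k \<theta> (n - 1) *v zeta k x (n - 1)) $ Inl i = (companion \<theta> *v regressor k x n) $ i" for i
      unfolding z A_tilde_stack_Inl using assms by (auto simp: regressor_def)
    ultimately show ?thesis
      unfolding inner_stack by (simp only: inner_vec_def right_diff_distrib sum_subtractf vector_minus_component inner_real_def)
  qed
  then show ?thesis by (simp add: residual_def first_unit_companion)
qed

lemma residual_add:
  "n \<ge> 1 \<Longrightarrow> residual k s (\<theta> + h) x n = residual k s \<theta> x n - h \<bullet> regressor k x n / s n"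
  by (simp add: residual_eq inner_add_left diff_divide_distrib add_divide_distrib)

lemma score_eq: "score k s \<theta> n x = (\<Sum>i=1..n. (residual k s \<theta> x i / s i) *\<^sub>R regressor k x i)"
  unfolding score_def by (intro sum.cong refl arg_cong[where f="\<lambda>v. _ *\<^sub>R v"] regressor_eq) simp

text \<open>The normalising terms cancel and the residual is affine in the parameter, so the
  quadratic expansion is exact for every path.\<close>

lemma log_likelihood_ratio:
  "ln (likelihood k s n (\<theta> + h) x / likelihood k s n \<theta> x) =
    h \<bullet> score k s \<theta> n x - 1/2 * (\<Sum>i=1..n. (h \<bullet> regressor k x i / s i)\<^sup>2)"
proof -
  have r: "(residual k s (\<theta> + h) x i)\<^sup>2 = (residual k s \<theta> x i)\<^sup>2
      - 2 * (h \<bullet> ((residual k s \<theta> x i / s i) *\<^sub>R regressor k x i)) + (h \<bullet> regressor k x i / s i)\<^sup>2"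
    if "i \<in> {1..n}" for i
  proof -
    have "residual k s (\<theta> + h) x i = residual k s \<theta> x i - h \<bullet> regressor k x i / s i"
      using that by (intro residual_add) simp
    then show ?thesis by (simp add: power2_diff)
  qed
  have "ln (likelihood k s n (\<theta> + h) x / likelihood k s n \<theta> x) =
      log_likelihood k s n (\<theta> + h) x - log_likelihood k s n \<theta> x"
    by (simp add: likelihood_def ln_div)
  also have "\<dots> = - (1/2) * (\<Sum>i=1..n. (residual k s (\<theta> + h) x i)\<^sup>2) + 1/2 * (\<Sum>i=1..n. (residual k s \<theta> x i)\<^sup>2)"
    by (simp add: log_likelihood_def)
  also have "(\<Sum>i=1..n. (residual k s (\<theta> + h) x i)\<^sup>2) = (\<Sum>i=1..n. (residual k s \<theta> x i)\<^sup>2)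
      - 2 * (h \<bullet> score k s \<theta> n x) + (\<Sum>i=1..n. (h \<bullet> regressor k x i / s i)\<^sup>2)"
    by (simp add: r sum.distrib sum_subtractf score_eq inner_sum_right sum_distrib_left del: inner_scaleR_right)
  finally show ?thesis by (simp add: algebra_simps)
qed

lemma log_likelihood_ratio_rate:
  assumes "n \<ge> 1"
  shows "ln (likelihood k s n (\<theta> + rate n *v u) x / likelihood k s n \<theta> x) =
    u \<bullet> ((1 / sqrt (real n)) *\<^sub>R score k s \<theta> n x) - 1/2 * ((\<Sum>i=1..n. (u \<bullet> regressor k x i / s i)\<^sup>2) / real n)"
proof -
  have "rate n *v u = (1 / sqrt (real n)) *\<^sub>R u"
    by (simp add: rate_def scaleR_matrix_vector_assoc[symmetric])
  then show ?thesis using assms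
    by (simp add: log_likelihood_ratio sum_divide_distrib power_divide power_mult_distrib mult_ac)
qed

section \<open>Dependence on the observed path\<close>

lemma lag_vec_cong: "(\<And>j. j \<le> n \<Longrightarrow> x j = y j) \<Longrightarrow> lag_vec x n = lag_vec y n"
proof -
  assume x: "\<And>j. j \<le> n \<Longrightarrow> x j = y j"
  have "n + 1 - pos i \<le> n" for i :: 'a using pos_pos[of i] by simp
  with x show ?thesis by (simp add: lag_vec_def vec_eq_iff)
qed

lemma Z_vec_cong: "(\<And>j. j \<le> n \<Longrightarrow> x j = y j) \<Longrightarrow> Z_vec k x n = Z_vec k y n"
  unfolding Z_vec_def by (intro sum.cong refl arg_cong[where f="\<lambda>v. _ *\<^sub>R v"] lag_vec_cong) auto

text \<open>Strictly earlier observations only: the regressor is predictable, and up to time n it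
  does not see that the path is truncated there.\<close>

lemma regressor_cong: "(\<And>j. j < n \<Longrightarrow> x j = y j) \<Longrightarrow> regressor k x n = regressor k y n"
  unfolding regressor_def
  by (auto intro!: arg_cong2[where f="(+)"] arg_cong[where f="\<lambda>v. _ *\<^sub>R v"] sum.cong Z_vec_cong)

lemma score_cong:
  fixes \<theta> :: "real ^ 'p::{finite,linorder}"
  assumes "\<And>j. j \<le> n \<Longrightarrow> x j = y j"
  shows "score k s \<theta> n x = score k s \<theta> n y"
proof -
  have "regressor k x i = (regressor k y i :: real ^ 'p::{finite,linorder})" "Z_vec k x i = (Z_vec k y i :: real ^ 'p::{finite,linorder})" if "i \<le> n" for i
    using assms that by (auto intro!: regressor_cong Z_vec_cong)
  then show ?thesis unfolding score_eq by (intro sum.cong refl) (simp add: residual_eq)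
qed

lemma lag_vec_measurable:
  assumes "m \<le> n"
  shows "(\<lambda>x. lag_vec x m :: real ^ 'p::{finite,linorder}) \<in> borel_measurable (PiM {0..n} (\<lambda>_. borel))"
proof -
  have "(lag_vec x m :: real ^ 'p::{finite,linorder}) = (\<Sum>i\<in>UNIV. (if pos i \<le> m + 1 then x (m + 1 - pos i) else 0) *\<^sub>R axis i 1)" for x
    by (simp add: lag_vec_def vec_eq_iff axis_def if_distrib[of "\<lambda>x. _ * x"] sum.delta cong: if_cong)
  moreover have "(\<lambda>x. \<Sum>i\<in>UNIV. (if pos i \<le> m + 1 then x (m + 1 - pos i) else 0) *\<^sub>R (axis i 1 :: real ^ 'p::{finite,linorder}))
      \<in> borel_measurable (PiM {0..n} (\<lambda>_. borel))"
  proof (intro borel_measurable_sum borel_measurable_scaleR borel_measurable_const)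
    fix i :: 'p
    show "(\<lambda>x. if pos i \<le> m + 1 then x (m + 1 - pos i) else 0) \<in> borel_measurable (PiM {0..n} (\<lambda>_. borel :: real measure))"
      using pos_pos[of i] assms by (cases "pos i \<le> m + 1") (auto intro!: measurable_component_singleton)
  qed
  ultimately show ?thesis by simp
qed

lemma Z_vec_measurable:
  assumes "m \<le> n"
  shows "(\<lambda>x. Z_vec k x m) \<in> borel_measurable (PiM {0..n} (\<lambda>_. borel))"
  unfolding Z_vec_def using assms
  by (intro borel_measurable_sum borel_measurable_scaleR borel_measurable_const lag_vec_measurable) auto

lemma regressor_measurable:
  assumes "m \<le> n"
  shows "(\<lambda>x. regressor k x m) \<in> borel_measurable (PiM {0..n} (\<lambda>_. borel))"
  unfolding regressor_def using assms
  by (cases "m \<le> 1") (auto intro!: borel_measurable_add borel_measurable_sum borel_measurable_scaleR Z_vec_measurable)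

lemma score_measurable:
  fixes \<theta> :: "real ^ 'p::{finite,linorder}"
  shows "score k s \<theta> n \<in> borel_measurable (PiM {0..n} (\<lambda>_. borel))"
proof -
  have "(\<lambda>x. \<Sum>i=1..n. ((((first_unit :: real ^ 'p::{finite,linorder}) \<bullet> Z_vec k x i - \<theta> \<bullet> regressor k x i) / s i) / s i) *\<^sub>R regressor k x i)
      \<in> borel_measurable (PiM {0..n} (\<lambda>_. borel))"
    by (intro borel_measurable_sum borel_measurable_scaleR borel_measurable_divide borel_measurable_diff
        borel_measurable_inner borel_measurable_const Z_vec_measurable regressor_measurable) auto
  moreover have "score k s \<theta> n x = (\<Sum>i=1..n. ((((first_unit :: real ^ 'p::{finite,linorder}) \<bullet> Z_vec k x i - \<theta> \<bullet> regressor k x i) / s i) / s i) *\<^sub>R regressor k x i)" for x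
    unfolding score_eq by (intro sum.cong refl) (simp add: residual_eq)
  ultimately show ?thesis by (simp cong: measurable_cong)
qed

subsection \<open>The observed path\<close>

lemma ar_path_0: "ar_path \<theta> e 0 = 0"
  by (simp add: ar_path.simps)

lemma ar_path_measurable:
  fixes \<theta> :: "real ^ 'p::{finite,linorder}"
  assumes "\<And>m. m \<ge> 1 \<Longrightarrow> \<xi> m \<in> borel_measurable M"
  shows "(\<lambda>\<omega>. ar_path \<theta> (\<lambda>m. \<xi> m \<omega>) n) \<in> borel_measurable M"
proof (induction n rule: less_induct)
  case (less n)
  show ?case
  proof (cases "n = 0")
    case False
    then have eq: "(\<lambda>\<omega>. ar_path \<theta> (\<lambda>m. \<xi> m \<omega>) n) = (\<lambda>\<omega>. (\<Sum>i\<in>UNIV.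
        (if pos i < n then \<theta> $ i * ar_path \<theta> (\<lambda>m. \<xi> m \<omega>) (n - pos i) else 0)) + \<xi> n \<omega>)"
      by (subst ar_path.simps) simp
    show ?thesis unfolding eq
    proof (intro borel_measurable_add borel_measurable_sum)
      fix i :: 'p
      show "(\<lambda>\<omega>. if pos i < n then \<theta> $ i * ar_path \<theta> (\<lambda>m. \<xi> m \<omega>) (n - pos i) else 0) \<in> borel_measurable M"
        using less[of "n - pos i"] pos_pos[of i]
        by (cases "pos i < n") (auto intro!: borel_measurable_times)
    qed (use assms False in auto)
  qed (simp add: ar_path_0)
qed

lemma lag_vec_ar_0: "lag_vec (ar_path \<theta> e) 0 = 0"
proof -
  have "1 - pos i = 0" for i :: 'a using pos_pos[of i] by simp
  then show ?thesis by (simp add: lag_vec_def vec_eq_iff ar_path_0)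
qed

text \<open>The state equation holds from time 0 on, because \<open>lag_vec\<close> and
  \<open>ar_path\<close> both treat nonpositive times as value 0.\<close>

lemma lag_vec_ar_Suc:
  fixes \<theta> :: "real ^ 'p::{finite,linorder}"
  shows "lag_vec (ar_path \<theta> e) (Suc n) = companion \<theta> *v lag_vec (ar_path \<theta> e) n + e (Suc n) *\<^sub>R first_unit"
proof (subst vec_eq_iff, rule allI)
  fix i :: 'p
  let ?X = "ar_path \<theta> e"
  show "lag_vec ?X (Suc n) $ i = (companion \<theta> *v lag_vec ?X n + e (Suc n) *\<^sub>R first_unit) $ i"
  proof (cases "pos i = 1")
    case True
    have "?X (Suc n) = (\<Sum>j\<in>UNIV. if pos j < Suc n then \<theta> $ j * ?X (Suc n - pos j) else 0) + e (Suc n)"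
      by (subst ar_path.simps) simp
    \<comment> \<open>The two index conditions differ only at \<open>pos j = n + 1\<close>, where
      the path value is X_0 = 0.\<close>
    also have "(\<Sum>j\<in>UNIV. if pos j < Suc n then \<theta> $ j * ?X (Suc n - pos j) else 0) =
        (\<Sum>j\<in>UNIV. \<theta> $ j * (if pos j \<le> n + 1 then ?X (n + 1 - pos j) else 0))"
      by (intro sum.cong refl) (auto simp: ar_path_0 le_Suc_eq less_Suc_eq_le)
    finally show ?thesis using True
      by (simp add: lag_vec_def companion_def matrix_vector_mult_def first_unit_def)
  next
    case False
    obtain j :: 'p where j: "pos i = pos j + 1" by (rule pos_pred[OF False])
    have "(pos i = pos l + 1) = (l = j)" for l using inj_pos j by (auto simp: inj_def)
    then have "(companion \<theta> *v lag_vec ?X n) $ i = lag_vec ?X n $ j" using False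
      by (simp add: matrix_vector_mult_def companion_def if_distrib[of "\<lambda>x. x * _"] sum.delta cong: if_cong)
    then show ?thesis using False j by (simp add: first_unit_def lag_vec_def)
  qed
qed

section \<open>Filtered states of the autoregression\<close>

context
  fixes r :: "nat \<Rightarrow> real" and k :: "nat \<Rightarrow> nat \<Rightarrow> real" and \<theta> :: "real ^ 'p::{finite,linorder}" and e :: "nat \<Rightarrow> real"
  assumes k: "\<And>n i. 1 \<le> i \<Longrightarrow> i \<le> n \<Longrightarrow> k n i = lev_coeff r n i"
begin

abbreviation "ar_lag \<equiv> lag_vec (ar_path \<theta> e) :: nat \<Rightarrow> real ^ 'p::{finite,linorder}"
abbreviation "ar_Z \<equiv> Z_vec k (ar_path \<theta> e) :: nat \<Rightarrow> real ^ 'p::{finite,linorder}"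
abbreviation "ar_W \<equiv> regressor k (ar_path \<theta> e) :: nat \<Rightarrow> real ^ 'p::{finite,linorder}"

lemma pacf_lev: "n \<ge> 1 \<Longrightarrow> pacf k n = lev_refl r n"
  using lev_coeff_first[of n r] k[of 1 "Suc n"] by (simp add: pacf_def)

lemma ar_Z_eq: "ar_Z n = (\<Sum>i=1..n. lev_coeff r n i *\<^sub>R ar_lag i)"
  unfolding Z_vec_def using k by (intro sum.cong) auto

text \<open>The reversed polynomial of the Szegoe recursion, \<open>\<Phi>\<^sup>*\<^sub>n = 1 - z \<Sum>\<^sub>k \<beta>\<^sub>k \<Phi>\<^sub>k\<close>.\<close>

lemma sum_pacf_Z:
  "n \<ge> 1 \<Longrightarrow> (\<Sum>j=1..<n. lev_refl r j *\<^sub>R ar_Z j) = - (\<Sum>j=1..n. lev_coeff r n (n - j) *\<^sub>R ar_lag j)"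
proof (induction n rule: dec_induct)
  case (step n)
  have n: "n \<ge> 1" using step by simp
  have "(\<Sum>j=1..Suc n. lev_coeff r (Suc n) (Suc n - j) *\<^sub>R ar_lag j) = (\<Sum>j=1..n. lev_coeff r (Suc n) (Suc (n - j)) *\<^sub>R ar_lag j)"
    using n by (simp add: Suc_diff_le)
  also have "\<dots> = (\<Sum>j=1..n. lev_coeff r n (n - j) *\<^sub>R ar_lag j - lev_refl r n *\<^sub>R (lev_coeff r n j *\<^sub>R ar_lag j))"
    using n by (intro sum.cong refl) (simp add: lev_coeff_Suc scaleR_diff_left)
  also have "\<dots> = (\<Sum>j=1..n. lev_coeff r n (n - j) *\<^sub>R ar_lag j) - lev_refl r n *\<^sub>R ar_Z n"
    by (simp add: sum_subtractf ar_Z_eq scaleR_sum_right)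
  finally show ?case using step.IH n by simp
qed simp

text \<open>The reversed-polynomial identity turns the regressor into the filter k(n, .) applied to
  the lagged states Y_{j-1}. This is why it obeys an autoregression driven by innovations.\<close>

lemma ar_W_eq: "n \<ge> 1 \<Longrightarrow> ar_W n = (\<Sum>j=1..n. lev_coeff r n j *\<^sub>R ar_lag (j - 1))"
proof (induction n rule: dec_induct)
  case base
  show ?case by (simp add: regressor_def lag_vec_ar_0)
next
  case (step n)
  have n: "n \<ge> 1" using step by simp
  have "ar_W (Suc n) = ar_Z n + lev_refl r n *\<^sub>R (\<Sum>j=1..<n. lev_refl r j *\<^sub>R ar_Z j)"
    using n by (auto simp: regressor_def pacf_lev intro!: arg_cong2[where f=scaleR] sum.cong)
  also have "\<dots> = (\<Sum>j=1..n. lev_coeff r (Suc n) (Suc j) *\<^sub>R ar_lag j)"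
    unfolding sum_pacf_Z[OF n]
    using n by (simp add: ar_Z_eq lev_coeff_Suc scaleR_diff_left sum_subtractf scaleR_sum_right)
  also have "\<dots> = (\<Sum>j=Suc 0..n. lev_coeff r (Suc n) (Suc j) *\<^sub>R ar_lag (Suc j - 1))" by simp
  also have "\<dots> = (\<Sum>j=Suc (Suc 0)..Suc n. lev_coeff r (Suc n) j *\<^sub>R ar_lag (j - 1))"
    by (subst sum.shift_bounds_cl_Suc_ivl) simp
  \<comment> \<open>The added term j = 1 carries the state at time 0, which is 0.\<close>
  also have "\<dots> = (\<Sum>j=1..Suc n. lev_coeff r (Suc n) j *\<^sub>R ar_lag (j - 1))"
    by (subst (2) sum.atLeast_Suc_atMost) (auto simp: lag_vec_ar_0)
  finally show ?case .
qed

text \<open>The filter k(n, .) is applied to Y_j = A_0 Y_{j-1} + e_j b; by linearity the lagged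
  states combine to the regressor and the inputs to the filtered noise.\<close>

lemma ar_Z_W: "n \<ge> 1 \<Longrightarrow> ar_Z n = companion \<theta> *v ar_W n + (\<Sum>j=1..n. lev_coeff r n j * e j) *\<^sub>R first_unit"
proof -
  assume n: "n \<ge> 1"
  have "ar_Z n = (\<Sum>j=1..n. lev_coeff r n j *\<^sub>R (companion \<theta> *v ar_lag (j - 1) + e j *\<^sub>R first_unit))"
  proof (unfold ar_Z_eq, intro sum.cong refl)
    fix j assume "j \<in> {1..n}"
    then have "j = Suc (j - 1)" by simp
    then show "lev_coeff r n j *\<^sub>R ar_lag j = lev_coeff r n j *\<^sub>R (companion \<theta> *v ar_lag (j - 1) + e j *\<^sub>R first_unit)"
      using lag_vec_ar_Suc[of \<theta> e "j - 1"] by simp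
  qed
  also have "\<dots> = (\<Sum>j=1..n. companion \<theta> *v (lev_coeff r n j *\<^sub>R ar_lag (j - 1))) +
      (\<Sum>j=1..n. (lev_coeff r n j * e j) *\<^sub>R first_unit)"
    by (simp add: scaleR_add_right sum.distrib matrix_vector_mult_scaleR)
  also have "(\<Sum>j=1..n. companion \<theta> *v (lev_coeff r n j *\<^sub>R ar_lag (j - 1))) = companion \<theta> *v ar_W n"
    unfolding ar_W_eq[OF n] by (simp add: linear_sum[OF matrix_vector_mul_linear])
  finally show ?thesis by (simp add: scaleR_sum_left)
qed

lemma ar_W_Suc:
  "n \<ge> 1 \<Longrightarrow> ar_W (Suc n) = ar_Z n + lev_refl r n *\<^sub>R (\<Sum>j=1..<n. lev_refl r j *\<^sub>R ar_Z j)"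
  by (auto simp: regressor_def pacf_lev intro!: arg_cong2[where f=scaleR] sum.cong)

lemma residual_ar:
  "n \<ge> 1 \<Longrightarrow> residual k s \<theta> (ar_path \<theta> e) n = (\<Sum>j=1..n. lev_coeff r n j * e j) / s n"
  by (simp add: residual_eq ar_Z_W inner_add_right first_unit_companion first_unit_inner_self)

end

section \<open>Local asymptotic normality\<close>

text \<open>Away from 0 Markov's inequality settles the distribution functions. The point 0 itself
  is a jump of the limit, as the points -1/(n+1) show, so it is no continuity point.\<close>

lemma (in prob_space) weak_conv_0_of_L1:
  fixes X :: "nat \<Rightarrow> 'a \<Rightarrow> real"
  assumes X: "\<And>n. integrable M (X n)" and lim: "(\<lambda>n. expectation (\<lambda>\<omega>. \<bar>X n \<omega>\<bar>)) \<longlonglongrightarrow> 0"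
  shows "weak_conv_m (\<lambda>n. distr M borel (X n)) (return borel 0)"
  unfolding weak_conv_m_def weak_conv_def
proof (intro allI impI)
  fix x assume cont: "isCont (cdf (return borel 0)) x"
  have Xm[measurable]: "X n \<in> borel_measurable M" for n using X by auto
  have cdf0: "cdf (return borel 0) y = (if 0 \<le> y then 1 else 0)" for y :: real
    by (simp add: cdf_def measure_return indicator_def)
  have cdfX: "cdf (distr M borel (X n)) y = prob {\<omega>\<in>space M. X n \<omega> \<le> y}" for n y
    by (simp add: cdf_def measure_distr vimage_def Int_def conj_commute)
  have markov: "prob {\<omega>\<in>space M. \<bar>X n \<omega>\<bar> \<ge> c} \<le> expectation (\<lambda>\<omega>. \<bar>X n \<omega>\<bar>) / c" if "c > 0" for c n
    using integral_Markov_inequality_measure[of M "\<lambda>\<omega>. \<bar>X n \<omega>\<bar>" "space M" c] that X by simp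
  have mlim: "(\<lambda>n. expectation (\<lambda>\<omega>. \<bar>X n \<omega>\<bar>) / c) \<longlonglongrightarrow> 0" for c
    using tendsto_divide_zero[OF lim] by simp
  consider "x < 0" | "x = 0" | "x > 0" by linarith
  then show "(\<lambda>n. cdf (distr M borel (X n)) x) \<longlonglongrightarrow> cdf (return borel 0) x"
  proof cases
    case 1
    have "prob {\<omega>\<in>space M. X n \<omega> \<le> x} \<le> expectation (\<lambda>\<omega>. \<bar>X n \<omega>\<bar>) / (- x)" for n
      by (rule order_trans[OF finite_measure_mono markov]) (use 1 in auto)
    then have "(\<lambda>n. prob {\<omega>\<in>space M. X n \<omega> \<le> x}) \<longlonglongrightarrow> 0"
      by (intro Lim_null_comparison[OF _ mlim[of "- x"]]) simp
    then show ?thesis using 1 by (simp add: cdf0 cdfX)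
  next
    case 2
    have "(\<lambda>n. - (1 / real (Suc n))) \<longlonglongrightarrow> 0"
      using tendsto_minus[OF LIMSEQ_Suc[OF lim_1_over_n]] by simp
    moreover have "isCont (cdf (return borel (0::real))) 0" using cont 2 by simp
    ultimately have "(\<lambda>n. cdf (return borel (0::real)) (- (1 / real (Suc n)))) \<longlonglongrightarrow> cdf (return borel 0) 0"
      by (rule isCont_tendsto_compose[rotated])
    then show ?thesis by (simp add: cdf0 LIMSEQ_const_iff)
  next
    case 3
    have "\<bar>prob {\<omega>\<in>space M. X n \<omega> \<le> x} - 1\<bar> \<le> expectation (\<lambda>\<omega>. \<bar>X n \<omega>\<bar>) / x" for n
    proof -
      have "prob {\<omega>\<in>space M. \<not> X n \<omega> \<le> x} \<le> expectation (\<lambda>\<omega>. \<bar>X n \<omega>\<bar>) / x"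
        by (rule order_trans[OF finite_measure_mono markov]) (use 3 in auto)
      then show ?thesis by (simp add: prob_neg)
    qed
    then have "(\<lambda>n. prob {\<omega>\<in>space M. X n \<omega> \<le> x} - 1) \<longlonglongrightarrow> 0"
      by (intro Lim_null_comparison[OF _ mlim[of x]]) simp
    then show ?thesis using 3 by (simp add: cdf0 cdfX LIM_zero_iff)
  qed
qed

lemma powr_bigo_null:
  fixes f :: "nat \<Rightarrow> real"
  assumes "f \<in> O(\<lambda>n. real n powr - a)" "a > 0"
  shows "f \<longlonglongrightarrow> 0"
proof -
  obtain c where c: "eventually (\<lambda>n. norm (f n) \<le> c * norm (real n powr - a)) sequentially"
    using assms(1) by (auto elim: landau_o.bigE)
  have "(\<lambda>n. c * norm (real n powr - a)) \<longlonglongrightarrow> c * norm (0 :: real)"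
    using assms(2) by (intro tendsto_mult tendsto_const tendsto_norm tendsto_neg_powr filterlim_real_sequentially) auto
  then have "(\<lambda>n. c * norm (real n powr - a)) \<longlonglongrightarrow> 0" by simp
  with c show ?thesis by (rule Lim_null_comparison)
qed

text \<open>The two forms in which \<alpha>_2 > 1 is used: summability keeps \<sigma>_n away from 0,
  and together with the second claim it makes the memory term vanish.\<close>

lemma powr_bigo_summable:
  fixes f :: "nat \<Rightarrow> real"
  assumes "f \<in> O(\<lambda>n. real n powr - a)" "a > 1"
  shows "summable f" "(\<lambda>n. real n * f n) \<longlonglongrightarrow> 0"
proof -
  obtain c where c: "eventually (\<lambda>n. norm (f n) \<le> c * norm (real n powr - a)) sequentially"
    using assms(1) by (auto elim: landau_o.bigE)
  show "summable f"
    by (rule summable_comparison_test_ev[OF c])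
      (use assms(2) in \<open>auto intro!: summable_mult simp: summable_real_powr_iff\<close>)
  have "(\<lambda>n. real n * f n) \<in> O(\<lambda>n. real n powr - (a - 1))"
  proof (rule bigoI)
    show "eventually (\<lambda>n. norm (real n * f n) \<le> c * norm (real n powr - (a - 1))) sequentially"
      using c eventually_gt_at_top[of 0]
    proof eventually_elim
      case (elim n)
      have "norm (real n * f n) \<le> real n * (c * norm (real n powr - a))"
        using elim by (simp add: abs_mult mult_left_mono)
      also have "\<dots> = c * norm (real n powr - (a - 1))"
        using elim by (simp add: powr_diff powr_minus divide_inverse powr_one)
      finally show ?case .
    qed
  qed
  then show "(\<lambda>n. real n * f n) \<longlonglongrightarrow> 0" by (rule powr_bigo_null) (use assms(2) in simp)
qed

theorem theorem3p4:
  fixes M :: "'w measure" and \<xi> :: "nat \<Rightarrow> 'w \<Rightarrow> real" and f :: "real \<Rightarrow> real"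
    and k :: "nat \<Rightarrow> nat \<Rightarrow> real" and \<sigma> :: "nat \<Rightarrow> real"
    and \<alpha>\<^sub>1 \<alpha>\<^sub>2 :: real
    and \<theta>\<^sub>0 :: "real ^ 'p::{finite,linorder}"
  assumes "prob_space M"
    and "gaussian_process M \<xi>" and "stationary_process M \<xi>" and "centered_process M \<xi>"
    and "autocov M \<xi> 0 = 1"
    and "spectral_density (autocov M \<xi>) f"
    and k: "k = innov_coeff M \<xi>"
    and \<sigma>: "\<sigma> = innov_sd M \<xi>"
    and "\<theta>\<^sub>0 \<in> stable_params"
    and "\<alpha>\<^sub>1 > 0" and "autocov M \<xi> \<in> O(\<lambda>n. real n powr - \<alpha>\<^sub>1)"
    and "log_integrable f"
    and "\<alpha>\<^sub>2 > 1" and "(\<lambda>n. (pacf k n)\<^sup>2) \<in> O(\<lambda>n. real n powr - \<alpha>\<^sub>2)"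
  shows "(\<exists>!I. is_fisher_info \<theta>\<^sub>0 I)
    \<and> (\<exists>\<nu>. mv_gauss_law \<nu> 0 (fisher_info \<theta>\<^sub>0) \<and>
          converges_in_law
            (\<lambda>n. distr (ar_law M \<xi> \<theta>\<^sub>0 n) borel (\<lambda>x. (1 / sqrt (real n)) *\<^sub>R score k \<sigma> \<theta>\<^sub>0 n x)) \<nu>)
    \<and> (\<forall>R>0. \<forall>u\<in>ball 0 R. \<exists>Rem :: nat \<Rightarrow> (nat \<Rightarrow> real) \<Rightarrow> real.
          (\<forall>n\<ge>1. \<forall>x\<in>space (ar_law M \<xi> \<theta>\<^sub>0 n).
             ln (likelihood k \<sigma> n (\<theta>\<^sub>0 + rate n *v u) x / likelihood k \<sigma> n \<theta>\<^sub>0 x)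
             = u \<bullet> ((1 / sqrt (real n)) *\<^sub>R score k \<sigma> \<theta>\<^sub>0 n x)
               - 1/2 * (u \<bullet> (fisher_info \<theta>\<^sub>0 *v u)) + Rem n x)
          \<and> weak_conv_m (\<lambda>n. distr (ar_law M \<xi> \<theta>\<^sub>0 n) borel (Rem n)) (return borel 0))"
proof -
  interpret gn: gaussian_noise M \<xi>
    using assms powr_bigo_null[OF assms(11,10)]
    by (intro gaussian_noise.intro gaussian_noise_axioms.intro) auto
  define A where "A = companion \<theta>\<^sub>0"
  define b :: "real ^ 'p::{finite,linorder}" where "b = first_unit"
  define s where "s n = sqrt (gn.V n)" for n
  define W :: "nat \<Rightarrow> 'w \<Rightarrow> real ^ 'p::{finite,linorder}" where
    "W n \<omega> = regressor k (ar_path \<theta>\<^sub>0 (\<lambda>m. \<xi> m \<omega>)) n" for n \<omega>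
  obtain C \<rho> where C: "0 \<le> C" and \<rho>: "0 < \<rho>" "\<rho> < 1"
    and decay: "\<And>j v. norm (((*v) A ^^ j) v) \<le> C * \<rho> ^ j * norm v"
    using matrix_decay[of A] assms(9) unfolding A_def stable_params_def by blast
  have kK: "k n i = gn.K n i" if "1 \<le> i" "i \<le> n" for n i
    unfolding k by (rule gn.innov_coeff_eq[OF that])
  have \<sigma>s: "\<sigma> n = s n" if "n \<ge> 1" for n
    unfolding \<sigma> s_def by (rule gn.innov_sd_eq[OF that])
  \<comment> \<open>Filtering the noise with the Levinson coefficients gives the innovation, so Z_j
    takes the form prescribed by \<open>innovation_ar\<close>.\<close>
  have Z: "Z_vec k (ar_path \<theta>\<^sub>0 (\<lambda>m. \<xi> m \<omega>)) j = A *v W j \<omega> + (s j * gn.\<epsilon> j \<omega>) *\<^sub>R b" if "j \<ge> 1" for j \<omega>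
  proof -
    have "(\<Sum>i=1..j. gn.K j i * \<xi> i \<omega>) = s j * gn.\<epsilon> j \<omega>"
      using gn.lev_var_pos[OF that] by (simp add: gn.\<epsilon>_def gn.\<eta>_def s_def)
    then show ?thesis
      using ar_Z_W[of k gn.r j \<theta>\<^sub>0 "\<lambda>m. \<xi> m \<omega>", OF kK that] by (simp add: A_def b_def W_def)
  qed
  interpret ia: innovation_ar M gn.\<epsilon> "lev_refl gn.r" s A b C \<rho> W
  proof unfold_locales
    show "gn.\<epsilon> n \<in> borel_measurable M" for n by (rule gn.eps_measurable)
    show "distr M borel (gn.\<epsilon> n) = std_normal_distribution" if "n \<ge> 1" for n
      by (rule gn.eps_distr[OF that])
    show "gn.indep_vars (\<lambda>_. borel) gn.\<epsilon> {1..n}" if "n \<ge> 1" for n by (rule gn.eps_indep[OF that])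
    show "s 1 = 1" by (simp add: s_def)
    show "s n > 0" if "n \<ge> 1" for n using gn.lev_var_pos[OF that] by (simp add: s_def)
    show "(s (Suc n))\<^sup>2 = (s n)\<^sup>2 * (1 - (lev_refl gn.r n)\<^sup>2)" if "n \<ge> 1" for n
      using gn.lev_var_pos[OF that] gn.lev_var_pos[of "Suc n"] by (simp add: s_def lev_var_Suc[OF that])
    \<comment> \<open>The two sequences differ at n = 0, where \<open>pacf\<close> is 1 by
      convention and the reflection coefficient is 0.\<close>
    have "eventually (\<lambda>n. (pacf k n)\<^sup>2 = (lev_refl gn.r n)\<^sup>2) sequentially"
      using eventually_ge_at_top[of 1] by eventually_elim (simp add: k gn.pacf_eq)
    then have "(\<lambda>n. (lev_refl gn.r n)\<^sup>2) \<in> O(\<lambda>n. real n powr - \<alpha>\<^sub>2)"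
      using assms(14) by (subst (asm) landau_o.big.in_cong)
    from powr_bigo_summable[OF this assms(13)]
    show "summable (\<lambda>n. (lev_refl gn.r n)\<^sup>2)" "(\<lambda>n. real n * (lev_refl gn.r n)\<^sup>2) \<longlonglongrightarrow> 0" .
    show "W (Suc 0) \<omega> = 0" for \<omega> unfolding W_def by (simp add: regressor_def)
    show "W (Suc n) \<omega> = (A *v W n \<omega> + (s n * gn.\<epsilon> n \<omega>) *\<^sub>R b) + lev_refl gn.r n *\<^sub>R
        (\<Sum>j=1..<n. lev_refl gn.r j *\<^sub>R (A *v W j \<omega> + (s j * gn.\<epsilon> j \<omega>) *\<^sub>R b))" if "n \<ge> 1" for n \<omega>
    proof -
      have "W (Suc n) \<omega> = Z_vec k (ar_path \<theta>\<^sub>0 (\<lambda>m. \<xi> m \<omega>)) n + lev_refl gn.r n *\<^sub>R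
          (\<Sum>j=1..<n. lev_refl gn.r j *\<^sub>R Z_vec k (ar_path \<theta>\<^sub>0 (\<lambda>m. \<xi> m \<omega>)) j)"
        unfolding W_def by (rule ar_W_Suc[OF kK that])
      also have "(\<Sum>j=1..<n. lev_refl gn.r j *\<^sub>R Z_vec k (ar_path \<theta>\<^sub>0 (\<lambda>m. \<xi> m \<omega>)) j) =
          (\<Sum>j=1..<n. lev_refl gn.r j *\<^sub>R (A *v W j \<omega> + (s j * gn.\<epsilon> j \<omega>) *\<^sub>R b))"
        by (intro sum.cong refl) (simp add: Z)
      finally show ?thesis by (simp only: Z[OF that])
    qed
  qed (use decay C \<rho> in auto)

  define F where "F = (\<chi> i j. \<Sum>l. ((*v) A ^^ l) b $ i * ((*v) A ^^ l) b $ j)"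
  have ex1: "\<exists>!I. is_fisher_info \<theta>\<^sub>0 I"
    unfolding is_fisher_info_def A_def[symmetric] b_def[symmetric] by (rule lyapunov_ex1[OF decay \<rho>])
  have Fsol: "is_fisher_info \<theta>\<^sub>0 F"
    unfolding is_fisher_info_def A_def[symmetric] b_def[symmetric] F_def by (rule lyapunov_series_solves[OF decay \<rho>])
  then have FI: "fisher_info \<theta>\<^sub>0 = F" unfolding fisher_info_def by (intro the1_equality ex1)
  define Q where "Q v = v \<bullet> (F *v v)" for v
  have Qs: "(\<lambda>l. (v \<bullet> ((*v) A ^^ l) b) * (v \<bullet> ((*v) A ^^ l) b)) sums Q v" for v
    unfolding Q_def F_def by (rule lyapunov_series[OF decay \<rho>])
  have Q0: "Q v \<ge> 0" for v by (rule sums_le[OF _ sums_zero Qs]) simp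
  have Qd: "Q v - Q (transpose A *v v) = (v \<bullet> b)\<^sup>2" for v
  proof -
    have "F = A ** F ** transpose A + columnvector b ** (rowvector b :: real ^ 'p::{finite,linorder} ^ 1)"
      using Fsol unfolding is_fisher_info_def A_def[symmetric] b_def[symmetric] .
    from arg_cong[OF this, of "\<lambda>F. v \<bullet> (F *v v)"] show ?thesis
      unfolding lyapunov_bilinear Q_def by (simp add: power2_eq_square del: transpose_matrix_vector)
  qed
  obtain KQ where KQ: "\<And>v. norm (F *v v) \<le> norm v * KQ"
    using bounded_linear.bounded[OF matrix_vector_mul_bounded_linear[of F]] by blast
  have QK: "\<bar>Q v\<bar> \<le> KQ * (norm v)\<^sup>2" for v
  proof -
    have "\<bar>Q v\<bar> \<le> norm v * norm (F *v v)" unfolding Q_def by (rule Cauchy_Schwarz_ineq2)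
    also have "\<dots> \<le> norm v * (norm v * KQ)" by (intro mult_left_mono KQ) auto
    finally show ?thesis by (simp add: power2_eq_square mult_ac)
  qed
  have lln: "(\<lambda>n. gn.expectation (\<lambda>\<omega>. \<bar>ia.q n v \<omega> - Q v\<bar>)) \<longlonglongrightarrow> 0" for v
    by (rule ia.q_law_of_large_numbers[OF Qd QK])

  \<comment> \<open>The law of the path lives on a finite product. Beyond n the path
    \<open>P n\<close> is undefined, which the congruence lemmas for regressor and score
    permit.\<close>
  define P where "P n \<omega> = (\<lambda>i\<in>{0..n}. ar_path \<theta>\<^sub>0 (\<lambda>m. \<xi> m \<omega>) i)" for n \<omega>
  have Pm[measurable]: "P n \<in> M \<rightarrow>\<^sub>M PiM {0..n} (\<lambda>_. borel)" for n
    unfolding P_def[abs_def] by (intro measurable_restrict ar_path_measurable gn.xi_measurable)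
  have law: "ar_law M \<xi> \<theta>\<^sub>0 n = distr M (PiM {0..n} (\<lambda>_. borel)) (P n)" for n
    by (simp add: ar_law_def P_def[abs_def])
  have distr_law: "distr (ar_law M \<xi> \<theta>\<^sub>0 n) borel g = distr M borel (\<lambda>\<omega>. g (P n \<omega>))"
    if "g \<in> borel_measurable (PiM {0..n} (\<lambda>_. borel))" for n and g :: "(nat \<Rightarrow> real) \<Rightarrow> 'z::topological_space"
    unfolding law by (subst distr_distr[OF that Pm]) (simp add: comp_def)
  have regP: "regressor k (P n \<omega>) i = W i \<omega>" if "i \<in> {1..n}" for n i \<omega>
    unfolding W_def using that by (intro regressor_cong) (auto simp: P_def)

  \<comment> \<open>At the true parameter the residuals are the innovations, so the score becomes a
    martingale sum.\<close>
  have score: "score k \<sigma> \<theta>\<^sub>0 n (P n \<omega>) = (\<Sum>i=1..n. gn.\<epsilon> i \<omega> *\<^sub>R ia.U i \<omega>)" for n \<omega>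
  proof -
    have "score k \<sigma> \<theta>\<^sub>0 n (P n \<omega>) = score k \<sigma> \<theta>\<^sub>0 n (ar_path \<theta>\<^sub>0 (\<lambda>m. \<xi> m \<omega>))"
      by (rule score_cong) (simp add: P_def)
    also have "\<dots> = (\<Sum>i=1..n. gn.\<epsilon> i \<omega> *\<^sub>R ia.U i \<omega>)"
      unfolding score_eq
    proof (intro sum.cong refl)
      fix i assume "i \<in> {1..n}"
      then have i: "i \<ge> 1" by simp
      have "residual k \<sigma> \<theta>\<^sub>0 (ar_path \<theta>\<^sub>0 (\<lambda>m. \<xi> m \<omega>)) i = gn.\<epsilon> i \<omega>"
        using residual_ar[of k gn.r i \<sigma> \<theta>\<^sub>0 "\<lambda>m. \<xi> m \<omega>", OF kK i] \<sigma>s[OF i]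
        by (simp add: gn.\<epsilon>_def gn.\<eta>_def s_def)
      then show "(residual k \<sigma> \<theta>\<^sub>0 (ar_path \<theta>\<^sub>0 (\<lambda>m. \<xi> m \<omega>)) i / \<sigma> i) *\<^sub>R regressor k (ar_path \<theta>\<^sub>0 (\<lambda>m. \<xi> m \<omega>)) i =
          gn.\<epsilon> i \<omega> *\<^sub>R ia.U i \<omega>"
        by (simp add: ia.U_def W_def \<sigma>s[OF i])
    qed
    finally show ?thesis .
  qed

  \<comment> \<open>The law of \<open>gauss_vec\<close> is the limit; its projections are identified
    as Gaussian by uniqueness of characteristic functions.\<close>
  define \<nu> where "\<nu> = distr M borel ia.gauss_vec"
  have gauss: "mv_gauss_law \<nu> 0 (fisher_info \<theta>\<^sub>0)"
    unfolding mv_gauss_law_def FI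
  proof (intro conjI allI)
    show "prob_space \<nu>" unfolding \<nu>_def by (rule gn.prob_space_distr) simp
    show "sets \<nu> = sets borel" by (simp add: \<nu>_def)
    show "transpose F = F" by (simp add: F_def transpose_def vec_eq_iff mult.commute)
    fix v
    show "v \<bullet> (F *v v) \<ge> 0" using Q0[of v] by (simp add: Q_def)
    have "distr \<nu> borel ((\<bullet>) v) = distr M borel (\<lambda>\<omega>. v \<bullet> ia.gauss_vec \<omega>)"
      unfolding \<nu>_def by (subst distr_distr) (auto simp: comp_def)
    also have "\<dots> = gauss_law 0 (sqrt (Q v))"
    proof (rule Levy_uniqueness)
      show "real_distribution (distr M borel (\<lambda>\<omega>. v \<bullet> ia.gauss_vec \<omega>))"
        by (intro gn.real_distribution_distr) simp
      show "real_distribution (gauss_law 0 (sqrt (Q v)))"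
        unfolding gauss_law_def by (intro prob_space.real_distribution_distr prob_space_std_normal) simp
      show "char (distr M borel (\<lambda>\<omega>. v \<bullet> ia.gauss_vec \<omega>)) = char (gauss_law 0 (sqrt (Q v)))"
      proof
        fix t
        have "(\<lambda>l. t\<^sup>2 * ((v \<bullet> ((*v) A ^^ l) b) * (v \<bullet> ((*v) A ^^ l) b))) sums (t\<^sup>2 * Q v)"
          by (rule sums_mult[OF Qs])
        then have st: "(\<lambda>l. ((t *\<^sub>R v) \<bullet> ((*v) A ^^ l) b) * ((t *\<^sub>R v) \<bullet> ((*v) A ^^ l) b)) sums (t\<^sup>2 * Q v)"
          by (simp add: power2_eq_square mult_ac)
        have "char (distr M borel (\<lambda>\<omega>. v \<bullet> ia.gauss_vec \<omega>)) t = gn.expectation (\<lambda>\<omega>. cis ((t *\<^sub>R v) \<bullet> ia.gauss_vec \<omega>))"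
          unfolding char_def by (subst integral_distr) (auto simp: cis_conv_exp)
        also have "\<dots> = complex_of_real (exp (- (t\<^sup>2 * Q v) / 2))" by (rule ia.gauss_vec_cf[OF st])
        also have "\<dots> = char (gauss_law 0 (sqrt (Q v))) t"
          using gauss_law_char[of 0 "sqrt (Q v)" t] Q0[of v]
          by (simp add: char_def cis_conv_exp power_mult_distrib)
        finally show "char (distr M borel (\<lambda>\<omega>. v \<bullet> ia.gauss_vec \<omega>)) t = char (gauss_law 0 (sqrt (Q v))) t" .
      qed
    qed
    finally show "distr \<nu> borel ((\<bullet>) v) = gauss_law (v \<bullet> 0) (sqrt (v \<bullet> (F *v v)))" by (simp add: Q_def)
  qed
  have clt: "converges_in_law
      (\<lambda>n. distr (ar_law M \<xi> \<theta>\<^sub>0 n) borel (\<lambda>x. (1 / sqrt (real n)) *\<^sub>R score k \<sigma> \<theta>\<^sub>0 n x)) \<nu>"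
    unfolding converges_in_law_def
  proof (intro allI impI)
    fix h :: "real ^ 'p::{finite,linorder} \<Rightarrow> real"
    assume h: "continuous_on UNIV h \<and> bounded (range h)"
    then obtain B where B: "\<And>x. \<bar>h x\<bar> \<le> B" by (auto simp: bounded_iff)
    have hm[measurable]: "h \<in> borel_measurable borel" using h by (intro borel_measurable_continuous_onI) auto
    have "integral\<^sup>L (distr (ar_law M \<xi> \<theta>\<^sub>0 n) borel (\<lambda>x. (1 / sqrt (real n)) *\<^sub>R score k \<sigma> \<theta>\<^sub>0 n x)) h =
        gn.expectation (\<lambda>\<omega>. h ((1 / sqrt (real n)) *\<^sub>R (\<Sum>i=1..n. gn.\<epsilon> i \<omega> *\<^sub>R ia.U i \<omega>)))" for n
    proof -
      have m: "(\<lambda>x. (1 / sqrt (real n)) *\<^sub>R score k \<sigma> \<theta>\<^sub>0 n x) \<in> borel_measurable (PiM {0..n} (\<lambda>_. borel))"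
        by (intro borel_measurable_scaleR borel_measurable_const score_measurable)
      show ?thesis
        unfolding distr_law[OF m] score[symmetric] by (rule integral_distr[OF measurable_compose[OF Pm m] hm])
    qed
    moreover have "integral\<^sup>L \<nu> h = gn.expectation (\<lambda>\<omega>. h (ia.gauss_vec \<omega>))"
      unfolding \<nu>_def by (rule integral_distr) measurable
    ultimately show "(\<lambda>n. integral\<^sup>L (distr (ar_law M \<xi> \<theta>\<^sub>0 n) borel
        (\<lambda>x. (1 / sqrt (real n)) *\<^sub>R score k \<sigma> \<theta>\<^sub>0 n x)) h) \<longlonglongrightarrow> integral\<^sup>L \<nu> h"
      using ia.martingale_clt[OF Qs lln, of h B] h B by simp
  qed
  have lan: "\<exists>Rem :: nat \<Rightarrow> (nat \<Rightarrow> real) \<Rightarrow> real.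
      (\<forall>n\<ge>1. \<forall>x\<in>space (ar_law M \<xi> \<theta>\<^sub>0 n).
         ln (likelihood k \<sigma> n (\<theta>\<^sub>0 + rate n *v u) x / likelihood k \<sigma> n \<theta>\<^sub>0 x)
         = u \<bullet> ((1 / sqrt (real n)) *\<^sub>R score k \<sigma> \<theta>\<^sub>0 n x)
           - 1/2 * (u \<bullet> (fisher_info \<theta>\<^sub>0 *v u)) + Rem n x)
      \<and> weak_conv_m (\<lambda>n. distr (ar_law M \<xi> \<theta>\<^sub>0 n) borel (Rem n)) (return borel 0)" for u
  proof -
    \<comment> \<open>Half the deviation of q_n(u) from its limit, with a minus sign, written as a
      function of the observed path; so the expansion holds at every path and only the smallness of
      \<open>Rem\<close> is probabilistic.\<close>
    define Rem where "Rem n x = - (1/2) * ((\<Sum>i=1..n. (u \<bullet> regressor k x i / \<sigma> i)\<^sup>2) / real n - Q u)" for n x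
    have Rm: "Rem n \<in> borel_measurable (PiM {0..n} (\<lambda>_. borel))" for n
      unfolding Rem_def[abs_def]
      by (intro borel_measurable_times borel_measurable_const borel_measurable_diff borel_measurable_divide
          borel_measurable_sum borel_measurable_power borel_measurable_inner regressor_measurable) auto
    have RP: "Rem n (P n \<omega>) = - (1/2) * (ia.q n u \<omega> - Q u)" for n \<omega>
      unfolding Rem_def ia.q_def ia.U_def
      by (intro arg_cong[where f="\<lambda>z. - (1/2) * (z / real n - Q u)"] sum.cong refl) (auto simp: regP \<sigma>s)
    have "weak_conv_m (\<lambda>n. distr M borel (\<lambda>\<omega>. - (1/2) * (ia.q n u \<omega> - Q u))) (return borel 0)"
    proof (rule gn.weak_conv_0_of_L1)
      show "integrable M (\<lambda>\<omega>. - (1/2) * (ia.q n u \<omega> - Q u))" for n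
        by (intro integrable_mult_right Bochner_Integration.integrable_diff ia.q_integrable) simp
      have "(\<lambda>n. 1/2 * gn.expectation (\<lambda>\<omega>. \<bar>ia.q n u \<omega> - Q u\<bar>)) \<longlonglongrightarrow> 0"
        by (rule tendsto_mult_right_zero[OF lln])
      then show "(\<lambda>n. gn.expectation (\<lambda>\<omega>. \<bar>- (1/2) * (ia.q n u \<omega> - Q u)\<bar>)) \<longlonglongrightarrow> 0"
        by (simp add: abs_mult)
    qed
    then have "weak_conv_m (\<lambda>n. distr (ar_law M \<xi> \<theta>\<^sub>0 n) borel (Rem n)) (return borel 0)"
      unfolding distr_law[OF Rm] RP .
    moreover have "ln (likelihood k \<sigma> n (\<theta>\<^sub>0 + rate n *v u) x / likelihood k \<sigma> n \<theta>\<^sub>0 x)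
        = u \<bullet> ((1 / sqrt (real n)) *\<^sub>R score k \<sigma> \<theta>\<^sub>0 n x) - 1/2 * (u \<bullet> (fisher_info \<theta>\<^sub>0 *v u)) + Rem n x"
      if "n \<ge> 1" for n x
      unfolding log_likelihood_ratio_rate[OF that] FI Rem_def Q_def[symmetric]
      by (simp add: algebra_simps)
    ultimately show ?thesis by blast
  qed
  show ?thesis using ex1 gauss clt lan by blast
qed

end
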